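(* Let $M$ be a spherically symmetric $C^2$ manifold of dimension $N$, let $J$ have compact support contained in $[0,1]$, and for $\varepsilon>0$ set $$L_\varepsilon u(x)=\frac1{\varepsilon^2}\int_M\varepsilon^{-N}J\Big(\frac{s_{xy}}{\varepsilon}\Big)\big(u(y)-u(x)\big)\,d\mu_y .$$ Let $\mathfrak q=\frac1{2N}\int_{\mathbb{R}^N}J(|z|)\,|z|^2\,dz$. If $u\in C^{2+\alpha}_{loc}(M)$, then $$L_\varepsilon u(x)\to\mathfrak q\,\Delta_M u(x)\quad\text{as }\varepsilon\to0$$ locally uniformly in $M$, where $\Delta_M$ is the Laplace–Beltrami operator on $M$. If $u\in C^{2+\alpha}(M)$ globally, then the convergence is uniform in $M$ and, moreover, $$\big|L_\varepsilon u(x)-\mathfrak q\,\Delta_M u(x)\big|\le C\,\|u\|_{C^{2+\alpha}(M)}\,\varepsilon^\alpha\quad\text{for all }x\in M.$$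
   Context: $M$ is an $N$-dimensional Riemannian manifold without boundary, with a fixed point $O$ and a family of isometries $\tau_x:M\to M$, $x\in M$, such that $\tau_x(x)=O$. $s_{xy}$ is the geodesic distance between $x$ and $y$. $J:\mathbb{R}_{\ge0}\to\mathbb{R}_{\ge0}$ is normalized by $\int_M J(s_{xO})\,d\mu_x=1$. "Spherically symmetric $C^2$ manifold" means: around any point of $M$ (taken as center) there are a small ball $B_R$, disjoint from the cut locus of its center, and polar coordinates $(r,\theta)$, $\theta\in\mathbb{S}^{N-1}$, in which the Riemannian metric on the punctured ball is $ds^2=dr^2+\psi^2(r)\,d\theta^2$, where $d\theta^2$ is the standard metric on $\mathbb{S}^{N-1}$, $\psi\in C^2$, $\psi(0)=0$ and $\psi'(0)\ne0$ (without loss of generality $\psi'(0)=1$). The measure $\mu$ is invariant under the isometries $\tau_x$ and in these coordinates is $d\mu=\psi^{N-1}(r)\,dr\,d\theta$, with $d\theta$ here the usual area element of $\mathbb{S}^{N-1}$; the Laplace–Beltrami operator is $$\Delta_M=\partial_{rr}+(N-1)\frac{\psi'}{\psi}\partial_r+\frac1{\psi^2}\Delta_{\mathbb{S}^{N-1}}.$$ $C^{2+\alpha}_{loc}(M)$ and $C^{2+\alpha}(M)$ are the usual local and global Hölder spaces with exponent $\alpha$, and $C$ is a constant not depending on $u$, $x$ or $\varepsilon$.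
   Formalization: The final estimate is stated for all 0 < ε < ε₀, with ε₀ independent of u and x; for arbitrary ε > 0 it fails, e.g. on hyperbolic space, where volume grows exponentially. *)

theory Defs
  imports "HOL-Analysis.Analysis"
begin

section \<open>Functions of class \<open>C\<^sup>k\<close> on open subsets of Euclidean space\<close>

definition partial :: "'n \<Rightarrow> (real^'n \<Rightarrow> 'b::real_normed_vector) \<Rightarrow> real^'n \<Rightarrow> 'b" where
  "partial i f x = frechet_derivative f (at x) (axis i 1)"

primrec Ck_on :: "nat \<Rightarrow> (real^'n) set \<Rightarrow> (real^'n \<Rightarrow> 'b::real_normed_vector) \<Rightarrow> bool" where
  "Ck_on 0 S f \<longleftrightarrow> continuous_on S f"
| "Ck_on (Suc k) S f \<longleftrightarrow> (\<forall>x\<in>S. f differentiable (at x)) \<and> (\<forall>i. Ck_on k S (partial i f))"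


section \<open>Riemannian manifolds\<close>

text \<open>The manifold is the whole of a Hausdorff, second countable type \<open>'m\<close>, and its dimension is
  \<open>CARD('n)\<close>. A chart is a pair \<open>(U, \<phi>)\<close>; the values of \<open>\<phi>\<close> outside \<open>U\<close> are irrelevant. Charts map
  onto open subsets of \<open>real^'n\<close>, so there is no boundary.\<close>

type_synonym ('m, 'n) chart = "'m set \<times> ('m \<Rightarrow> real^'n)"

abbreviation chart_image :: "('m, 'n) chart \<Rightarrow> (real^'n) set" where
  "chart_image c \<equiv> snd c ` fst c"

abbreviation chart_inv :: "('m, 'n) chart \<Rightarrow> real^'n \<Rightarrow> 'm" where
  "chart_inv c \<equiv> inv_into (fst c) (snd c)"

definition is_chart :: "('m::topological_space, 'n::finite) chart \<Rightarrow> bool" where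
  "is_chart c \<longleftrightarrow> open (fst c) \<and> open (chart_image c) \<and>
     homeomorphism (fst c) (chart_image c) (snd c) (chart_inv c)"

text \<open>The coordinate expression of a map \<open>f\<close> of the manifold into itself, and its domain. For
  \<open>f = id\<close> this is a transition map.\<close>

definition local_rep :: "('m \<Rightarrow> 'm) \<Rightarrow> ('m, 'n) chart \<Rightarrow> ('m, 'n) chart \<Rightarrow> real^'n \<Rightarrow> real^'n" where
  "local_rep f c c' = snd c' \<circ> f \<circ> chart_inv c"

definition local_dom :: "('m \<Rightarrow> 'm) \<Rightarrow> ('m, 'n) chart \<Rightarrow> ('m, 'n) chart \<Rightarrow> (real^'n) set" where
  "local_dom f c c' = snd c ` (fst c \<inter> f -` fst c')"

definition compatible :: "('m, 'n::finite) chart \<Rightarrow> ('m, 'n) chart \<Rightarrow> bool" where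
  "compatible c c' \<longleftrightarrow> Ck_on 3 (local_dom id c c') (local_rep id c c') \<and>
     Ck_on 3 (local_dom id c' c) (local_rep id c' c)"

text \<open>A differentiable structure of class \<open>C\<^sup>3\<close>, i.e. a maximal \<open>C\<^sup>3\<close> atlas. This is the least
  regularity for which metrics of class \<open>C\<^sup>2\<close> and the spaces \<open>C\<^sup>2\<^sup>+\<^sup>\<alpha>\<close> do not depend on the choice of
  charts.\<close>

definition differentiable_structure :: "('m::topological_space, 'n::finite) chart set \<Rightarrow> bool" where
  "differentiable_structure A \<longleftrightarrow>
     (\<forall>c\<in>A. is_chart c) \<and> (\<Union>c\<in>A. fst c) = UNIV \<and>
     (\<forall>c\<in>A. \<forall>c'\<in>A. compatible c c') \<and>
     (\<forall>c. is_chart c \<and> (\<forall>c'\<in>A. compatible c c') \<longrightarrow> c \<in> A)"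

text \<open>A metric tensor \<open>g\<close> is given by its matrix \<open>g c x\<close> in each chart \<open>c\<close>, at the point with
  coordinates \<open>x\<close>.\<close>

type_synonym ('m, 'n) metric = "('m, 'n) chart \<Rightarrow> real^'n \<Rightarrow> real^'n^'n"

definition preserves_metric ::
  "('m, 'n::finite) chart set \<Rightarrow> ('m, 'n) metric \<Rightarrow> ('m \<Rightarrow> 'm) \<Rightarrow> bool" where
  "preserves_metric A g f \<longleftrightarrow> (\<forall>c\<in>A. \<forall>c'\<in>A. \<forall>x\<in>local_dom f c c'.
     (let D = matrix (frechet_derivative (local_rep f c c') (at x))
      in g c x = transpose D ** g c' (local_rep f c c' x) ** D))"

text \<open>Preservation of \<open>g\<close> by \<open>id\<close> is the transformation law of a symmetric covariant 2-tensor.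
  Connectedness makes the geodesic distance finite.\<close>

definition riemannian_manifold ::
  "('m::{t2_space, second_countable_topology}, 'n::finite) chart set \<Rightarrow> ('m, 'n) metric \<Rightarrow> bool" where
  "riemannian_manifold A g \<longleftrightarrow>
     connected (UNIV :: 'm set) \<and> differentiable_structure A \<and>
     (\<forall>c\<in>A. Ck_on 2 (chart_image c) (g c) \<and>
        (\<forall>x\<in>chart_image c. transpose (g c x) = g c x \<and> (\<forall>v. v \<noteq> 0 \<longrightarrow> v \<bullet> (g c x *v v) > 0))) \<and>
     preserves_metric A g id"

definition Ck_map :: "nat \<Rightarrow> ('m::topological_space, 'n::finite) chart set \<Rightarrow> ('m \<Rightarrow> 'm) \<Rightarrow> bool" where
  "Ck_map k A f \<longleftrightarrow> continuous_on UNIV f \<and>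
     (\<forall>c\<in>A. \<forall>c'\<in>A. Ck_on k (local_dom f c c') (local_rep f c c'))"

definition riemannian_isometry ::
  "('m::topological_space, 'n::finite) chart set \<Rightarrow> ('m, 'n) metric \<Rightarrow> ('m \<Rightarrow> 'm) \<Rightarrow> bool" where
  "riemannian_isometry A g f \<longleftrightarrow>
     bij f \<and> Ck_map 3 A f \<and> Ck_map 3 A (inv f) \<and> preserves_metric A g f"

text \<open>The Riemannian volume measure, determined by its density \<open>sqrt (det g)\<close> in every chart.\<close>

definition riemannian_measure ::
  "('m::topological_space, 'n::finite) chart set \<Rightarrow> ('m, 'n) metric \<Rightarrow> 'm measure \<Rightarrow> bool" where
  "riemannian_measure A g \<mu> \<longleftrightarrow> sets \<mu> = sets borel \<and>
     (\<forall>c\<in>A. \<forall>B\<in>sets borel. B \<subseteq> fst c \<longrightarrow>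
        emeasure \<mu> B = (\<integral>\<^sup>+x\<in>snd c ` B. ennreal (sqrt (det (g c x))) \<partial>lborel))"


section \<open>Geodesic distance, cut locus, Laplace--Beltrami operator\<close>

text \<open>Chart-independent quantities are evaluated in an arbitrarily chosen chart around the point.\<close>

definition chart_at :: "('m, 'n) chart set \<Rightarrow> 'm \<Rightarrow> ('m, 'n) chart" where
  "chart_at A p = (SOME c. c \<in> A \<and> p \<in> fst c)"

definition piecewise_C1_curve ::
  "('m::topological_space, 'n::finite) chart set \<Rightarrow> (real \<Rightarrow> 'm) \<Rightarrow> bool" where
  "piecewise_C1_curve A \<gamma> \<longleftrightarrow> continuous_on {0..1} \<gamma> \<and>
     (\<exists>S. finite S \<and> (\<forall>c\<in>A. (snd c \<circ> \<gamma>) C1_differentiable_on ({0..1} \<inter> \<gamma> -` fst c - S)))"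

definition speed ::
  "('m, 'n::finite) chart set \<Rightarrow> ('m, 'n) metric \<Rightarrow> (real \<Rightarrow> 'm) \<Rightarrow> real \<Rightarrow> real" where
  "speed A g \<gamma> t = (let c = chart_at A (\<gamma> t); v = vector_derivative (snd c \<circ> \<gamma>) (at t)
     in sqrt (v \<bullet> (g c (snd c (\<gamma> t)) *v v)))"

text \<open>The length may be infinite, since one-sided limits of the velocity at the finitely many
  exceptional times are not required.\<close>

definition curve_length ::
  "('m, 'n::finite) chart set \<Rightarrow> ('m, 'n) metric \<Rightarrow> (real \<Rightarrow> 'm) \<Rightarrow> ennreal" where
  "curve_length A g \<gamma> = (\<integral>\<^sup>+t\<in>{0..1}. ennreal (speed A g \<gamma> t) \<partial>lborel)"

definition geodesic_dist ::
  "('m::topological_space, 'n::finite) chart set \<Rightarrow> ('m, 'n) metric \<Rightarrow> 'm \<Rightarrow> 'm \<Rightarrow> real" where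
  "geodesic_dist A g p q = enn2real
     (INF \<gamma>\<in>{\<gamma>. piecewise_C1_curve A \<gamma> \<and> \<gamma> 0 = p \<and> \<gamma> 1 = q}. curve_length A g \<gamma>)"

text \<open>Unit speed minimizing geodesics on \<open>[0, b]\<close>, as distance-realizing curves.\<close>

definition minimizing_geodesic ::
  "('m::topological_space, 'n::finite) chart set \<Rightarrow> ('m, 'n) metric \<Rightarrow> (real \<Rightarrow> 'm) \<Rightarrow> real \<Rightarrow> bool" where
  "minimizing_geodesic A g \<gamma> b \<longleftrightarrow>
     (\<forall>t\<in>{0..b}. \<forall>t'\<in>{0..b}. geodesic_dist A g (\<gamma> t) (\<gamma> t') = \<bar>t - t'\<bar>)"

text \<open>The points beyond which some minimizing geodesic issuing from \<open>p\<close> stops being minimizing.\<close>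

definition cut_locus ::
  "('m::topological_space, 'n::finite) chart set \<Rightarrow> ('m, 'n) metric \<Rightarrow> 'm \<Rightarrow> 'm set" where
  "cut_locus A g p = {q. \<exists>\<gamma> b. 0 < b \<and> \<gamma> 0 = p \<and> \<gamma> b = q \<and> minimizing_geodesic A g \<gamma> b \<and>
     \<not> (\<exists>\<gamma>' b'. b < b' \<and> (\<forall>t\<in>{0..b}. \<gamma>' t = \<gamma> t) \<and> minimizing_geodesic A g \<gamma>' b')}"

text \<open>\<open>(1 / sqrt (det G)) \<Sum>\<^sub>i \<partial>\<^sub>i (sqrt (det G) \<Sum>\<^sub>j G\<^sup>i\<^sup>j \<partial>\<^sub>j v)\<close>.\<close>

definition laplace_coord ::
  "(real^'n \<Rightarrow> real^'n^'n) \<Rightarrow> (real^'n \<Rightarrow> real) \<Rightarrow> real^'n::finite \<Rightarrow> real" where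
  "laplace_coord G v x = (1 / sqrt (det (G x))) *
     (\<Sum>i\<in>UNIV. partial i (\<lambda>y. sqrt (det (G y)) *
        (\<Sum>j\<in>UNIV. matrix_inv (G y) $ i $ j * partial j v y)) x)"

definition laplace_beltrami ::
  "('m, 'n::finite) chart set \<Rightarrow> ('m, 'n) metric \<Rightarrow> ('m \<Rightarrow> real) \<Rightarrow> 'm \<Rightarrow> real" where
  "laplace_beltrami A g u p = (let c = chart_at A p
     in laplace_coord (g c) (u \<circ> chart_inv c) (snd c p))"


section \<open>Spherically symmetric manifolds\<close>

definition C2_profile :: "real \<Rightarrow> (real \<Rightarrow> real) \<Rightarrow> bool" where
  "C2_profile R \<psi> \<longleftrightarrow> \<psi> 0 = 0 \<and> (\<exists>\<psi>' \<psi>''.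
     (\<forall>r\<in>{0..<R}. (\<psi> has_real_derivative \<psi>' r) (at r within {0..<R})) \<and>
     (\<forall>r\<in>{0..<R}. (\<psi>' has_real_derivative \<psi>'' r) (at r within {0..<R})) \<and>
     continuous_on {0..<R} \<psi>'' \<and> \<psi>' 0 = 1)"

text \<open>Polar coordinates \<open>(r, \<theta>)\<close> on the geodesic ball of radius \<open>R\<close> centred at \<open>p\<close> are encoded by the
  chart with coordinates \<open>z = r \<theta>\<close>, so that \<open>r = norm z\<close> and, off the centre, \<open>\<theta> = sgn z\<close>. The last
  clause is \<open>ds\<^sup>2 = dr\<^sup>2 + \<psi>\<^sup>2(r) d\<theta>\<^sup>2\<close> evaluated on a tangent vector \<open>v\<close>.\<close>

definition polar_chart ::
  "('m::topological_space, 'n::finite) chart set \<Rightarrow> ('m, 'n) metric \<Rightarrow> 'm \<Rightarrow> real \<Rightarrow> (real \<Rightarrow> real)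
     \<Rightarrow> ('m, 'n) chart \<Rightarrow> bool" where
  "polar_chart A g p R \<psi> c \<longleftrightarrow> c \<in> A \<and> 0 < R \<and> C2_profile R \<psi> \<and>
     fst c = {q. geodesic_dist A g p q < R} \<and> fst c \<inter> cut_locus A g p = {} \<and>
     chart_image c = ball 0 R \<and> p \<in> fst c \<and> snd c p = 0 \<and>
     (\<forall>q\<in>fst c. geodesic_dist A g p q = norm (snd c q)) \<and>
     (\<forall>z\<in>ball 0 R - {0}. \<forall>v. v \<bullet> (g c z *v v) =
        (frechet_derivative norm (at z) v)\<^sup>2 +
        (\<psi> (norm z))\<^sup>2 * (norm (frechet_derivative sgn (at z) v))\<^sup>2)"

definition spherically_symmetric ::
  "('m::topological_space, 'n::finite) chart set \<Rightarrow> ('m, 'n) metric \<Rightarrow> bool" where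
  "spherically_symmetric A g \<longleftrightarrow> (\<forall>p. \<exists>R \<psi> c. polar_chart A g p R \<psi> c)"


section \<open>Hoelder spaces\<close>

definition C2_holder_loc ::
  "('m, 'n::finite) chart set \<Rightarrow> real \<Rightarrow> ('m \<Rightarrow> real) \<Rightarrow> bool" where
  "C2_holder_loc A \<alpha> u \<longleftrightarrow> (\<forall>c\<in>A. let v = u \<circ> chart_inv c in
     Ck_on 2 (chart_image c) v \<and>
     (\<forall>i j K. compact K \<and> K \<subseteq> chart_image c \<longrightarrow>
        (\<exists>C. \<forall>x\<in>K. \<forall>y\<in>K.
           \<bar>partial i (partial j v) x - partial i (partial j v) y\<bar> \<le> C * dist x y powr \<alpha>)))"

definition sup_norm :: "(real^'n) set \<Rightarrow> (real^'n \<Rightarrow> real) \<Rightarrow> ennreal" where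
  "sup_norm S f = (SUP x\<in>S. ennreal \<bar>f x\<bar>)"

definition holder_seminorm :: "real \<Rightarrow> (real^'n) set \<Rightarrow> (real^'n \<Rightarrow> real) \<Rightarrow> ennreal" where
  "holder_seminorm \<alpha> S f =
     (SUP x\<in>S. SUP y\<in>S - {x}. ennreal (\<bar>f x - f y\<bar> / dist x y powr \<alpha>))"

definition C2_holder_norm_on ::
  "real \<Rightarrow> (real^'n::finite) set \<Rightarrow> (real^'n \<Rightarrow> real) \<Rightarrow> ennreal" where
  "C2_holder_norm_on \<alpha> S v = sup_norm S v + (\<Sum>i\<in>UNIV. sup_norm S (partial i v)) +
     (\<Sum>i\<in>UNIV. \<Sum>j\<in>UNIV. sup_norm S (partial i (partial j v)) +
        holder_seminorm \<alpha> S (partial i (partial j v)))"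

text \<open>The global norm is the supremum of the Euclidean norms of \<open>u\<close> in the normal coordinates
  \<open>z = r \<theta>\<close> on all balls of a fixed radius \<open>\<rho>\<close>; on a homogeneous manifold different \<open>\<rho>\<close> give
  equivalent norms.\<close>

definition C2_holder_norm ::
  "('m::topological_space, 'n::finite) chart set \<Rightarrow> ('m, 'n) metric \<Rightarrow> real \<Rightarrow> real \<Rightarrow> ('m \<Rightarrow> real)
     \<Rightarrow> ennreal" where
  "C2_holder_norm A g \<rho> \<alpha> u =
     (SUP c\<in>{c. \<exists>p \<psi>. polar_chart A g p \<rho> \<psi> c}. C2_holder_norm_on \<alpha> (ball 0 \<rho>) (u \<circ> chart_inv c))"

definition C2_holder ::
  "('m::topological_space, 'n::finite) chart set \<Rightarrow> ('m, 'n) metric \<Rightarrow> real \<Rightarrow> real \<Rightarrow> ('m \<Rightarrow> real)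
     \<Rightarrow> bool" where
  "C2_holder A g \<rho> \<alpha> u \<longleftrightarrow> C2_holder_loc A \<alpha> u \<and> C2_holder_norm A g \<rho> \<alpha> u < \<infinity>"


section \<open>The rescaled nonlocal operator\<close>

definition L_op ::
  "('m::topological_space, 'n::finite) chart set \<Rightarrow> ('m, 'n) metric \<Rightarrow> 'm measure \<Rightarrow> (real \<Rightarrow> real)
     \<Rightarrow> real \<Rightarrow> ('m \<Rightarrow> real) \<Rightarrow> 'm \<Rightarrow> real" where
  "L_op A g \<mu> J \<epsilon> u x = (1 / \<epsilon>\<^sup>2) *
     (\<integral>y. (1 / \<epsilon> ^ CARD('n)) * J (geodesic_dist A g x y / \<epsilon>) * (u y - u x) \<partial>\<mu>)"

end

theory Submission
  imports Defs
begin

text \<open>Composing a polar chart at \<open>p\<^sub>0\<close> with \<open>\<tau> x\<close> yields, at every point \<open>x\<close>, a polar chart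
  \<open>z = r \<theta>\<close> in which the metric has one and the same matrix \<open>G z\<close>. This matrix is the identity at the
  centre and even in \<open>z\<close>, so its first derivatives vanish at the centre. Hence the Laplace--Beltrami
  operator at \<open>x\<close> is the flat Laplacian of the coordinate expression \<open>v\<close> at \<open>0\<close>, and the nonlocal operator
  is an average of \<open>v - v 0\<close> against a radial kernel with an even density \<open>1 + O(r)\<close>. In the second order
  Taylor expansion of \<open>v\<close> the linear term averages out, the quadratic term produces \<open>\<q>\<close> times the flat
  Laplacian, and the remainder is controlled by the modulus of continuity of the second derivatives of
  \<open>v\<close> at \<open>0\<close>.

  For functions that are only locally \<open>C\<^sup>2\<^sup>+\<^sup>\<alpha>\<close> this modulus has to be uniform in the centre \<open>x\<close>, although
  \<open>\<tau> x\<close> need not depend continuously on \<open>x\<close>. The transition maps between the polar charts are isometries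
  of \<open>G\<close>, so their second derivatives are a continuous function of the point, its image and the first
  derivatives (the Christoffel formula), and the latter range over a compact set.\<close>

section \<open>Calculus in coordinates\<close>


text \<open>That the metric is the identity at the centre and even is read off the quadratic form in
  \<open>polar_chart\<close> by symmetry and continuity, not by expanding \<open>\<psi>\<close>.
  \<open>laplace_beltrami\<close> is evaluated in an arbitrarily chosen chart, so its value at a
  centre has to be carried through a transition map with Jacobian K. Written as the divergence of a
  flux, the operator changes by the factor det K K^-1, whose columns are divergence-free (Piola).
  Hence two derivatives of the transition map and one of the metric suffice. The constant
  \<open>\<q>\<close> combines the 1/2 of Taylor's formula with 1/N, the share of one coordinate in
  the second moment of a radial kernel. The kernel J(|w|) must be integrable on flat space for the
  linear term to make sense. Near 0 this comes from the normalisation on the manifold, away from 0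
  from the second moment. \<open>geodesic_dist\<close> is a real number even when no curve has
  finite length; the triangle inequality is therefore proved for the extended distance and
  transferred where finiteness is known.\<close>

lemma partial_eqI:
  assumes "(f has_derivative f') (at x)"
  shows "partial i f x = f' (axis i 1)"
  using frechet_derivative_at[OF assms] by (simp add: partial_def)

lemma vec_eq_sum_axis: "h = (\<Sum>i\<in>UNIV. h $ i *\<^sub>R axis i (1::real))"
  using basis_expansion[of h] by (simp add: scalar_mult_eq_scaleR)

lemma has_derivative_partial:
  fixes f :: "real^'n \<Rightarrow> 'b::real_normed_vector"
  assumes "f differentiable (at x)"
  shows "(f has_derivative (\<lambda>h. \<Sum>i\<in>UNIV. h $ i *\<^sub>R partial i f x)) (at x)"
proof -
  let ?D = "frechet_derivative f (at x)"
  have D: "(f has_derivative ?D) (at x)"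
    using assms frechet_derivative_works by blast
  interpret linear ?D
    using D has_derivative_linear by blast
  have "?D h = (\<Sum>i\<in>UNIV. h $ i *\<^sub>R partial i f x)" for h
  proof -
    have "?D h = ?D (\<Sum>i\<in>UNIV. h $ i *\<^sub>R axis i 1)"
      using vec_eq_sum_axis[of h] by simp
    also have "\<dots> = (\<Sum>i\<in>UNIV. h $ i *\<^sub>R partial i f x)"
      by (simp add: sum scale partial_def)
    finally show ?thesis .
  qed
  then have "?D = (\<lambda>h. \<Sum>i\<in>UNIV. h $ i *\<^sub>R partial i f x)" by blast
  with D show ?thesis by simp
qed

lemma matrix_frechet_derivative:
  fixes f :: "real^'n \<Rightarrow> real^'m"
  shows "matrix (frechet_derivative f (at x)) $ a $ i = partial i f x $ a"
  by (simp add: matrix_def partial_def)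

lemma partial_cong_open:
  assumes "open S" "x \<in> S" "\<And>y. y \<in> S \<Longrightarrow> f y = g y"
  shows "partial i f x = partial i g x"
proof -
  have "(f has_derivative D) (at x) \<longleftrightarrow> (g has_derivative D) (at x)" for D
    using has_derivative_transform_within_open[of f D x UNIV S g]
      has_derivative_transform_within_open[of g D x UNIV S f] assms by auto
  then show ?thesis by (simp add: partial_def frechet_derivative_def)
qed

lemma differentiable_cong_open:
  assumes "f differentiable (at x)" "open S" "x \<in> S" "\<And>y. y \<in> S \<Longrightarrow> f y = g y"
  shows "g differentiable (at x)"
  using assms has_derivative_transform_within_open[of f _ x UNIV S g]
  unfolding differentiable_def by metis

lemma Ck_on_cong:
  assumes "Ck_on k S f" "open S" "\<And>y. y \<in> S \<Longrightarrow> f y = g y"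
  shows "Ck_on k S g"
  using assms
proof (induction k arbitrary: f g)
  case 0
  then show ?case by (simp cong: continuous_on_cong)
next
  case (Suc k)
  have "g differentiable (at x)" if "x \<in> S" for x
    by (rule differentiable_cong_open[of f x S g]) (use Suc.prems that in simp_all)
  moreover have "Ck_on k S (partial i g)" for i
  proof (rule Suc.IH[of "partial i f"])
    show "Ck_on k S (partial i f)" using Suc.prems(1) by simp
    show "partial i f y = partial i g y" if "y \<in> S" for y
      by (rule partial_cong_open[OF Suc.prems(2) that Suc.prems(3)])
  qed (rule Suc.prems)
  ultimately show ?case by simp
qed

lemma Ck_on_subset: "Ck_on k S f \<Longrightarrow> T \<subseteq> S \<Longrightarrow> Ck_on k T f"
  by (induction k arbitrary: f) (auto intro: continuous_on_subset)

lemma Ck_on_continuous_on: "Ck_on k S f \<Longrightarrow> continuous_on S f"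
  by (cases k) (auto intro!: continuous_at_imp_continuous_on differentiable_imp_continuous_within)

lemma Ck_on_Suc_differentiable: "Ck_on (Suc k) S f \<Longrightarrow> x \<in> S \<Longrightarrow> f differentiable (at x)"
  by simp

lemma Ck_on_decr: "Ck_on (Suc k) S f \<Longrightarrow> Ck_on k S f"
  by (induction k arbitrary: f)
    (auto intro!: continuous_at_imp_continuous_on differentiable_imp_continuous_within)

lemma partial_bounded_linear:
  assumes "bounded_linear l" "f differentiable (at x)"
  shows "partial i (\<lambda>x. l (f x)) x = l (partial i f x)"
proof -
  obtain D where D: "(f has_derivative D) (at x)"
    using assms(2) differentiable_def by blast
  show ?thesis
    using partial_eqI[OF bounded_linear.has_derivative[OF assms(1) D]] partial_eqI[OF D] by simp
qed

lemma Ck_on_bounded_linear: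
  assumes "bounded_linear l" "open S" "Ck_on k S f"
  shows "Ck_on k S (\<lambda>x. l (f x))"
  using assms(3)
proof (induction k arbitrary: f)
  case 0
  then show ?case unfolding Ck_on.simps by (rule bounded_linear.continuous_on[OF assms(1)])
next
  case (Suc k)
  have "(\<lambda>x. l (f x)) differentiable (at x)" if x: "x \<in> S" for x
  proof -
    obtain D where "(f has_derivative D) (at x)"
      using Ck_on_Suc_differentiable[OF Suc.prems x] unfolding differentiable_def ..
    from bounded_linear.has_derivative[OF assms(1) this] show ?thesis
      by (rule differentiableI)
  qed
  moreover have "Ck_on k S (partial i (\<lambda>x. l (f x)))" for i
  proof (rule Ck_on_cong[OF Suc.IH[of "partial i f"] assms(2)])
    show "Ck_on k S (partial i f)" using Suc.prems by simp
    show "l (partial i f y) = partial i (\<lambda>x. l (f x)) y" if "y \<in> S" for y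
      by (rule partial_bounded_linear[OF assms(1), symmetric])
        (rule Ck_on_Suc_differentiable[OF Suc.prems that])
  qed
  ultimately show ?case by simp
qed

lemma Ck_on_nth: "open S \<Longrightarrow> Ck_on k S f \<Longrightarrow> Ck_on k S (\<lambda>x. f x $ a)"
  by (rule Ck_on_bounded_linear[OF bounded_linear_vec_nth])

lemma partial_nth: "f differentiable (at x) \<Longrightarrow> partial i (\<lambda>x. f x $ a) x = partial i f x $ a"
  by (rule partial_bounded_linear[OF bounded_linear_vec_nth])

lemma partial_compose:
  fixes f :: "real^'m \<Rightarrow> 'b::real_normed_vector" and \<phi> :: "real^'n \<Rightarrow> real^'m"
  assumes "\<phi> differentiable (at x)" "f differentiable (at (\<phi> x))"
  shows "partial i (\<lambda>x. f (\<phi> x)) x = (\<Sum>a\<in>UNIV. (partial i \<phi> x $ a) *\<^sub>R partial a f (\<phi> x))"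
proof -
  have "(f \<circ> \<phi> has_derivative
      (\<lambda>h. \<Sum>a\<in>UNIV. h $ a *\<^sub>R partial a f (\<phi> x)) \<circ> (\<lambda>h. \<Sum>i\<in>UNIV. h $ i *\<^sub>R partial i \<phi> x)) (at x)"
    by (intro diff_chain_at has_derivative_partial assms)
  from partial_eqI[OF this, of i]
  have "partial i (f \<circ> \<phi>) x =
     (\<Sum>a\<in>UNIV. (\<Sum>j\<in>UNIV. (axis i 1 $ j) *\<^sub>R partial j \<phi> x) $ a *\<^sub>R partial a f (\<phi> x))"
    by simp
  also have "(\<Sum>j\<in>UNIV. (axis i (1::real) $ j) *\<^sub>R partial j \<phi> x) = partial i \<phi> x"
    by (simp add: axis_def if_distrib[of "\<lambda>c. c *\<^sub>R _"] cong: if_cong)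
  finally show ?thesis by (simp add: o_def)
qed

section \<open>Restriction to lines and symmetry of second derivatives\<close>

lemma has_real_derivative_line:
  fixes f :: "real^'n \<Rightarrow> real"
  assumes "f differentiable (at (x + t *\<^sub>R h))"
  shows "((\<lambda>t. f (x + t *\<^sub>R h)) has_real_derivative (\<Sum>i\<in>UNIV. h $ i * partial i f (x + t *\<^sub>R h))) (at t)"
proof -
  have "((\<lambda>t. x + t *\<^sub>R h) has_derivative (\<lambda>s. s *\<^sub>R h)) (at t)"
    by (auto intro!: derivative_eq_intros)
  from diff_chain_at[OF this has_derivative_partial[OF assms]]
  have "((\<lambda>t. f (x + t *\<^sub>R h)) has_derivative (\<lambda>s. \<Sum>i\<in>UNIV. (s *\<^sub>R h) $ i *\<^sub>R partial i f (x + t *\<^sub>R h))) (at t)"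
    by (simp add: o_def)
  moreover have "(\<lambda>s. \<Sum>i\<in>UNIV. (s *\<^sub>R h) $ i *\<^sub>R partial i f (x + t *\<^sub>R h))
     = (*) (\<Sum>i\<in>UNIV. h $ i * partial i f (x + t *\<^sub>R h))"
    by (simp add: fun_eq_iff sum_distrib_left sum_distrib_right mult_ac)
  ultimately show ?thesis by (simp add: has_field_derivative_def)
qed

lemma has_real_derivative_axis_line:
  fixes f :: "real^'n \<Rightarrow> real"
  assumes "f differentiable (at (x + t *\<^sub>R axis i 1))"
  shows "((\<lambda>t. f (x + t *\<^sub>R axis i 1)) has_real_derivative partial i f (x + t *\<^sub>R axis i 1)) (at t)"
proof -
  have "(\<Sum>j\<in>UNIV. axis i (1::real) $ j * partial j f y) = partial i f y" for y
    by (simp add: axis_def if_distrib[of "\<lambda>c. c * _"] cong: if_cong)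
  with has_real_derivative_line[OF assms] show ?thesis by simp
qed

text \<open>The mean value theorem is applied twice: in direction i to the increment of f in
  direction j, then in direction j to \<open>partial i f\<close>. The condition 2t < r keeps the
  whole parallelogram in the ball.\<close>

lemma second_difference_mvt:
  fixes f :: "real^'n \<Rightarrow> real"
  assumes C2: "Ck_on 2 (ball x r) f" and t: "0 < t" "2 * t < r"
  shows "\<exists>\<xi> \<eta>. 0 < \<xi> \<and> \<xi> < t \<and> 0 < \<eta> \<and> \<eta> < t \<and>
    f (x + t *\<^sub>R axis i 1 + t *\<^sub>R axis j 1) - f (x + t *\<^sub>R axis i 1)
      - f (x + t *\<^sub>R axis j 1) + f x
    = t * t * partial j (partial i f) (x + \<xi> *\<^sub>R axis i 1 + \<eta> *\<^sub>R axis j 1)"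
proof -
  have inb: "x + a *\<^sub>R axis i 1 + b *\<^sub>R axis j 1 \<in> ball x r" if "0 \<le> a" "a \<le> t" "0 \<le> b" "b \<le> t" for a b
  proof -
    have "norm (a *\<^sub>R axis i 1 + b *\<^sub>R axis j 1 :: real^'n) \<le> a + b"
      using norm_triangle_ineq[of "a *\<^sub>R axis i 1" "b *\<^sub>R axis j 1 :: real^'n"] that by simp
    moreover have "dist x (x + a *\<^sub>R axis i 1 + b *\<^sub>R axis j 1) = norm (a *\<^sub>R axis i 1 + b *\<^sub>R axis j 1 :: real^'n)"
      using norm_minus_cancel[of "a *\<^sub>R axis i 1 + b *\<^sub>R axis j 1 :: real^'n"] by (simp add: dist_norm)
    ultimately show ?thesis using that t by simp
  qed
  have d1: "f differentiable (at y)" if "y \<in> ball x r" for y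
    using C2 that by (simp add: numeral_2_eq_2)
  have d2: "partial i f differentiable (at y)" if "y \<in> ball x r" for y
    using C2 that by (simp add: numeral_2_eq_2)
  define \<phi> where "\<phi> s = f ((x + t *\<^sub>R axis j 1) + s *\<^sub>R axis i 1) - f (x + s *\<^sub>R axis i 1)" for s
  have inb0: "x + a *\<^sub>R axis i 1 \<in> ball x r" if "0 \<le> a" "a \<le> t" for a
    using inb[of a 0] that t by simp
  have inb1: "x + t *\<^sub>R axis j 1 + a *\<^sub>R axis i 1 \<in> ball x r" if "0 \<le> a" "a \<le> t" for a
    using inb[of a t] that t by (simp add: add_ac)
  have "(\<phi> has_real_derivative partial i f ((x + t *\<^sub>R axis j 1) + s *\<^sub>R axis i 1)
      - partial i f (x + s *\<^sub>R axis i 1)) (at s)" if "0 \<le> s" "s \<le> t" for s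
    unfolding \<phi>_def
    by (intro DERIV_diff has_real_derivative_axis_line d1 inb0 inb1 that)
  from MVT2[OF t(1) this] obtain \<xi> where \<xi>: "0 < \<xi>" "\<xi> < t"
    "\<phi> t - \<phi> 0 = (t - 0) * (partial i f ((x + t *\<^sub>R axis j 1) + \<xi> *\<^sub>R axis i 1)
      - partial i f (x + \<xi> *\<^sub>R axis i 1))"
    by blast
  have "((\<lambda>s. partial i f ((x + \<xi> *\<^sub>R axis i 1) + s *\<^sub>R axis j 1)) has_real_derivative
      partial j (partial i f) ((x + \<xi> *\<^sub>R axis i 1) + s *\<^sub>R axis j 1)) (at s)" if "0 \<le> s" "s \<le> t" for s
    by (intro has_real_derivative_axis_line d2 inb) (use that \<xi> in auto)
  from MVT2[OF t(1) this] obtain \<eta> where \<eta>: "0 < \<eta>" "\<eta> < t"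
    "partial i f ((x + \<xi> *\<^sub>R axis i 1) + t *\<^sub>R axis j 1) - partial i f ((x + \<xi> *\<^sub>R axis i 1) + 0 *\<^sub>R axis j 1)
      = (t - 0) * partial j (partial i f) ((x + \<xi> *\<^sub>R axis i 1) + \<eta> *\<^sub>R axis j 1)"
    by blast
  have eq: "(x + t *\<^sub>R axis j 1) + s *\<^sub>R axis i 1 = (x + s *\<^sub>R axis i 1) + t *\<^sub>R axis j 1" for s
    by (simp only: add.assoc add.commute[of "t *\<^sub>R axis j 1"])
  have "f (x + t *\<^sub>R axis i 1 + t *\<^sub>R axis j 1) - f (x + t *\<^sub>R axis i 1)
      - f (x + t *\<^sub>R axis j 1) + f x = \<phi> t - \<phi> 0"
    by (simp add: \<phi>_def eq)
  also have "\<dots> = t * t * partial j (partial i f) (x + \<xi> *\<^sub>R axis i 1 + \<eta> *\<^sub>R axis j 1)"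
    using \<xi>(3) \<eta>(3) by (simp add: eq)
  finally have "f (x + t *\<^sub>R axis i 1 + t *\<^sub>R axis j 1) - f (x + t *\<^sub>R axis i 1)
      - f (x + t *\<^sub>R axis j 1) + f x
    = t * t * partial j (partial i f) (x + \<xi> *\<^sub>R axis i 1 + \<eta> *\<^sub>R axis j 1)" .
  then show ?thesis using \<xi>(1,2) \<eta>(1,2) by blast
qed

text \<open>The second difference is symmetric in i and j, so both mixed derivatives take a common
  value at points arbitrarily close to x; their continuity forces equality at x.\<close>

lemma partial_commute:
  fixes f :: "real^'n \<Rightarrow> real"
  assumes C2: "Ck_on 2 S f" and S: "open S" "x \<in> S"
  shows "partial i (partial j f) x = partial j (partial i f) x"
proof (rule ccontr)
  define e where "e = dist (partial i (partial j f) x) (partial j (partial i f) x) / 2"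
  assume "\<not> ?thesis"
  then have e: "e > 0" by (simp add: e_def)
  have cont: "continuous (at x) (partial a (partial b f))" for a b
    using C2 S by (simp add: numeral_2_eq_2 continuous_on_eq_continuous_at)
  obtain r where r: "r > 0" "ball x r \<subseteq> S" using S openE by blast
  obtain d1 where d1: "d1 > 0" "\<And>y. dist y x < d1 \<Longrightarrow> dist (partial i (partial j f) y) (partial i (partial j f) x) < e"
    using cont[of i j] e unfolding continuous_at_eps_delta by blast
  obtain d2 where d2: "d2 > 0" "\<And>y. dist y x < d2 \<Longrightarrow> dist (partial j (partial i f) y) (partial j (partial i f) x) < e"
    using cont[of j i] e unfolding continuous_at_eps_delta by blast
  \<comment> \<open>Dividing by 3 leaves 2t strictly below all three radii, and the intermediate
    points lie at distance less than 2t from x.\<close>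
  define t where "t = min r (min d1 d2) / 3"
  have t: "0 < t" "2 * t < r" "2 * t < d1" "2 * t < d2" using r d1 d2 by (auto simp: t_def)
  have C2': "Ck_on 2 (ball x r) f" using Ck_on_subset[OF C2 r(2)] .
  have close: "dist (x + a *\<^sub>R axis k 1 + b *\<^sub>R axis l 1) x < 2 * t" if "0 < a" "a < t" "0 < b" "b < t" for a b k l
  proof -
    have "norm (a *\<^sub>R axis k 1 + b *\<^sub>R axis l 1 :: real^'n) \<le> a + b"
      using norm_triangle_ineq[of "a *\<^sub>R axis k 1" "b *\<^sub>R axis l 1 :: real^'n"] that by simp
    then show ?thesis using that by (simp add: dist_norm add.assoc)
  qed
  obtain \<xi> \<eta> where a: "0 < \<xi>" "\<xi> < t" "0 < \<eta>" "\<eta> < t"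
    "f (x + t *\<^sub>R axis i 1 + t *\<^sub>R axis j 1) - f (x + t *\<^sub>R axis i 1)
      - f (x + t *\<^sub>R axis j 1) + f x
    = t * t * partial j (partial i f) (x + \<xi> *\<^sub>R axis i 1 + \<eta> *\<^sub>R axis j 1)"
    using second_difference_mvt[OF C2' t(1,2)] by blast
  obtain \<xi>' \<eta>' where b: "0 < \<xi>'" "\<xi>' < t" "0 < \<eta>'" "\<eta>' < t"
    "f (x + t *\<^sub>R axis j 1 + t *\<^sub>R axis i 1) - f (x + t *\<^sub>R axis j 1)
      - f (x + t *\<^sub>R axis i 1) + f x
    = t * t * partial i (partial j f) (x + \<xi>' *\<^sub>R axis j 1 + \<eta>' *\<^sub>R axis i 1)"
    using second_difference_mvt[OF C2' t(1,2)] by blast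
  have "t * t * partial j (partial i f) (x + \<xi> *\<^sub>R axis i 1 + \<eta> *\<^sub>R axis j 1)
     = t * t * partial i (partial j f) (x + \<xi>' *\<^sub>R axis j 1 + \<eta>' *\<^sub>R axis i 1)"
    using a(5) b(5) add.commute[of "t *\<^sub>R axis i (1::real) :: real^'n" "t *\<^sub>R axis j 1"]
    by (simp only: add.assoc)
  then have "partial j (partial i f) (x + \<xi> *\<^sub>R axis i 1 + \<eta> *\<^sub>R axis j 1)
     = partial i (partial j f) (x + \<xi>' *\<^sub>R axis j 1 + \<eta>' *\<^sub>R axis i 1)"
    using t(1) by simp
  moreover have "dist (partial j (partial i f) (x + \<xi> *\<^sub>R axis i 1 + \<eta> *\<^sub>R axis j 1)) (partial j (partial i f) x) < e"
    by (rule d2(2)) (use close[OF a(1-4), of i j] t in linarith)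
  moreover have "dist (partial i (partial j f) (x + \<xi>' *\<^sub>R axis j 1 + \<eta>' *\<^sub>R axis i 1)) (partial i (partial j f) x) < e"
    by (rule d1(2)) (use close[OF b(1-4), of j i] t in linarith)
  ultimately have "dist (partial i (partial j f) x) (partial j (partial i f) x) < e + e"
    by (simp add: dist_real_def)
  then show False by (simp add: e_def)
qed

section \<open>Determinants and inverses of matrix-valued functions\<close>

lemma
  fixes A :: "real^'n^'n"
  assumes "det A \<noteq> 0"
  shows matrix_inv_right: "A ** matrix_inv A = mat 1"
    and matrix_inv_left: "matrix_inv A ** A = mat 1"
proof -
  have "\<exists>B. A ** B = mat 1 \<and> B ** A = mat 1"
    using assms invertible_det_nz[of A] by (simp add: invertible_def)
  then have "A ** matrix_inv A = mat 1 \<and> matrix_inv A ** A = mat 1"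
    unfolding matrix_inv_def by (rule someI_ex)
  then show "A ** matrix_inv A = mat 1" "matrix_inv A ** A = mat 1" by auto
qed

text \<open>Cramer's rule: the entries of the inverse are quotients of determinants, which is how
  differentiability and continuity of inversion are obtained.\<close>

lemma matrix_inv_nth:
  fixes A :: "real^'n^'n"
  assumes "det A \<noteq> 0"
  shows "matrix_inv A $ i $ j = det (\<chi> k l. if l = i then axis j 1 $ k else A $ k $ l) / det A"
proof -
  have "A ** matrix_inv A = mat 1"
    by (rule matrix_inv_right[OF assms])
  then have "A *v (matrix_inv A *v axis j 1) = axis j 1"
    by (simp add: matrix_vector_mul_assoc)
  then have "matrix_inv A *v axis j 1 = (\<chi> i. det (\<chi> k l. if l = i then axis j 1 $ k else A $ k $ l) / det A)"
    using cramer[OF assms, of "matrix_inv A *v axis j 1" "axis j 1"] by simp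
  then have "(matrix_inv A *v axis j 1) $ i = det (\<chi> k l. if l = i then axis j 1 $ k else A $ k $ l) / det A"
    by simp
  then show ?thesis by (simp add: matrix_vector_mul_component inner_axis matrix_vector_mult_basis column_def)
qed

lemma differentiable_det:
  fixes A :: "'a::real_normed_vector \<Rightarrow> real^'n^'n"
  assumes "\<And>i j. (\<lambda>x. A x $ i $ j) differentiable (at x)"
  shows "(\<lambda>x. det (A x)) differentiable (at x)"
proof -
  obtain D where D: "\<And>i j. ((\<lambda>x. A x $ i $ j) has_derivative D i j) (at x)"
    using assms unfolding differentiable_def by metis
  show ?thesis
    unfolding det_def
    by (rule differentiableI, rule has_derivative_sum, rule has_derivative_mult[OF has_derivative_const],
      rule has_derivative_prod, rule D)
qed

lemma continuous_on_det [continuous_intros]: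
  fixes A :: "'a::topological_space \<Rightarrow> real^'n^'n"
  assumes "continuous_on S A"
  shows "continuous_on S (\<lambda>x. det (A x))"
  unfolding det_def by (intro continuous_intros assms)

lemma differentiable_matrix_inv:
  fixes A :: "'a::real_normed_vector \<Rightarrow> real^'n^'n"
  assumes A: "\<And>i j. (\<lambda>x. A x $ i $ j) differentiable (at x)"
    and S: "open S" "x \<in> S" "\<And>y. y \<in> S \<Longrightarrow> det (A y) \<noteq> 0"
  shows "(\<lambda>x. matrix_inv (A x) $ i $ j) differentiable (at x)"
proof (rule differentiable_cong_open)
  show "(\<lambda>x. det (\<chi> k l. if l = i then axis j 1 $ k else A x $ k $ l) / det (A x)) differentiable (at x)"
  proof (intro differentiable_divide differentiable_det)
    fix k l show "(\<lambda>x. (\<chi> k l. if l = i then axis j 1 $ k else A x $ k $ l) $ k $ l) differentiable (at x)"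
      by (cases "l = i") (auto simp: A)
  qed (use A S in auto)
qed (use S in \<open>auto simp: matrix_inv_nth\<close>)

lemma continuous_on_matrix_inv:
  fixes A :: "'a::topological_space \<Rightarrow> real^'n^'n"
  assumes A: "continuous_on S A" "\<And>y. y \<in> S \<Longrightarrow> det (A y) \<noteq> 0"
  shows "continuous_on S (\<lambda>x. matrix_inv (A x))"
proof -
  have "continuous_on S (\<lambda>x. det (\<chi> k l. if l = i then axis j 1 $ k else A x $ k $ l) / det (A x))" for i j
  proof (intro continuous_intros A ballI)
    fix k l show "continuous_on S (\<lambda>x. if l = i then axis j 1 $ k else A x $ k $ l)"
      by (cases "l = i") (auto intro!: continuous_intros A)
  qed (use A in auto)
  then have "continuous_on S (\<lambda>x. matrix_inv (A x) $ i $ j)" for i j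
    by (rule continuous_on_eq) (simp add: matrix_inv_nth A)
  then have "continuous_on S (\<lambda>x. \<chi> i j. matrix_inv (A x) $ i $ j)"
    by (intro continuous_on_vec_lambda)
  then show ?thesis by simp
qed

text \<open>A permutation that fixes all indices except possibly i also fixes i. So every other
  permutation than the identity still meets an off-diagonal entry after one factor of the Leibniz
  product is differentiated away, and only the trace survives.\<close>

lemma has_derivative_det_mat_1:
  fixes A :: "'a::real_normed_vector \<Rightarrow> real^'n^'n"
  assumes A: "\<And>i j. ((\<lambda>x. A x $ i $ j) has_derivative A' i j) (at x)" and 1: "A x = mat 1"
  shows "((\<lambda>x. det (A x)) has_derivative (\<lambda>h. \<Sum>i\<in>UNIV. A' i i h)) (at x)"
proof -
  have entry: "A x $ i $ j = (if i = j then 1 else 0)" for i j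
    by (simp add: 1 mat_def)
  let ?P = "{p. p permutes (UNIV::'n set)}"
  have "((\<lambda>x. det (A x)) has_derivative
     (\<lambda>h. \<Sum>p\<in>?P. of_int (sign p) * (\<Sum>i\<in>UNIV. A' i (p i) h * (\<Prod>j\<in>UNIV - {i}. A x $ j $ p j)))) (at x)"
    unfolding det_def by (auto intro!: derivative_eq_intros A simp: fun_eq_iff)
  moreover have "(\<Sum>p\<in>?P. of_int (sign p) * (\<Sum>i\<in>UNIV. A' i (p i) h * (\<Prod>j\<in>UNIV - {i}. A x $ j $ p j)))
     = (\<Sum>i\<in>UNIV. A' i i h)" for h
  proof -
    have "(\<Prod>j\<in>UNIV - {i}. A x $ j $ p j) = 0" if p: "p \<in> ?P" "p \<noteq> id" for p i
    proof -
      have "\<exists>j. j \<noteq> i \<and> p j \<noteq> j"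
      proof (rule ccontr)
        assume "\<not> ?thesis"
        then have *: "\<And>j. j \<noteq> i \<Longrightarrow> p j = j" by blast
        moreover have "p i = i"
        proof (rule ccontr)
          assume "p i \<noteq> i"
          then have "p (p i) = p i" using * by blast
          then have "p i = i" using p permutes_inj[of p UNIV] by (simp add: inj_eq)
          with \<open>p i \<noteq> i\<close> show False by blast
        qed
        ultimately have "p = id" by (metis eq_id_iff)
        with p show False by blast
      qed
      then obtain j where "j \<in> UNIV - {i}" "A x $ j $ p j = 0" by (auto simp: entry)
      then show ?thesis by (intro prod_zero) auto
    qed
    then have "of_int (sign p) * (\<Sum>i\<in>UNIV. A' i (p i) h * (\<Prod>j\<in>UNIV - {i}. A x $ j $ p j)) = 0"
      if "p \<in> ?P - {id}" for p
      using that by (simp del: prod_zero_iff)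
    then have "(\<Sum>p\<in>?P. of_int (sign p) * (\<Sum>i\<in>UNIV. A' i (p i) h * (\<Prod>j\<in>UNIV - {i}. A x $ j $ p j)))
       = (\<Sum>p\<in>{id}. of_int (sign p) * (\<Sum>i\<in>UNIV. A' i (p i) h * (\<Prod>j\<in>UNIV - {i}. A x $ j $ p j)))"
      by (intro sum.mono_neutral_right) (simp_all add: permutes_id del: prod_zero_iff)
    also have "\<dots> = (\<Sum>i\<in>UNIV. A' i i h)" by (simp add: entry)
    finally show ?thesis .
  qed
  ultimately show ?thesis by simp
qed

text \<open>Jacobi's formula, reduced to the identity matrix by multiplying with the constant matrix
  \<open>matrix_inv (A x)\<close>.\<close>

lemma has_derivative_det:
  fixes A :: "'a::real_normed_vector \<Rightarrow> real^'n^'n"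
  assumes A: "\<And>i j. ((\<lambda>x. A x $ i $ j) has_derivative A' i j) (at x)" and nz: "det (A x) \<noteq> 0"
  shows "((\<lambda>x. det (A x)) has_derivative
    (\<lambda>h. det (A x) * (\<Sum>i\<in>UNIV. \<Sum>j\<in>UNIV. matrix_inv (A x) $ i $ j * A' j i h))) (at x)"
proof -
  let ?B = "matrix_inv (A x)"
  have inv: "A x ** ?B = mat 1" "?B ** A x = mat 1"
    by (rule matrix_inv_right[OF nz], rule matrix_inv_left[OF nz])
  have "((\<lambda>y. (?B ** A y) $ i $ j) has_derivative (\<lambda>h. \<Sum>k\<in>UNIV. ?B $ i $ k * A' k j h)) (at x)" for i j
    unfolding matrix_matrix_mult_def by (auto intro!: derivative_eq_intros A)
  from has_derivative_det_mat_1[OF this inv(2)]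
  have "((\<lambda>y. det (A x) * det (?B ** A y)) has_derivative
    (\<lambda>h. det (A x) * (\<Sum>i\<in>UNIV. \<Sum>j\<in>UNIV. ?B $ i $ j * A' j i h))) (at x)"
    by (intro derivative_eq_intros) auto
  moreover have "det (A x) * det (?B ** A y) = det (A y)" for y
    using arg_cong[OF inv(1), of det] by (simp add: det_mul mult.assoc[symmetric])
  ultimately show ?thesis by simp
qed

text \<open>Cramer's rule supplies differentiability; differentiating A A^-1 = 1 then determines the
  derivative.\<close>

lemma has_derivative_matrix_inv:
  fixes A :: "'a::real_normed_vector \<Rightarrow> real^'n^'n"
  assumes A: "\<And>i j. ((\<lambda>x. A x $ i $ j) has_derivative A' i j) (at x)"
    and S: "open S" "x \<in> S" "\<And>y. y \<in> S \<Longrightarrow> det (A y) \<noteq> 0"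
  shows "((\<lambda>x. matrix_inv (A x) $ i $ j) has_derivative
    (\<lambda>h. - (\<Sum>a\<in>UNIV. \<Sum>b\<in>UNIV. matrix_inv (A x) $ i $ a * A' a b h * matrix_inv (A x) $ b $ j))) (at x)"
proof -
  let ?B = "\<lambda>x. matrix_inv (A x)"
  have inv: "A y ** ?B y = mat 1" "?B y ** A y = mat 1" if "y \<in> S" for y
    by (rule matrix_inv_right[OF S(3)[OF that]], rule matrix_inv_left[OF S(3)[OF that]])
  have "(\<lambda>x. ?B x $ i $ j) differentiable (at x)" for i j
    by (rule differentiable_matrix_inv[OF _ S]) (use A differentiable_def in blast)
  then obtain B' where B': "\<And>i j. ((\<lambda>x. ?B x $ i $ j) has_derivative B' i j) (at x)"
    unfolding differentiable_def by metis
  have eq: "(\<Sum>k\<in>UNIV. A x $ a $ k * B' k j h) + (\<Sum>k\<in>UNIV. A' a k h * ?B x $ k $ j) = 0" for a j h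
  proof -
    have "((\<lambda>y. \<Sum>k\<in>UNIV. A y $ a $ k * ?B y $ k $ j) has_derivative
      (\<lambda>h. (\<Sum>k\<in>UNIV. A x $ a $ k * B' k j h + A' a k h * ?B x $ k $ j))) (at x)"
      by (intro has_derivative_sum has_derivative_mult A B')
    moreover have "((\<lambda>y. \<Sum>k\<in>UNIV. A y $ a $ k * ?B y $ k $ j) has_derivative (\<lambda>h. 0)) (at x)"
    proof (rule has_derivative_transform_within_open[OF _ S(1,2)])
      show "((\<lambda>y. (mat 1 :: real^'n^'n) $ a $ j) has_derivative (\<lambda>h. 0)) (at x)" by simp
      show "(mat 1 :: real^'n^'n) $ a $ j = (\<Sum>k\<in>UNIV. A y $ a $ k * ?B y $ k $ j)" if "y \<in> S" for y
        using arg_cong[OF inv(1)[OF that], of "\<lambda>M. M $ a $ j"] by (simp add: matrix_matrix_mult_def)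
    qed
    ultimately have "(\<lambda>h. (\<Sum>k\<in>UNIV. A x $ a $ k * B' k j h + A' a k h * ?B x $ k $ j)) = (\<lambda>h. 0)"
      by (rule has_derivative_unique)
    then show ?thesis by (simp add: fun_eq_iff sum.distrib)
  qed
  have "B' i j h = - (\<Sum>a\<in>UNIV. \<Sum>b\<in>UNIV. ?B x $ i $ a * A' a b h * ?B x $ b $ j)" for h
  proof -
    have "B' i j h = (\<Sum>k\<in>UNIV. (?B x ** A x) $ i $ k * B' k j h)"
      unfolding inv(2)[OF S(2)] by (simp add: mat_def if_distrib[of "\<lambda>c. c * _"] cong: if_cong)
    also have "\<dots> = (\<Sum>k\<in>UNIV. \<Sum>a\<in>UNIV. ?B x $ i $ a * (A x $ a $ k * B' k j h))"
      by (simp add: matrix_matrix_mult_def sum_distrib_right mult.assoc)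
    also have "\<dots> = (\<Sum>a\<in>UNIV. ?B x $ i $ a * (\<Sum>k\<in>UNIV. A x $ a $ k * B' k j h))"
      by (subst sum.swap) (simp add: sum_distrib_left)
    also have "\<dots> = (\<Sum>a\<in>UNIV. ?B x $ i $ a * - (\<Sum>b\<in>UNIV. A' a b h * ?B x $ b $ j))"
      by (rule sum.cong[OF refl], rule arg_cong[of _ _ "(*) _"]) (simp add: eq_neg_iff_add_eq_0 eq)
    finally show ?thesis by (simp add: sum_negf sum_distrib_left mult.assoc)
  qed
  then have "B' i j = (\<lambda>h. - (\<Sum>a\<in>UNIV. \<Sum>b\<in>UNIV. ?B x $ i $ a * A' a b h * ?B x $ b $ j))" by blast
  with B'[of i j] show ?thesis by simp
qed

text \<open>Piola's identity: the columns of the adjugate det K K^-1 of a Jacobian K are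
  divergence-free. Here \<open>P a b i\<close> stands for the i-th derivative of the (a, b) entry,
  and \<open>sym\<close> expresses that K consists of first derivatives of one map. The derivatives
  \<open>E\<close> are exposed together with the identity because they are needed in a product rule
  later.\<close>

lemma piola_identity:
  fixes K :: "real^'n \<Rightarrow> real^'n^'n"
  assumes K: "\<And>a b. ((\<lambda>x. K x $ a $ b) has_derivative (\<lambda>h. \<Sum>i\<in>UNIV. h $ i * P a b i)) (at x)"
    and sym: "\<And>a b i. P a b i = P a i b"
    and S: "open S" "x \<in> S" "\<And>y. y \<in> S \<Longrightarrow> det (K y) \<noteq> 0"
  shows "\<exists>E. (\<forall>i k. ((\<lambda>x. det (K x) * matrix_inv (K x) $ i $ k) has_derivative E i k) (at x)) \<and>
    (\<forall>k. (\<Sum>i\<in>UNIV. E i k (axis i 1)) = 0)"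
proof -
  let ?B = "matrix_inv (K x)" and ?d = "det (K x)"
  let ?A = "\<lambda>a b h. \<Sum>i\<in>UNIV. h $ i * P a b i"
  define E where "E i k h = ?d * - (\<Sum>a\<in>UNIV. \<Sum>b\<in>UNIV. ?B $ i $ a * ?A a b h * ?B $ b $ k)
    + ?d * (\<Sum>a\<in>UNIV. \<Sum>b\<in>UNIV. ?B $ a $ b * ?A b a h) * ?B $ i $ k" for i k h
  have "((\<lambda>x. det (K x) * matrix_inv (K x) $ i $ k) has_derivative E i k) (at x)" for i k
    unfolding E_def
    by (rule has_derivative_mult[OF has_derivative_det[OF K S(3)[OF S(2)]] has_derivative_matrix_inv[OF K S]])
  moreover have "(\<Sum>i\<in>UNIV. E i k (axis i 1)) = 0" for k
  proof -
    have ax: "?A a b (axis i 1) = P a b i" for a b i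
      by (simp add: axis_def if_distrib[of "\<lambda>c. c * _"] cong: if_cong)
    have "E i k (axis i 1) = ?d * ((\<Sum>a\<in>UNIV. \<Sum>b\<in>UNIV. ?B $ a $ b * P b a i * ?B $ i $ k)
         - (\<Sum>a\<in>UNIV. \<Sum>b\<in>UNIV. ?B $ i $ a * P a b i * ?B $ b $ k))" for i
    proof -
      have "(\<Sum>a\<in>UNIV. \<Sum>b\<in>UNIV. ?B $ a $ b * P b a i) * ?B $ i $ k
          = (\<Sum>a\<in>UNIV. \<Sum>b\<in>UNIV. ?B $ a $ b * P b a i * ?B $ i $ k)"
        by (simp add: sum_distrib_right)
      then show ?thesis
        unfolding E_def ax by (simp only: mult.assoc[of ?d] right_diff_distrib mult_minus_right)
    qed
    then have "(\<Sum>i\<in>UNIV. E i k (axis i 1)) =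
       ?d * ((\<Sum>i\<in>UNIV. \<Sum>a\<in>UNIV. \<Sum>b\<in>UNIV. ?B $ a $ b * P b a i * ?B $ i $ k)
         - (\<Sum>i\<in>UNIV. \<Sum>a\<in>UNIV. \<Sum>b\<in>UNIV. ?B $ i $ a * P a b i * ?B $ b $ k))"
      by (simp add: sum_subtractf sum_distrib_left right_diff_distrib)
    \<comment> \<open>Exchanging the names a and i and applying \<open>sym\<close> turns the term
      from the determinant into the term from the inverse, up to the order of summation.\<close>
    also have "(\<Sum>i\<in>UNIV. \<Sum>a\<in>UNIV. \<Sum>b\<in>UNIV. ?B $ a $ b * P b a i * ?B $ i $ k)
       = (\<Sum>a\<in>UNIV. \<Sum>i\<in>UNIV. \<Sum>b\<in>UNIV. ?B $ a $ b * P b i a * ?B $ i $ k)"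
      by (subst sum.swap) (simp add: sym)
    also have "\<dots> = (\<Sum>a\<in>UNIV. \<Sum>b\<in>UNIV. \<Sum>i\<in>UNIV. ?B $ a $ b * P b i a * ?B $ i $ k)"
      by (rule sum.cong[OF refl], rule sum.swap)
    finally show ?thesis by simp
  qed
  ultimately show ?thesis by blast
qed

section \<open>The flux of a function and the Laplacian at a centre of symmetry\<close>

lemma matrix_inv_unique:
  fixes A B :: "real^'n^'n"
  assumes "A ** B = mat 1"
  shows "matrix_inv A = B"
proof -
  have "det A \<noteq> 0"
    using arg_cong[OF assms, of det] by (auto simp: det_mul)
  have "matrix_inv A = matrix_inv A ** (A ** B)"
    by (simp add: assms)
  also have "\<dots> = B"
    by (simp only: matrix_mul_assoc matrix_inv_left[OF \<open>det A \<noteq> 0\<close>] matrix_mul_lid)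
  finally show ?thesis .
qed

lemma matrix_inv_mat_1 [simp]: "matrix_inv (mat 1 :: real^'n^'n) = mat 1"
  by (rule matrix_inv_unique) simp

text \<open>The chain rule for z -> -z gives D = -D. This removes all first-order terms of the
  metric at a centre without computing any of them.\<close>

lemma has_derivative_even:
  fixes f :: "'a::real_normed_vector \<Rightarrow> 'b::real_normed_vector"
  assumes f: "f differentiable (at 0)" and T: "open T" "0 \<in> T" "\<And>z. z \<in> T \<Longrightarrow> f (- z) = f z"
  shows "(f has_derivative (\<lambda>_. 0)) (at 0)"
proof -
  obtain D where D: "(f has_derivative D) (at 0)"
    using f differentiable_def by blast
  have "(f \<circ> uminus has_derivative D \<circ> uminus) (at 0)"
    using D by (intro diff_chain_at) (auto intro!: derivative_eq_intros)
  then have "(f has_derivative D \<circ> uminus) (at 0)"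
    by (rule has_derivative_transform_within_open[OF _ T(1,2)]) (simp add: T(3))
  then have "D = D \<circ> uminus"
    using D has_derivative_unique by blast
  moreover have "D (- h) = - D h" for h
    using D has_derivative_linear linear_neg by blast
  ultimately have "D h = - D h" for h
    by (metis comp_apply)
  then have "D = (\<lambda>_. 0)"
    by (simp add: eq_neg_iff_add_eq_0 fun_eq_iff flip: scaleR_2)
  with D show ?thesis by simp
qed

lemma matrix_entry_differentiable:
  fixes G :: "'a::real_normed_vector \<Rightarrow> real^'n^'m"
  assumes "G differentiable F"
  shows "(\<lambda>x. G x $ i $ j) differentiable F"
proof -
  obtain D where "(G has_derivative D) F"
    using assms differentiable_def by blast
  then have "((\<lambda>x. G x $ i $ j) has_derivative (\<lambda>h. D h $ i $ j)) F"
    by (intro bounded_linear.has_derivative[OF bounded_linear_vec_nth])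
  then show ?thesis by (rule differentiableI)
qed

text \<open>The coefficient matrix sqrt(det G) G^-1 is even and equals the identity at 0, so to
  first order the flux varies like the gradient and its derivative is the Hessian of v.\<close>

lemma flux_has_derivative_centre:
  fixes G :: "real^'n \<Rightarrow> real^'n^'n" and v :: "real^'n \<Rightarrow> real"
  assumes T: "open T" "0 \<in> T" "\<And>z. z \<in> T \<Longrightarrow> - z \<in> T"
    and G: "G differentiable (at 0)" "\<And>z. z \<in> T \<Longrightarrow> det (G z) > 0" "G 0 = mat 1"
      "\<And>z. z \<in> T \<Longrightarrow> G (- z) = G z"
    and v: "\<And>l. partial l v differentiable (at 0)"
  shows "((\<lambda>z. sqrt (det (G z)) * (matrix_inv (G z) *v (\<chi> l. partial l v z)) $ k) has_derivative
    (\<lambda>h. \<Sum>m\<in>UNIV. h $ m * partial m (partial k v) 0)) (at 0)"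
proof -
  let ?H = "\<lambda>l z. sqrt (det (G z)) * matrix_inv (G z) $ k $ l"
  have entries: "(\<lambda>x. G x $ i $ j) differentiable (at 0)" for i j
    by (rule matrix_entry_differentiable[OF G(1)])
  have H: "(?H l has_derivative (\<lambda>_. 0)) (at 0)" for l
  proof (rule has_derivative_even[OF _ T(1,2)])
    obtain D where "((\<lambda>z. det (G z)) has_derivative D) (at 0)"
      using differentiable_det[of G 0, OF entries] differentiable_def by blast
    then have "(\<lambda>z. sqrt (det (G z))) differentiable (at 0)"
      using G(2)[OF T(2)] by (intro differentiableI) (rule has_derivative_real_sqrt)
    moreover have "(\<lambda>z. matrix_inv (G z) $ k $ l) differentiable (at 0)"
      by (rule differentiable_matrix_inv[OF entries T(1,2)]) (use G(2) in force)
    ultimately show "?H l differentiable (at 0)"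
      by (rule differentiable_mult)
  qed (simp add: G(4))
  have "((\<lambda>z. \<Sum>l\<in>UNIV. ?H l z * partial l v z) has_derivative
    (\<lambda>h. \<Sum>l\<in>UNIV. ?H l 0 * (\<Sum>m\<in>UNIV. h $ m *\<^sub>R partial m (partial l v) 0) + 0 * partial l v 0)) (at 0)"
    by (intro has_derivative_sum has_derivative_mult H has_derivative_partial v)
  moreover have H0: "?H l 0 = (if k = l then 1 else 0)" for l
    by (simp add: G(3)) (simp add: mat_def)
  have "(\<lambda>h. \<Sum>l\<in>UNIV. ?H l 0 * (\<Sum>m\<in>UNIV. h $ m *\<^sub>R partial m (partial l v) 0) + 0 * partial l v 0)
    = (\<lambda>h. \<Sum>m\<in>UNIV. h $ m * partial m (partial k v) 0)"
    unfolding H0 by (simp add: if_distrib[of "\<lambda>c. c * _"] cong: if_cong)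
  moreover have "(\<Sum>l\<in>UNIV. ?H l z * partial l v z)
    = sqrt (det (G z)) * (matrix_inv (G z) *v (\<chi> l. partial l v z)) $ k" for z
    by (simp add: matrix_vector_mult_def sum_distrib_left mult.assoc)
  ultimately show ?thesis by simp
qed

text \<open>Under a change of coordinates with Jacobian K the flux is a vector density and
  transforms by det K K^-1. The factor \<open>sgn (det K)\<close> appears because the square root
  yields the modulus of det K.\<close>

lemma flux_transform:
  fixes K G :: "real^'n^'n"
  assumes K: "det K \<noteq> 0" and G: "det G > 0"
  shows "sqrt (det (transpose K ** G ** K)) * (matrix_inv (transpose K ** G ** K) *v (transpose K *v d)) $ i
    = sgn (det K) * (\<Sum>k\<in>UNIV. det K * matrix_inv K $ i $ k * (sqrt (det G) * (matrix_inv G *v d) $ k))"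
proof -
  have tr: "transpose (matrix_inv K) ** transpose K = mat 1"
    by (simp only: matrix_transpose_mul[symmetric] matrix_inv_right[OF K] transpose_mat)
  have tr': "transpose K ** transpose (matrix_inv K) = mat 1"
    by (simp only: matrix_transpose_mul[symmetric] matrix_inv_left[OF K] transpose_mat)
  have "(transpose K ** G ** K) ** (matrix_inv K ** matrix_inv G ** transpose (matrix_inv K))
    = transpose K ** G ** (K ** matrix_inv K) ** matrix_inv G ** transpose (matrix_inv K)"
    by (simp only: matrix_mul_assoc)
  also have "\<dots> = transpose K ** (G ** matrix_inv G) ** transpose (matrix_inv K)"
    by (simp only: matrix_inv_right[OF K] matrix_mul_rid matrix_mul_assoc)
  also have "\<dots> = mat 1"
    using G by (simp add: matrix_inv_right tr')
  finally have "matrix_inv (transpose K ** G ** K) = matrix_inv K ** matrix_inv G ** transpose (matrix_inv K)"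
    by (rule matrix_inv_unique)
  then have "matrix_inv (transpose K ** G ** K) *v (transpose K *v d)
     = matrix_inv K *v (matrix_inv G *v ((transpose (matrix_inv K) ** transpose K) *v d))"
    by (simp only: matrix_vector_mul_assoc matrix_mul_assoc)
  also have "\<dots> = matrix_inv K *v (matrix_inv G *v d)"
    by (simp add: tr)
  finally have 1: "(matrix_inv (transpose K ** G ** K) *v (transpose K *v d)) $ i
    = (\<Sum>k\<in>UNIV. matrix_inv K $ i $ k * (matrix_inv G *v d) $ k)"
    by (simp add: matrix_vector_mult_def)
  have "det (transpose K ** G ** K) = (det K)\<^sup>2 * det G"
    by (simp add: det_mul det_transpose power2_eq_square)
  then have 2: "sqrt (det (transpose K ** G ** K)) = sgn (det K) * det K * sqrt (det G)"
    by (simp add: real_sqrt_mult abs_sgn mult.commute)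
  show ?thesis unfolding 1 2 by (simp add: sum_distrib_left mult_ac)
qed

text \<open>\<open>G'\<close> and \<open>v'\<close> are the expressions in an arbitrary chart, G and
  v those in a chart centred at the point, and F is the transition map. In the divergence of the
  transformed flux, the terms with derivatives of det K K^-1 cancel by Piola's identity, and the
  rest is the trace of the Hessian of v contracted with K K^-1 = 1.\<close>

lemma laplace_coord_centre:
  fixes G G' :: "real^'n \<Rightarrow> real^'n^'n" and v v' :: "real^'n \<Rightarrow> real" and F :: "real^'n \<Rightarrow> real^'n"
  defines "K \<equiv> \<lambda>y. matrix (frechet_derivative F (at y))"
  assumes S: "open S" "x \<in> S" and F: "Ck_on 2 S F" "\<And>y. y \<in> S \<Longrightarrow> F y \<in> T" "F x = 0"
    and K: "\<And>y. y \<in> S \<Longrightarrow> det (K y) \<noteq> 0"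
    and G': "\<And>y. y \<in> S \<Longrightarrow> G' y = transpose (K y) ** G (F y) ** K y"
    and v': "\<And>y. y \<in> S \<Longrightarrow> v' y = v (F y)"
    and T: "open T" "\<And>z. z \<in> T \<Longrightarrow> - z \<in> T"
    and G: "G differentiable (at 0)" "\<And>z. z \<in> T \<Longrightarrow> det (G z) > 0" "G 0 = mat 1"
      "\<And>z. z \<in> T \<Longrightarrow> G (- z) = G z"
    and v: "Ck_on 2 T v"
  shows "laplace_coord G' v' x = (\<Sum>i\<in>UNIV. partial i (partial i v) 0)"
proof -
  have 0: "0 \<in> T" using F(2)[OF S(2)] F(3) by simp
  have dF: "F differentiable (at y)" "partial a F differentiable (at y)" if "y \<in> S" for y a
    using F(1) that by (simp_all add: numeral_2_eq_2)
  have dv: "v differentiable (at z)" "partial a v differentiable (at z)" if "z \<in> T" for z a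
    using v that by (simp_all add: numeral_2_eq_2)
  have K_nth: "K y $ a $ i = partial i F y $ a" for y a i
    by (simp add: K_def matrix_frechet_derivative)
  define w where "w k z = sqrt (det (G z)) * (matrix_inv (G z) *v (\<chi> l. partial l v z)) $ k" for k z
  have w: "(w k has_derivative (\<lambda>h. \<Sum>m\<in>UNIV. h $ m * partial m (partial k v) 0)) (at 0)" for k
    unfolding w_def by (rule flux_has_derivative_centre[OF T(1) 0 T(2) G dv(2)[OF 0]])
  have w0: "w k 0 = partial k v 0" for k
    by (simp add: w_def G(3))
  define P where "P a b i = partial i (partial b F) x $ a" for a b i
  have derK: "((\<lambda>y. K y $ a $ b) has_derivative (\<lambda>h. \<Sum>i\<in>UNIV. h $ i * P a b i)) (at x)" for a b
    using bounded_linear.has_derivative[OF bounded_linear_vec_nth has_derivative_partial[OF dF(2)[OF S(2)]], of b a]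
    by (simp add: K_nth P_def)
  have P_sym: "P a b i = P a i b" for a b i
  proof -
    have P: "partial i (partial b (\<lambda>y. F y $ a)) x = P a b i" for i b
    proof -
      have "partial i (partial b (\<lambda>y. F y $ a)) x = partial i (\<lambda>y. partial b F y $ a) x"
        by (rule partial_cong_open[OF S]) (simp add: partial_nth dF)
      then show ?thesis by (simp add: partial_nth dF S P_def)
    qed
    show ?thesis
      unfolding P[symmetric] by (rule partial_commute[OF Ck_on_nth[OF S(1) F(1)] S])
  qed
  obtain E where E: "\<And>i k. ((\<lambda>y. det (K y) * matrix_inv (K y) $ i $ k) has_derivative E i k) (at x)"
    and E0: "\<And>k. (\<Sum>i\<in>UNIV. E i k (axis i 1)) = 0"
    using piola_identity[OF derK P_sym S K] by blast
  \<comment> \<open>Piola's identity concerns det K itself, whereas the volume density contains its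
    modulus. The sign is therefore taken out as a constant, on the neighbourhood \<open>S'\<close>
    where det K cannot change sign.\<close>
  define s where "s = sgn (det (K x))"
  have s: "s * s = 1" using K[OF S(2)] by (simp add: s_def sgn_if)
  let ?flux = "\<lambda>i y. sqrt (det (G' y)) * (\<Sum>j\<in>UNIV. matrix_inv (G' y) $ i $ j * partial j v' y)"
  have "continuous (at x) (\<lambda>y. det (K y))"
    using has_derivative_det[OF derK K[OF S(2)]] has_derivative_continuous by blast
  then have "\<forall>\<^sub>F y in at x. dist (det (K y)) (det (K x)) < \<bar>det (K x)\<bar>"
    using K[OF S(2)] by (intro tendstoD) (auto simp: continuous_at)
  then have "\<forall>\<^sub>F y in nhds x. dist (det (K y)) (det (K x)) < \<bar>det (K x)\<bar>"
    using K[OF S(2)] by (simp add: eventually_nhds_conv_at)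
  then obtain S' where S': "open S'" "x \<in> S'" "\<And>y. y \<in> S' \<Longrightarrow> dist (det (K y)) (det (K x)) < \<bar>det (K x)\<bar>"
    unfolding eventually_nhds by blast
  have flux: "s * (\<Sum>k\<in>UNIV. det (K y) * matrix_inv (K y) $ i $ k * w k (F y)) = ?flux i y"
    if "y \<in> S \<inter> S'" for i y
  proof -
    have y: "y \<in> S" using that by simp
    have sgn: "sgn (det (K y)) = s"
      using S'(3)[of y] that K[OF S(2)] by (auto simp: s_def dist_real_def sgn_if split: if_splits)
    have "partial j v' y = (\<Sum>a\<in>UNIV. partial j F y $ a * partial a v (F y))" for j
    proof -
      have "partial j v' y = partial j (\<lambda>y. v (F y)) y"
        by (rule partial_cong_open[OF S(1) y v'])
      then show ?thesis
        by (simp only: partial_compose[OF dF(1)[OF y] dv(1)[OF F(2)[OF y]]] real_scaleR_def)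
    qed
    then have "(\<chi> j. partial j v' y) = transpose (K y) *v (\<chi> l. partial l v (F y))"
      by (simp add: vec_eq_iff matrix_vector_mult_def transpose_def K_nth)
    moreover have "(\<Sum>j\<in>UNIV. matrix_inv (G' y) $ i $ j * partial j v' y)
        = (matrix_inv (G' y) *v (\<chi> j. partial j v' y)) $ i"
      by (simp add: matrix_vector_mult_def)
    ultimately have "?flux i y = sqrt (det (G' y)) * (matrix_inv (G' y) *v (transpose (K y) *v (\<chi> l. partial l v (F y)))) $ i"
      by simp
    then show ?thesis
      unfolding G'[OF y] flux_transform[OF K[OF y] G(2)[OF F(2)[OF y]]] sgn w_def by (rule sym)
  qed
  have part: "partial i (?flux i) x = s * (\<Sum>k\<in>UNIV. det (K x) * matrix_inv (K x) $ i $ k *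
      (\<Sum>m\<in>UNIV. K x $ m $ i * partial m (partial k v) 0) + E i k (axis i 1) * partial k v 0)" for i
  proof -
    have wF: "(w k \<circ> F has_derivative (\<lambda>h. \<Sum>m\<in>UNIV. h $ m * partial m (partial k v) 0) \<circ> frechet_derivative F (at x)) (at x)" for k
      by (rule diff_chain_at) (use w dF[OF S(2)] F(3) in \<open>auto simp: frechet_derivative_works[symmetric]\<close>)
    have "((\<lambda>y. s * (\<Sum>k\<in>UNIV. det (K y) * matrix_inv (K y) $ i $ k * (w k \<circ> F) y)) has_derivative
      (\<lambda>h. s * (\<Sum>k\<in>UNIV. det (K x) * matrix_inv (K x) $ i $ k *
        ((\<lambda>h. \<Sum>m\<in>UNIV. h $ m * partial m (partial k v) 0) \<circ> frechet_derivative F (at x)) h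
        + E i k h * (w k \<circ> F) x))) (at x)"
      by (intro has_derivative_mult_right has_derivative_sum has_derivative_mult E wF)
    then have "(?flux i has_derivative
      (\<lambda>h. s * (\<Sum>k\<in>UNIV. det (K x) * matrix_inv (K x) $ i $ k *
        ((\<lambda>h. \<Sum>m\<in>UNIV. h $ m * partial m (partial k v) 0) \<circ> frechet_derivative F (at x)) h
        + E i k h * (w k \<circ> F) x))) (at x)"
      by (rule has_derivative_transform_within_open[OF _ open_Int[OF S(1) S'(1)] IntI[OF S(2) S'(2)]])
        (simp only: o_def flux)
    from partial_eqI[OF this, of i] show ?thesis
      by (simp add: F(3) w0 K_nth flip: partial_def)
  qed
  have "(\<Sum>i\<in>UNIV. partial i (?flux i) x) =
    s * (\<Sum>i\<in>UNIV. \<Sum>k\<in>UNIV. det (K x) * matrix_inv (K x) $ i $ k *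
      (\<Sum>m\<in>UNIV. K x $ m $ i * partial m (partial k v) 0))
    + s * (\<Sum>i\<in>UNIV. \<Sum>k\<in>UNIV. E i k (axis i 1) * partial k v 0)"
    unfolding part by (simp add: sum.distrib sum_distrib_left distrib_left)
  also have "(\<Sum>i\<in>UNIV. \<Sum>k\<in>UNIV. E i k (axis i 1) * partial k v 0) = 0"
    by (subst sum.swap) (simp add: sum_distrib_right[symmetric] E0)
  also have "(\<Sum>i\<in>UNIV. \<Sum>k\<in>UNIV. det (K x) * matrix_inv (K x) $ i $ k *
      (\<Sum>m\<in>UNIV. K x $ m $ i * partial m (partial k v) 0))
    = det (K x) * (\<Sum>k\<in>UNIV. \<Sum>m\<in>UNIV. (K x ** matrix_inv (K x)) $ m $ k * partial m (partial k v) 0)"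
  proof -
    have "(\<Sum>i\<in>UNIV. \<Sum>k\<in>UNIV. det (K x) * matrix_inv (K x) $ i $ k *
      (\<Sum>m\<in>UNIV. K x $ m $ i * partial m (partial k v) 0))
      = (\<Sum>k\<in>UNIV. \<Sum>i\<in>UNIV. \<Sum>m\<in>UNIV. det (K x) * (K x $ m $ i * matrix_inv (K x) $ i $ k * partial m (partial k v) 0))"
      by (subst sum.swap) (simp add: sum_distrib_left mult_ac)
    also have "\<dots> = (\<Sum>k\<in>UNIV. \<Sum>m\<in>UNIV. \<Sum>i\<in>UNIV. det (K x) * (K x $ m $ i * matrix_inv (K x) $ i $ k * partial m (partial k v) 0))"
      by (rule sum.cong[OF refl], rule sum.swap)
    finally show ?thesis
      by (simp add: matrix_matrix_mult_def sum_distrib_left sum_distrib_right)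
  qed
  also have "(\<Sum>k\<in>UNIV. \<Sum>m\<in>UNIV. (K x ** matrix_inv (K x)) $ m $ k * partial m (partial k v) 0)
    = (\<Sum>k\<in>UNIV. partial k (partial k v) 0)"
    unfolding matrix_inv_right[OF K[OF S(2)]]
    by (simp add: mat_def if_distrib[of "\<lambda>c. c * _"] cong: if_cong)
  finally have sum: "(\<Sum>i\<in>UNIV. partial i (?flux i) x) = s * (det (K x) * (\<Sum>k\<in>UNIV. partial k (partial k v) 0))"
    by simp
  have "det (G' x) = (det (K x))\<^sup>2"
    unfolding G'[OF S(2)] by (simp add: F(3) G(3) det_mul det_transpose power2_eq_square)
  then have sq: "sqrt (det (G' x)) = s * det (K x)"
    by (simp add: s_def abs_sgn mult.commute)
  show ?thesis
    unfolding laplace_coord_def sum sq using K[OF S(2)] s by (auto simp: divide_simps)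
qed

section \<open>Charts\<close>

lemma
  assumes "is_chart c"
  shows chart_inj: "inj_on (snd c) (fst c)"
    and chart_open: "open (fst c)"
    and chart_image_open: "open (chart_image c)"
    and chart_continuous: "continuous_on (fst c) (snd c)"
    and chart_inv_continuous: "continuous_on (chart_image c) (chart_inv c)"
proof -
  have "homeomorphism (fst c) (chart_image c) (snd c) (chart_inv c)"
    using assms by (simp add: is_chart_def)
  then show "inj_on (snd c) (fst c)" "continuous_on (fst c) (snd c)"
    "continuous_on (chart_image c) (chart_inv c)"
    by (auto simp: homeomorphism_def intro: inj_on_inverseI)
qed (use assms in \<open>auto simp: is_chart_def\<close>)

lemma chart_inv_f [simp]: "is_chart c \<Longrightarrow> q \<in> fst c \<Longrightarrow> chart_inv c (snd c q) = q"
  by (simp add: chart_inj)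

lemma f_chart_inv [simp]: "z \<in> chart_image c \<Longrightarrow> snd c (chart_inv c z) = z"
  by (rule f_inv_into_f)

lemma chart_inv_in [simp]: "z \<in> chart_image c \<Longrightarrow> chart_inv c z \<in> fst c"
  by (rule inv_into_into)

lemma local_dom_iff:
  assumes "is_chart c"
  shows "z \<in> local_dom f c c' \<longleftrightarrow> z \<in> chart_image c \<and> f (chart_inv c z) \<in> fst c'"
  using assms by (auto simp: local_dom_def)

lemma open_local_dom:
  assumes c: "is_chart c" and "open (fst c')" and f: "continuous_on UNIV f"
  shows "open (local_dom f c c')"
proof -
  have "continuous_on (chart_image c) (f \<circ> chart_inv c)"
    by (intro continuous_on_compose chart_inv_continuous[OF c] continuous_on_subset[OF f]) simp
  from continuous_open_preimage[OF this chart_image_open[OF c] assms(2)]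
  have "open (chart_image c \<inter> (f \<circ> chart_inv c) -` fst c')" .
  moreover have "chart_image c \<inter> (f \<circ> chart_inv c) -` fst c' = local_dom f c c'"
    by (auto simp: local_dom_iff[OF c])
  ultimately show ?thesis by simp
qed

section \<open>Charts transported by a map of the manifold\<close>

definition pullback_chart :: "('m \<Rightarrow> 'm) \<Rightarrow> ('m, 'n) chart \<Rightarrow> ('m, 'n) chart" where
  "pullback_chart f c = (f -` fst c, snd c \<circ> f)"

lemma fst_pullback_chart [simp]: "fst (pullback_chart f c) = f -` fst c"
  and snd_pullback_chart [simp]: "snd (pullback_chart f c) = snd c \<circ> f"
  by (simp_all add: pullback_chart_def)

lemma pullback_chart_image:
  assumes "surj f"
  shows "chart_image (pullback_chart f c) = chart_image c"
proof -
  have "f ` (f -` fst c) = fst c"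
    using assms by (rule surj_image_vimage_eq)
  then show ?thesis
    unfolding fst_pullback_chart snd_pullback_chart image_comp[symmetric] by (rule arg_cong)
qed

lemma pullback_chart_inv:
  fixes c :: "('m::topological_space, 'n::finite) chart" and f :: "'m \<Rightarrow> 'm"
  assumes f: "bij f" and c: "is_chart c" and z: "z \<in> chart_image c"
  shows "inv_into (f -` fst c) (snd c \<circ> f) z = inv f (chart_inv c z)"
proof -
  have inj: "inj_on (snd (pullback_chart f c)) (fst (pullback_chart f c))"
    using bij_is_inj[OF f] chart_inj[OF c] by (auto simp: inj_on_def)
  have "inv f (chart_inv c z) \<in> fst (pullback_chart f c)"
    using z f by (simp add: bij_is_surj surj_f_inv_f)
  moreover have "snd (pullback_chart f c) (inv f (chart_inv c z)) = z"
    using z f by (simp add: bij_is_surj surj_f_inv_f)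
  ultimately have "chart_inv (pullback_chart f c) z = inv f (chart_inv c z)"
    using inv_into_f_f[OF inj] by metis
  then show ?thesis by simp
qed

lemma is_chart_pullback:
  fixes c :: "('m::topological_space, 'n::finite) chart"
  assumes f: "bij f" "continuous_on UNIV f" "continuous_on UNIV (inv f)" and c: "is_chart c"
  shows "is_chart (pullback_chart f c)"
proof -
  let ?c = "pullback_chart f c"
  have im: "chart_image ?c = chart_image c"
    by (rule pullback_chart_image[OF bij_is_surj[OF f(1)]])
  have "open (fst ?c)"
    using continuous_open_preimage[OF f(2) open_UNIV chart_open[OF c]] by simp
  moreover have "continuous_on (fst ?c) (snd ?c)"
    unfolding fst_pullback_chart snd_pullback_chart
    by (intro continuous_on_compose continuous_on_subset[OF f(2)] continuous_on_subset[OF chart_continuous[OF c]]) auto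
  moreover have "continuous_on (chart_image c) (inv f \<circ> chart_inv c)"
    by (intro continuous_on_compose chart_inv_continuous[OF c] continuous_on_subset[OF f(3)]) auto
  then have "continuous_on (chart_image ?c) (chart_inv ?c)"
    unfolding im by (rule continuous_on_eq) (simp add: pullback_chart_inv f c)
  moreover have "inj_on (snd ?c) (fst ?c)"
    using bij_is_inj[OF f(1)] chart_inj[OF c] by (auto simp: inj_on_def)
  moreover have "chart_inv ?c ` chart_image ?c = fst ?c"
    using \<open>inj_on (snd ?c) (fst ?c)\<close> by (metis image_inv_into_cancel inj_on_imp_bij_betw bij_betw_inv_into bij_betw_imp_surj_on)
  ultimately show ?thesis
    unfolding is_chart_def homeomorphism_def
    using chart_image_open[OF c] im by (auto simp del: fst_pullback_chart snd_pullback_chart)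
qed

lemma
  assumes "differentiable_structure A"
  shows atlas_chart: "c \<in> A \<Longrightarrow> is_chart c"
    and atlas_cover: "\<exists>c\<in>A. p \<in> fst c"
    and atlas_compatible: "c \<in> A \<Longrightarrow> c' \<in> A \<Longrightarrow> compatible c c'"
    and atlas_maximal: "is_chart c \<Longrightarrow> (\<And>c'. c' \<in> A \<Longrightarrow> compatible c c') \<Longrightarrow> c \<in> A"
proof -
  note A = assms[unfolded differentiable_structure_def]
  show "c \<in> A \<Longrightarrow> is_chart c" "c \<in> A \<Longrightarrow> c' \<in> A \<Longrightarrow> compatible c c'"
    using A by blast+
  have "p \<in> (\<Union>c\<in>A. fst c)" using A by simp
  then show "\<exists>c\<in>A. p \<in> fst c" by blast
  show "is_chart c \<Longrightarrow> (\<And>c'. c' \<in> A \<Longrightarrow> compatible c c') \<Longrightarrow> c \<in> A"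
    using A by blast
qed

lemma chart_at:
  assumes "differentiable_structure A"
  shows "chart_at A p \<in> A" "p \<in> fst (chart_at A p)"
proof -
  have "\<exists>c. c \<in> A \<and> p \<in> fst c" using atlas_cover[OF assms, of p] by blast
  then have "chart_at A p \<in> A \<and> p \<in> fst (chart_at A p)"
    unfolding chart_at_def by (rule someI_ex)
  then show "chart_at A p \<in> A" "p \<in> fst (chart_at A p)" by auto
qed

text \<open>By maximality of the atlas only compatibility is at stake, and the transition maps
  between the pulled back chart and a chart \<open>c'\<close> are the coordinate expressions of
  \<open>inv f\<close> from c to \<open>c'\<close> and of f from \<open>c'\<close> to c.\<close>

lemma pullback_chart_in_atlas:
  assumes A: "differentiable_structure A" and f: "bij f" "Ck_map 3 A f" "Ck_map 3 A (inv f)" and c: "c \<in> A"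
  shows "pullback_chart f c \<in> A"
proof (rule atlas_maximal[OF A])
  let ?c = "pullback_chart f c"
  have cont: "continuous_on UNIV f" "continuous_on UNIV (inv f)"
    using f by (simp_all add: Ck_map_def)
  note chart = atlas_chart[OF A c]
  note im = pullback_chart_image[OF bij_is_surj[OF f(1)], of c]
  show chart': "is_chart ?c"
    by (rule is_chart_pullback[OF f(1) cont chart])
  fix c' assume c': "c' \<in> A"
  note chartc' = atlas_chart[OF A c']
  have dom: "local_dom id ?c c' = local_dom (inv f) c c'"
  proof (intro set_eqI)
    fix z
    show "z \<in> local_dom id ?c c' \<longleftrightarrow> z \<in> local_dom (inv f) c c'"
      unfolding local_dom_iff[OF chart'] local_dom_iff[OF chart] im
      by (cases "z \<in> chart_image c") (simp_all add: pullback_chart_inv[OF f(1) chart])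
  qed
  have 1: "Ck_on 3 (local_dom id ?c c') (local_rep id ?c c')"
    unfolding dom
  proof (rule Ck_on_cong)
    show "Ck_on 3 (local_dom (inv f) c c') (local_rep (inv f) c c')"
      using f(3) c c' by (simp add: Ck_map_def)
    show "open (local_dom (inv f) c c')"
      by (rule open_local_dom[OF chart chart_open[OF chartc'] cont(2)])
    show "local_rep (inv f) c c' z = local_rep id ?c c' z" if "z \<in> local_dom (inv f) c c'" for z
      using that by (simp add: local_dom_iff[OF chart] local_rep_def pullback_chart_inv[OF f(1) chart])
  qed
  have "local_dom id c' ?c = local_dom f c' c" "local_rep id c' ?c = local_rep f c' c"
    by (auto simp: local_dom_def local_rep_def fun_eq_iff)
  then have 2: "Ck_on 3 (local_dom id c' ?c) (local_rep id c' ?c)"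
    using f(2) c c' by (simp add: Ck_map_def)
  show "compatible ?c c'"
    using 1 2 by (simp add: compatible_def)
qed

text \<open>Between \<open>pullback_chart f c\<close> and c the map f is the identity in
  coordinates, so the isometry equation holds with D = 1.\<close>

lemma pullback_chart_metric:
  assumes A: "differentiable_structure A" and f: "riemannian_isometry A g f"
    and c: "c \<in> A" and z: "z \<in> chart_image c"
  shows "g (pullback_chart f c) z = g c z"
proof -
  let ?c = "pullback_chart f c"
  have f': "bij f" "Ck_map 3 A f" "Ck_map 3 A (inv f)" "preserves_metric A g f"
    using f by (auto simp: riemannian_isometry_def)
  note chart = atlas_chart[OF A c]
  have c': "?c \<in> A"
    by (rule pullback_chart_in_atlas[OF A f'(1-3) c])
  note chart' = atlas_chart[OF A c']
  have im: "chart_image ?c = chart_image c"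
    by (rule pullback_chart_image[OF bij_is_surj[OF f'(1)]])
  have rep: "local_rep f ?c c y = y" if "y \<in> chart_image c" for y
    using that f'(1)
    by (simp add: local_rep_def pullback_chart_inv[OF f'(1) chart] bij_is_surj surj_f_inv_f)
  have "z \<in> local_dom f ?c c"
    using z f'(1) unfolding local_dom_iff[OF chart'] im
    by (simp add: pullback_chart_inv[OF f'(1) chart] bij_is_surj surj_f_inv_f)
  then have "g ?c z = (let D = matrix (frechet_derivative (local_rep f ?c c) (at z))
      in transpose D ** g c (local_rep f ?c c z) ** D)"
    using f'(4) c c' by (auto simp: preserves_metric_def Let_def)
  moreover have "(local_rep f ?c c has_derivative (\<lambda>h. h)) (at z)"
    by (rule has_derivative_transform_within_open[OF has_derivative_ident chart_image_open[OF chart] z])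
      (simp add: rep)
  then have "frechet_derivative (local_rep f ?c c) (at z) = (\<lambda>h. h)"
    using frechet_derivative_at by metis
  ultimately show ?thesis
    by (simp add: rep[OF z] matrix_id_mat_1 transpose_mat flip: id_def)
qed

section \<open>Curves and the geodesic distance\<close>

text \<open>Derivatives here are two-sided and only the continuity of the derivative is relative to
  X, so it is enough to agree with a C1 function on an open neighbourhood of each point. This lets a
  curve be treated chart by chart.\<close>

lemma C1_differentiable_on_local:
  assumes "\<And>t. t \<in> X \<Longrightarrow> \<exists>N h. open N \<and> t \<in> N \<and> h C1_differentiable_on (X \<inter> N) \<and> (\<forall>s\<in>N. h s = f s)"
  shows "f C1_differentiable_on X"
  unfolding C1_differentiable_on_eq
proof safe
  have *: "f differentiable (at t) \<and> continuous (at t within X) (\<lambda>t. vector_derivative f (at t))" if t: "t \<in> X" for t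
  proof -
    obtain N h where N: "open N" "t \<in> N" "h C1_differentiable_on (X \<inter> N)" and eq: "\<And>s. s \<in> N \<Longrightarrow> h s = f s"
      using assms[OF t] by blast
    have h: "\<And>s. s \<in> X \<inter> N \<Longrightarrow> h differentiable (at s)"
      "continuous_on (X \<inter> N) (\<lambda>s. vector_derivative h (at s))"
      using N(3) by (auto simp: C1_differentiable_on_eq)
    have vd: "(f has_vector_derivative vector_derivative h (at s)) (at s)" if s: "s \<in> X \<inter> N" for s
    proof -
      have "(h has_vector_derivative vector_derivative h (at s)) (at s)"
        using h(1)[OF s] vector_derivative_works by blast
      then show ?thesis
        by (rule has_vector_derivative_transform_within_open[OF _ N(1)]) (use s eq in auto)
    qed
    have "continuous_on (X \<inter> N) (\<lambda>s. vector_derivative f (at s))"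
      by (rule continuous_on_eq[OF h(2)]) (use vd vector_derivative_at in metis)
    then have "continuous (at t within (X \<inter> N)) (\<lambda>s. vector_derivative f (at s))"
      using t N(2) by (simp add: continuous_on_eq_continuous_within)
    moreover have "at t within X = at t within (X \<inter> N)"
      by (rule at_within_nhd[OF N(2,1)]) auto
    ultimately show ?thesis
      using vd[of t] t N(2) by (auto simp: differentiableI_vector)
  qed
  show "f differentiable (at t)" if "t \<in> X" for t using *[OF that] by blast
  show "continuous_on X (\<lambda>t. vector_derivative f (at t))"
    using * by (simp add: continuous_on_eq_continuous_within)
qed

lemma C1_differentiable_on_subset: "f C1_differentiable_on S \<Longrightarrow> T \<subseteq> S \<Longrightarrow> f C1_differentiable_on T"
  unfolding C1_differentiable_on_def by (meson continuous_on_subset subsetD)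

lemma vector_derivative_compose_partial:
  fixes F :: "real^'n \<Rightarrow> 'b::real_normed_vector"
  assumes "\<eta> differentiable (at t)" "F differentiable (at (\<eta> t))"
  shows "((\<lambda>t. F (\<eta> t)) has_vector_derivative (\<Sum>i\<in>UNIV. vector_derivative \<eta> (at t) $ i *\<^sub>R partial i F (\<eta> t))) (at t)"
proof -
  have "(\<eta> has_vector_derivative vector_derivative \<eta> (at t)) (at t)"
    using assms(1) vector_derivative_works by blast
  from vector_derivative_diff_chain_within[OF this has_derivative_at_withinI[OF has_derivative_partial[OF assms(2)]]]
  show ?thesis by (simp add: o_def)
qed

lemma open_curve_vimage:
  fixes \<gamma> :: "real \<Rightarrow> 'a::topological_space"
  assumes "continuous_on {0..1} \<gamma>" "open U"
  shows "open ({0<..<1} \<inter> \<gamma> -` U)"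
proof -
  have "continuous_on {0<..<1} \<gamma>"
    by (rule continuous_on_subset[OF assms(1)]) auto
  from continuous_open_preimage[OF this open_greaterThanLessThan assms(2)] show ?thesis .
qed

text \<open>The endpoints join the exceptional set: continuity of the curve is known on the closed
  interval only, so the preimage of a chart domain is a full neighbourhood only of interior
  times.\<close>

lemma C1_curve_image:
  assumes A: "differentiable_structure A" and f: "Ck_map 1 A f"
    and \<gamma>: "continuous_on {0..1} \<gamma>" "\<And>c. c \<in> A \<Longrightarrow> (snd c \<circ> \<gamma>) C1_differentiable_on ({0..1} \<inter> \<gamma> -` fst c - S)"
    and c': "c' \<in> A"
  shows "(snd c' \<circ> (f \<circ> \<gamma>)) C1_differentiable_on ({0..1} \<inter> (f \<circ> \<gamma>) -` fst c' - (S \<union> {0, 1}))"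
proof (rule C1_differentiable_on_local)
  let ?X = "{0..1} \<inter> (f \<circ> \<gamma>) -` fst c' - (S \<union> {0, 1})"
  fix t assume t: "t \<in> ?X"
  obtain c where c: "c \<in> A" "\<gamma> t \<in> fst c" using atlas_cover[OF A] by blast
  note chart = atlas_chart[OF A c(1)]
  let ?N = "{0<..<1} \<inter> \<gamma> -` fst c"
  let ?F = "local_rep f c c'" and ?\<eta> = "snd c \<circ> \<gamma>"
  have F: "Ck_on 1 (local_dom f c c') ?F"
    using f c c' by (auto simp: Ck_map_def)
  have dom: "?\<eta> s \<in> local_dom f c c'" if "s \<in> ?X \<inter> ?N" for s
    using that chart by (auto simp: local_dom_iff)
  have \<eta>: "?\<eta> C1_differentiable_on (?X \<inter> ?N)"
    by (rule C1_differentiable_on_subset[OF \<gamma>(2)[OF c(1)]]) auto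
  then have d\<eta>: "\<And>s. s \<in> ?X \<inter> ?N \<Longrightarrow> ?\<eta> differentiable (at s)"
    and c\<eta>: "continuous_on (?X \<inter> ?N) (\<lambda>s. vector_derivative ?\<eta> (at s))"
    by (auto simp: C1_differentiable_on_eq)
  have "(\<lambda>s. ?F (?\<eta> s)) C1_differentiable_on (?X \<inter> ?N)"
    unfolding C1_differentiable_on_def
  proof (intro exI conjI ballI)
    show "((\<lambda>s. ?F (?\<eta> s)) has_vector_derivative
       (\<Sum>i\<in>UNIV. vector_derivative ?\<eta> (at s) $ i *\<^sub>R partial i ?F (?\<eta> s))) (at s)" if "s \<in> ?X \<inter> ?N" for s
      by (rule vector_derivative_compose_partial[OF d\<eta>[OF that]])
        (use F dom[OF that] in \<open>simp add: numeral_eq_Suc\<close>)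
    have "continuous_on (?X \<inter> ?N) ?\<eta>"
      by (intro continuous_at_imp_continuous_on ballI differentiable_imp_continuous_within d\<eta>)
    moreover have "continuous_on (local_dom f c c') (partial i ?F)" for i
      using F by simp
    ultimately have "continuous_on (?X \<inter> ?N) (\<lambda>s. partial i ?F (?\<eta> s))" for i
      using continuous_on_compose2[of "local_dom f c c'" "partial i ?F" "?X \<inter> ?N" ?\<eta>] dom by blast
    then show "continuous_on (?X \<inter> ?N) (\<lambda>s. \<Sum>i\<in>UNIV. vector_derivative ?\<eta> (at s) $ i *\<^sub>R partial i ?F (?\<eta> s))"
      by (intro continuous_intros c\<eta>)
  qed
  moreover have "open ?N"
    by (rule open_curve_vimage[OF \<gamma>(1) chart_open[OF chart]])
  moreover have "t \<in> ?N" using t c by auto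
  moreover have "\<forall>s\<in>?N. ?F (?\<eta> s) = (snd c' \<circ> (f \<circ> \<gamma>)) s"
    using chart by (simp add: local_rep_def)
  ultimately show "\<exists>N h. open N \<and> t \<in> N \<and> h C1_differentiable_on (?X \<inter> N) \<and> (\<forall>s\<in>N. h s = (snd c' \<circ> (f \<circ> \<gamma>)) s)"
    by blast
qed

lemma piecewise_C1_curve_image:
  assumes A: "differentiable_structure A" and f: "Ck_map 1 A f" and \<gamma>: "piecewise_C1_curve A \<gamma>"
  shows "piecewise_C1_curve A (f \<circ> \<gamma>)"
proof -
  obtain S where S: "finite S" "\<And>c. c \<in> A \<Longrightarrow> (snd c \<circ> \<gamma>) C1_differentiable_on ({0..1} \<inter> \<gamma> -` fst c - S)"
    and cont: "continuous_on {0..1} \<gamma>"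
    using \<gamma> by (auto simp: piecewise_C1_curve_def)
  have "continuous_on {0..1} (f \<circ> \<gamma>)"
    using f by (intro continuous_on_compose cont) (auto simp: Ck_map_def intro: continuous_on_subset)
  moreover have "finite (S \<union> {0, 1})" using S(1) by simp
  ultimately show ?thesis
    unfolding piecewise_C1_curve_def using C1_curve_image[OF A f cont S(2)] by blast
qed

section \<open>Speed and length of curves under isometries\<close>

lemma quadratic_form_transform:
  fixes D M :: "real^'n^'n"
  shows "v \<bullet> ((transpose D ** M ** D) *v v) = (D *v v) \<bullet> (M *v (D *v v))"
proof -
  have "v \<bullet> ((transpose D ** M ** D) *v v) = (transpose D *v (M *v (D *v v))) \<bullet> v"
    by (simp only: matrix_vector_mul_assoc[symmetric] inner_commute)
  also have "\<dots> = (M *v (D *v v)) \<bullet> (D *v v)"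
    by (simp only: transpose_matrix_vector dot_lmul_matrix)
  finally show ?thesis by (simp only: inner_commute)
qed

lemma Ck_map_decr: "Ck_map (Suc k) A f \<Longrightarrow> Ck_map k A f"
  unfolding Ck_map_def using Ck_on_decr by blast

text \<open>The left side is measured in the chart chosen around the image point, the right side in
  any chart around the original point. With f = id it states that speed is independent of the chart;
  comparing with the chosen chart gives its invariance under isometries.\<close>

lemma speed_image_chart:
  assumes A: "differentiable_structure A" and f: "Ck_map 1 A f" "preserves_metric A g f"
    and \<gamma>: "continuous_on {0..1} \<gamma>" "\<And>c. c \<in> A \<Longrightarrow> (snd c \<circ> \<gamma>) C1_differentiable_on ({0..1} \<inter> \<gamma> -` fst c - S)"
    and t: "t \<in> {0<..<1} - S" and c: "c \<in> A" "\<gamma> t \<in> fst c"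
  shows "speed A g (f \<circ> \<gamma>) t = (let v = vector_derivative (snd c \<circ> \<gamma>) (at t)
    in sqrt (v \<bullet> (g c (snd c (\<gamma> t)) *v v)))"
proof -
  let ?c' = "chart_at A (f (\<gamma> t))"
  let ?F = "local_rep f c ?c'" and ?\<eta> = "snd c \<circ> \<gamma>"
  note c' = chart_at[OF A, of "f (\<gamma> t)"]
  note chart = atlas_chart[OF A c(1)]
  let ?v = "vector_derivative ?\<eta> (at t)" and ?w = "vector_derivative (snd ?c' \<circ> (f \<circ> \<gamma>)) (at t)"
  define D where "D = matrix (frechet_derivative ?F (at (?\<eta> t)))"
  have dom: "?\<eta> t \<in> local_dom f c ?c'"
    using c c' chart by (simp add: local_dom_iff)
  have F: "?F differentiable (at (?\<eta> t))"
    using f c c' dom by (auto simp: Ck_map_def)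
  have "?\<eta> differentiable (at t)"
    using \<gamma>(2)[OF c(1)] c(2) t by (auto simp: C1_differentiable_on_eq)
  from vector_derivative_compose_partial[OF this F]
  have "((\<lambda>t. ?F (?\<eta> t)) has_vector_derivative (\<Sum>i\<in>UNIV. ?v $ i *\<^sub>R partial i ?F (?\<eta> t))) (at t)" .
  then have "((snd ?c' \<circ> (f \<circ> \<gamma>)) has_vector_derivative (\<Sum>i\<in>UNIV. ?v $ i *\<^sub>R partial i ?F (?\<eta> t))) (at t)"
  proof (rule has_vector_derivative_transform_within_open)
    show "open ({0<..<1} \<inter> \<gamma> -` fst c)"
      by (rule open_curve_vimage[OF \<gamma>(1) chart_open[OF chart]])
    show "t \<in> {0<..<1} \<inter> \<gamma> -` fst c" using t c by simp
    show "?F (?\<eta> s) = (snd ?c' \<circ> (f \<circ> \<gamma>)) s" if "s \<in> {0<..<1} \<inter> \<gamma> -` fst c" for s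
      using that chart by (simp add: local_rep_def)
  qed
  then have "?w = (\<Sum>i\<in>UNIV. ?v $ i *\<^sub>R partial i ?F (?\<eta> t))"
    by (rule vector_derivative_at)
  also have "\<dots> = D *v ?v"
    by (simp add: vec_eq_iff D_def matrix_vector_mult_def matrix_frechet_derivative mult.commute)
  finally have w: "?w = D *v ?v" .
  have gD: "g c (?\<eta> t) = transpose D ** g ?c' (?F (?\<eta> t)) ** D"
    using f c c' dom by (auto simp: preserves_metric_def D_def Let_def)
  have "?F (?\<eta> t) = snd ?c' (f (\<gamma> t))"
    using chart c by (simp add: local_rep_def)
  then have "?w \<bullet> (g ?c' (snd ?c' (f (\<gamma> t))) *v ?w) = ?v \<bullet> (g c (?\<eta> t) *v ?v)"
    unfolding gD w by (simp add: quadratic_form_transform)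
  then show ?thesis
    by (simp add: speed_def Let_def)
qed

lemma speed_isometry:
  assumes A: "differentiable_structure A" and f: "riemannian_isometry A g f"
    and \<gamma>: "continuous_on {0..1} \<gamma>" "\<And>c. c \<in> A \<Longrightarrow> (snd c \<circ> \<gamma>) C1_differentiable_on ({0..1} \<inter> \<gamma> -` fst c - S)"
    and t: "t \<in> {0<..<1} - S"
  shows "speed A g (f \<circ> \<gamma>) t = speed A g \<gamma> t"
proof -
  have f': "Ck_map 1 A f" "preserves_metric A g f"
    using f by (auto simp: riemannian_isometry_def numeral_eq_Suc intro: Ck_map_decr)
  show ?thesis
    using speed_image_chart[OF A f' \<gamma> t chart_at[OF A]] by (simp add: speed_def Let_def)
qed

lemma curve_length_cong:
  assumes "finite S" "\<And>t. t \<in> {0<..<1} - S \<Longrightarrow> speed A g \<gamma> t = speed A g \<gamma>' t"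
  shows "curve_length A g \<gamma> = curve_length A g \<gamma>'"
  unfolding curve_length_def
proof (rule nn_integral_cong_AE)
  have "finite (S \<union> {0, 1})" using assms(1) by simp
  then have "S \<union> {0, 1} \<in> null_sets lborel" by (rule finite_imp_null_set_lborel)
  then have "AE t in lborel. t \<notin> S \<union> {0, 1}" by (rule AE_not_in)
  then show "AE t in lborel. ennreal (speed A g \<gamma> t) * indicator {0..1} t = ennreal (speed A g \<gamma>' t) * indicator {0..1} t"
    by eventually_elim (use assms(2) in \<open>auto simp: indicator_def\<close>)
qed

lemma curve_length_isometry:
  assumes A: "differentiable_structure A" and f: "riemannian_isometry A g f" and \<gamma>: "piecewise_C1_curve A \<gamma>"
  shows "curve_length A g (f \<circ> \<gamma>) = curve_length A g \<gamma>"
proof -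
  obtain S where S: "finite S" "\<And>c. c \<in> A \<Longrightarrow> (snd c \<circ> \<gamma>) C1_differentiable_on ({0..1} \<inter> \<gamma> -` fst c - S)"
    and cont: "continuous_on {0..1} \<gamma>"
    using \<gamma> by (auto simp: piecewise_C1_curve_def)
  show ?thesis
    by (rule curve_length_cong[OF S(1)]) (rule speed_isometry[OF A f cont S(2)])
qed

text \<open>The infimum before infinity is discarded. In this form symmetry and the triangle
  inequality hold without any finiteness condition.\<close>

definition geodesic_edist ::
  "('m::topological_space, 'n::finite) chart set \<Rightarrow> ('m, 'n) metric \<Rightarrow> 'm \<Rightarrow> 'm \<Rightarrow> ennreal" where
  "geodesic_edist A g p q =
     (INF \<gamma>\<in>{\<gamma>. piecewise_C1_curve A \<gamma> \<and> \<gamma> 0 = p \<and> \<gamma> 1 = q}. curve_length A g \<gamma>)"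

lemma geodesic_edist_lower:
  "piecewise_C1_curve A \<gamma> \<Longrightarrow> \<gamma> 0 = p \<Longrightarrow> \<gamma> 1 = q \<Longrightarrow> geodesic_edist A g p q \<le> curve_length A g \<gamma>"
  unfolding geodesic_edist_def by (rule INF_lower) simp

lemma geodesic_edist_isometry:
  assumes A: "differentiable_structure A" and f: "riemannian_isometry A g f"
  shows "geodesic_edist A g (f p) (f q) = geodesic_edist A g p q"
proof (rule antisym)
  have f': "bij f" "Ck_map 1 A f" "Ck_map 1 A (inv f)"
    using f by (auto simp: riemannian_isometry_def numeral_eq_Suc intro: Ck_map_decr)
  show "geodesic_edist A g (f p) (f q) \<le> geodesic_edist A g p q"
    unfolding geodesic_edist_def[of _ _ p q]
  proof (rule INF_greatest)
    fix \<gamma> assume "\<gamma> \<in> {\<gamma>. piecewise_C1_curve A \<gamma> \<and> \<gamma> 0 = p \<and> \<gamma> 1 = q}"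
    then have \<gamma>: "piecewise_C1_curve A \<gamma>" "\<gamma> 0 = p" "\<gamma> 1 = q" by auto
    have "geodesic_edist A g (f p) (f q) \<le> curve_length A g (f \<circ> \<gamma>)"
      by (rule geodesic_edist_lower[OF piecewise_C1_curve_image[OF A f'(2) \<gamma>(1)]]) (simp_all add: \<gamma>)
    then show "geodesic_edist A g (f p) (f q) \<le> curve_length A g \<gamma>"
      by (simp only: curve_length_isometry[OF A f \<gamma>(1)])
  qed
  show "geodesic_edist A g p q \<le> geodesic_edist A g (f p) (f q)"
    unfolding geodesic_edist_def[of _ _ "f p" "f q"]
  proof (rule INF_greatest)
    fix \<gamma> assume "\<gamma> \<in> {\<gamma>. piecewise_C1_curve A \<gamma> \<and> \<gamma> 0 = f p \<and> \<gamma> 1 = f q}"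
    then have \<gamma>: "piecewise_C1_curve A \<gamma>" "\<gamma> 0 = f p" "\<gamma> 1 = f q" by auto
    have \<gamma>': "piecewise_C1_curve A (inv f \<circ> \<gamma>)"
      by (rule piecewise_C1_curve_image[OF A f'(3) \<gamma>(1)])
    have "geodesic_edist A g p q \<le> curve_length A g (inv f \<circ> \<gamma>)"
      by (rule geodesic_edist_lower[OF \<gamma>']) (simp_all add: \<gamma> bij_is_inj[OF f'(1)])
    \<comment> \<open>An isometry is only assumed to preserve the metric in the forward direction,
      so length invariance is applied to f along the curve
      \<open>inv f \<circ> \<gamma>\<close>.\<close>
    also have "\<dots> = curve_length A g (f \<circ> (inv f \<circ> \<gamma>))"
      by (rule curve_length_isometry[OF A f \<gamma>', symmetric])
    also have "f \<circ> (inv f \<circ> \<gamma>) = \<gamma>"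
      using surj_f_inv_f[OF bij_is_surj[OF f'(1)]] by (simp add: fun_eq_iff)
    finally show "geodesic_edist A g p q \<le> curve_length A g \<gamma>" .
  qed
qed

lemma geodesic_dist_isometry:
  assumes "differentiable_structure A" "riemannian_isometry A g f"
  shows "geodesic_dist A g (f p) (f q) = geodesic_dist A g p q"
  using geodesic_edist_isometry[OF assms] by (simp add: geodesic_dist_def geodesic_edist_def)

lemma
  assumes "riemannian_manifold A g"
  shows manifold_atlas: "differentiable_structure A"
    and metric_Ck_on: "c \<in> A \<Longrightarrow> Ck_on 2 (chart_image c) (g c)"
    and metric_symmetric: "c \<in> A \<Longrightarrow> z \<in> chart_image c \<Longrightarrow> transpose (g c z) = g c z"
    and metric_pos: "c \<in> A \<Longrightarrow> z \<in> chart_image c \<Longrightarrow> v \<noteq> 0 \<Longrightarrow> v \<bullet> (g c z *v v) > 0"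
    and metric_transform: "preserves_metric A g id"
  using assms unfolding riemannian_manifold_def by blast+

lemma Ck_map_id:
  assumes "differentiable_structure A"
  shows "Ck_map 1 A id"
proof -
  have "Ck_on 3 (local_dom id c c') (local_rep id c c')" if "c \<in> A" "c' \<in> A" for c c'
    using atlas_compatible[OF assms that] by (simp add: compatible_def)
  then have "Ck_map 3 A id"
    by (simp add: Ck_map_def)
  then show ?thesis
    by (auto simp: numeral_eq_Suc intro: Ck_map_decr)
qed

lemma speed_eq_chart:
  assumes M: "riemannian_manifold A g"
    and \<gamma>: "continuous_on {0..1} \<gamma>" "\<And>c. c \<in> A \<Longrightarrow> (snd c \<circ> \<gamma>) C1_differentiable_on ({0..1} \<inter> \<gamma> -` fst c - S)"
    and t: "t \<in> {0<..<1} - S" and c: "c \<in> A" "\<gamma> t \<in> fst c"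
  shows "speed A g \<gamma> t = (let v = vector_derivative (snd c \<circ> \<gamma>) (at t)
    in sqrt (v \<bullet> (g c (snd c (\<gamma> t)) *v v)))"
  using speed_image_chart[OF manifold_atlas[OF M] Ck_map_id[OF manifold_atlas[OF M]] metric_transform[OF M] \<gamma> t c]
  by simp

lemma continuous_on_matrix_vector_mult:
  fixes G :: "'a::topological_space \<Rightarrow> real^'n^'m"
  assumes "continuous_on S G" "continuous_on S v"
  shows "continuous_on S (\<lambda>x. G x *v v x)"
  unfolding matrix_vector_mult_def by (intro continuous_intros assms)

text \<open>The chart in the definition of \<open>speed\<close> is chosen anew at every point,
  without any regularity. Around each time the speed is rewritten in one fixed chart, where it is a
  continuous expression. Measurability, needed for substitution and additivity of lengths, follows
  from this.\<close>

lemma continuous_on_speed: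
  assumes M: "riemannian_manifold A g"
    and \<gamma>: "continuous_on {0..1} \<gamma>" "\<And>c. c \<in> A \<Longrightarrow> (snd c \<circ> \<gamma>) C1_differentiable_on ({0..1} \<inter> \<gamma> -` fst c - S)"
  shows "continuous_on ({0<..<1} - S) (speed A g \<gamma>)"
  unfolding continuous_on_eq_continuous_within
proof
  let ?X = "{0<..<1} - S"
  fix t assume t: "t \<in> ?X"
  note A = manifold_atlas[OF M]
  obtain c where c: "c \<in> A" "\<gamma> t \<in> fst c" using atlas_cover[OF A] by blast
  note chart = atlas_chart[OF A c(1)]
  let ?N = "{0<..<1} \<inter> \<gamma> -` fst c" and ?v = "\<lambda>s. vector_derivative (snd c \<circ> \<gamma>) (at s)"
  have N: "open ?N"
    by (rule open_curve_vimage[OF \<gamma>(1) chart_open[OF chart]])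
  have "(snd c \<circ> \<gamma>) C1_differentiable_on (?X \<inter> ?N)"
    by (rule C1_differentiable_on_subset[OF \<gamma>(2)[OF c(1)]]) auto
  then have v: "continuous_on (?X \<inter> ?N) ?v"
    by (simp add: C1_differentiable_on_eq)
  have \<eta>: "continuous_on (?X \<inter> ?N) (snd c \<circ> \<gamma>)"
    by (intro continuous_on_compose continuous_on_subset[OF \<gamma>(1)] continuous_on_subset[OF chart_continuous[OF chart]]) auto
  have "continuous_on (?X \<inter> ?N) (\<lambda>s. g c ((snd c \<circ> \<gamma>) s))"
    by (rule continuous_on_compose2[OF Ck_on_continuous_on[OF metric_Ck_on[OF M c(1)]] \<eta>]) auto
  then have "continuous_on (?X \<inter> ?N) (\<lambda>s. sqrt (?v s \<bullet> (g c (snd c (\<gamma> s)) *v ?v s)))"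
    by (intro continuous_intros v continuous_on_matrix_vector_mult) simp
  then have "continuous_on (?X \<inter> ?N) (speed A g \<gamma>)"
  proof (rule continuous_on_eq)
    fix s assume s: "s \<in> ?X \<inter> ?N"
    show "sqrt (?v s \<bullet> (g c (snd c (\<gamma> s)) *v ?v s)) = speed A g \<gamma> s"
      using speed_eq_chart[OF M \<gamma> _ c(1), of s] s by (simp add: Let_def)
  qed
  then have "continuous (at t within (?X \<inter> ?N)) (speed A g \<gamma>)"
    using t c by (simp add: continuous_on_eq_continuous_within)
  moreover have "at t within ?X = at t within (?X \<inter> ?N)"
    by (rule at_within_nhd[OF _ N]) (use t c in auto)
  ultimately show "continuous (at t within ?X) (speed A g \<gamma>)" by simp
qed

lemma measurable_speed:
  assumes M: "riemannian_manifold A g" and "finite S"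
    and \<gamma>: "continuous_on {0..1} \<gamma>" "\<And>c. c \<in> A \<Longrightarrow> (snd c \<circ> \<gamma>) C1_differentiable_on ({0..1} \<inter> \<gamma> -` fst c - S)"
  shows "(\<lambda>t. ennreal (indicator ({0<..<1} - S) t * speed A g \<gamma> t)) \<in> borel_measurable borel"
proof -
  have "open ({0<..<1} - S)"
    using assms(2) by (simp add: open_Diff finite_imp_closed)
  from borel_measurable_continuous_on_indicator[OF borel_open[OF this] continuous_on_speed[OF M \<gamma>]]
  show ?thesis by simp
qed

text \<open>At the exceptional times the speed is arbitrary. Lengths are therefore computed with a
  measurable representative f that may differ from it on a finite set.\<close>

lemma curve_length_eq:
  assumes "finite S" "\<And>t. t \<in> {0<..<1} - S \<Longrightarrow> ennreal (speed A g \<gamma> t) = f t"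
    "\<And>t. t \<notin> {0..1} \<union> S \<Longrightarrow> f t = 0"
  shows "curve_length A g \<gamma> = (\<integral>\<^sup>+t. f t \<partial>lborel)"
  unfolding curve_length_def
proof (rule nn_integral_cong_AE)
  have "finite (S \<union> {0, 1})" using assms(1) by simp
  then have "S \<union> {0, 1} \<in> null_sets lborel" by (rule finite_imp_null_set_lborel)
  then have "AE t in lborel. t \<notin> S \<union> {0, 1}" by (rule AE_not_in)
  then show "AE t in lborel. ennreal (speed A g \<gamma> t) * indicator {0..1} t = f t"
  proof eventually_elim
    case (elim t)
    then show ?case using assms(2,3)[of t] by (auto simp: indicator_def)
  qed
qed

section \<open>Reversal and concatenation of curves\<close>

lemma C1_differentiable_on_affine:
  assumes "f C1_differentiable_on Y" "\<And>s. s \<in> X \<Longrightarrow> a * s + b \<in> Y"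
  shows "(\<lambda>s. f (a * s + b)) C1_differentiable_on X"
proof -
  obtain D where D: "\<And>t. t \<in> Y \<Longrightarrow> (f has_vector_derivative D t) (at t)" "continuous_on Y D"
    using assms(1) by (auto simp: C1_differentiable_on_def)
  have "((\<lambda>s. f (a * s + b)) has_vector_derivative a *\<^sub>R D (a * s + b)) (at s)" if s: "s \<in> X" for s
  proof -
    have "((\<lambda>s. a * s + b) has_vector_derivative a) (at s)"
      by (auto intro!: derivative_eq_intros)
    from vector_diff_chain_at[OF this D(1)[OF assms(2)[OF s]]] show ?thesis
      by (simp add: o_def)
  qed
  moreover have "continuous_on X (\<lambda>s. a *\<^sub>R D (a * s + b))"
    by (intro continuous_intros continuous_on_compose2[OF D(2)]) (use assms(2) in auto)
  ultimately show ?thesis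
    unfolding C1_differentiable_on_def by (intro exI[of _ "\<lambda>s. a *\<^sub>R D (a * s + b)"]) auto
qed

lemma speed_affine:
  assumes A: "differentiable_structure A"
    and \<gamma>: "\<And>c. c \<in> A \<Longrightarrow> (snd c \<circ> \<gamma>) C1_differentiable_on ({0..1} \<inter> \<gamma> -` fst c - S)"
    and s: "a * s + b \<in> {0..1} - S"
  shows "speed A g (\<lambda>s. \<gamma> (a * s + b)) s = \<bar>a\<bar> * speed A g \<gamma> (a * s + b)"
proof -
  let ?t = "a * s + b"
  let ?c = "chart_at A (\<gamma> ?t)"
  let ?v = "vector_derivative (snd ?c \<circ> \<gamma>) (at ?t)"
  have "(snd ?c \<circ> \<gamma>) differentiable (at ?t)"
    using \<gamma>[OF chart_at(1)[OF A]] chart_at(2)[OF A, of "\<gamma> ?t"] s by (auto simp: C1_differentiable_on_eq)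
  then have "((snd ?c \<circ> \<gamma>) has_vector_derivative ?v) (at ?t)"
    using vector_derivative_works by blast
  moreover have "((\<lambda>s. a * s + b) has_vector_derivative a) (at s)"
    by (auto intro!: derivative_eq_intros)
  ultimately have "((snd ?c \<circ> \<gamma>) \<circ> (\<lambda>s. a * s + b) has_vector_derivative a *\<^sub>R ?v) (at s)"
    by (rule vector_diff_chain_at[rotated])
  then have "vector_derivative (snd ?c \<circ> (\<lambda>s. \<gamma> (a * s + b))) (at s) = a *\<^sub>R ?v"
    using vector_derivative_at by (simp add: o_def)
  then have "speed A g (\<lambda>s. \<gamma> (a * s + b)) s = sqrt (a\<^sup>2 * (?v \<bullet> (g ?c (snd ?c (\<gamma> ?t)) *v ?v)))"
    by (simp add: speed_def Let_def matrix_vector_mult_scaleR power2_eq_square mult.assoc)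
  then show ?thesis
    by (simp add: speed_def Let_def real_sqrt_mult)
qed

lemma speed_cong_open:
  assumes "open N" "t \<in> N" "\<And>s. s \<in> N \<Longrightarrow> \<gamma> s = \<gamma>' s"
  shows "speed A g \<gamma> t = speed A g \<gamma>' t"
proof -
  have "vector_derivative (F \<circ> \<gamma>) (at t) = vector_derivative (F \<circ> \<gamma>') (at t)" for F :: "'a \<Rightarrow> real^'b"
  proof -
    have "(F \<circ> \<gamma> has_vector_derivative D) (at t) \<longleftrightarrow> (F \<circ> \<gamma>' has_vector_derivative D) (at t)" for D
      using has_vector_derivative_transform_within_open[of "F \<circ> \<gamma>" D t N "F \<circ> \<gamma>'"]
        has_vector_derivative_transform_within_open[of "F \<circ> \<gamma>'" D t N "F \<circ> \<gamma>"] assms by auto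
    then show ?thesis by (simp add: vector_derivative_def)
  qed
  then show ?thesis
    using assms(2,3) by (simp add: speed_def Let_def)
qed

lemma geodesic_edist_commute_le:
  assumes M: "riemannian_manifold A g"
  shows "geodesic_edist A g q p \<le> geodesic_edist A g p q"
  unfolding geodesic_edist_def[of A g p q]
proof (rule INF_greatest)
  fix \<gamma> assume "\<gamma> \<in> {\<gamma>. piecewise_C1_curve A \<gamma> \<and> \<gamma> 0 = p \<and> \<gamma> 1 = q}"
  then obtain S where S: "finite S" and cont: "continuous_on {0..1} \<gamma>"
    and \<gamma>: "\<And>c. c \<in> A \<Longrightarrow> (snd c \<circ> \<gamma>) C1_differentiable_on ({0..1} \<inter> \<gamma> -` fst c - S)" and pq: "\<gamma> 0 = p" "\<gamma> 1 = q"
    by (auto simp: piecewise_C1_curve_def)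
  let ?r = "\<lambda>s. -1 * s + (1::real)" and ?S = "(\<lambda>s. 1 - s) ` S"
  let ?\<delta> = "\<lambda>s. \<gamma> (?r s)"
  have "continuous_on {0..1} ?\<delta>"
    by (intro continuous_on_compose2[OF cont]) (auto intro!: continuous_intros)
  moreover have "(snd c \<circ> ?\<delta>) C1_differentiable_on ({0..1} \<inter> ?\<delta> -` fst c - ?S)" if "c \<in> A" for c
  proof -
    have "(\<lambda>s. (snd c \<circ> \<gamma>) (?r s)) C1_differentiable_on ({0..1} \<inter> ?\<delta> -` fst c - ?S)"
    proof (rule C1_differentiable_on_affine[OF \<gamma>[OF that]])
      fix s assume s: "s \<in> {0..1} \<inter> ?\<delta> -` fst c - ?S"
      have "?r s \<notin> S"
      proof
        assume "?r s \<in> S"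
        then have "1 - ?r s \<in> ?S" by (rule imageI)
        with s show False by simp
      qed
      with s show "?r s \<in> {0..1} \<inter> \<gamma> -` fst c - S" by simp
    qed
    then show ?thesis by (simp add: o_def)
  qed
  ultimately have \<delta>: "piecewise_C1_curve A ?\<delta>"
    unfolding piecewise_C1_curve_def using S by blast
  let ?h = "\<lambda>t. ennreal (indicator ({0<..<1} - S) t * speed A g \<gamma> t)"
  have h: "?h \<in> borel_measurable borel"
    by (rule measurable_speed[OF M S cont \<gamma>])
  have "geodesic_edist A g q p \<le> curve_length A g ?\<delta>"
    by (rule geodesic_edist_lower[OF \<delta>]) (simp_all add: pq)
  also have "\<dots> = (\<integral>\<^sup>+s. ?h (1 + (-1) * s) \<partial>lborel)"
  proof (rule curve_length_eq)
    show "finite ?S" using S by simp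
    show "ennreal (speed A g ?\<delta> t) = ?h (1 + (-1) * t)" if t: "t \<in> {0<..<1} - ?S" for t
    proof -
      have "?r t \<notin> S"
      proof
        assume "?r t \<in> S"
        then have "1 - ?r t \<in> ?S" by (rule imageI)
        with t show False by simp
      qed
      then have r: "?r t \<in> {0..1} - S" "1 + (-1) * t \<in> {0<..<1} - S" using t by auto
      show ?thesis
        using speed_affine[OF manifold_atlas[OF M] \<gamma> r(1), of g] r(2) by (simp add: indicator_def)
    qed
  qed (auto simp: indicator_def)
  also have "\<dots> = (\<integral>\<^sup>+t. ?h t \<partial>lborel)"
    using nn_integral_real_affine[OF h, of "-1" 1] by simp
  also have "\<dots> = curve_length A g \<gamma>"
    by (rule curve_length_eq[symmetric, OF S]) (auto simp: indicator_def)
  finally show "geodesic_edist A g q p \<le> curve_length A g \<gamma>" .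
qed

text \<open>The normalisation of J measures the distance from x to the centre, a polar chart the
  distance from the centre to x.\<close>

lemma geodesic_dist_commute:
  assumes M: "riemannian_manifold A g"
  shows "geodesic_dist A g p q = geodesic_dist A g q p"
  using antisym[OF geodesic_edist_commute_le[OF M] geodesic_edist_commute_le[OF M], of p q]
  by (simp add: geodesic_dist_def geodesic_edist_def)

lemma piecewise_C1_joinpaths:
  assumes \<gamma>: "continuous_on {0..1} \<gamma>" "\<And>c. c \<in> A \<Longrightarrow> (snd c \<circ> \<gamma>) C1_differentiable_on ({0..1} \<inter> \<gamma> -` fst c - S)"
    and \<delta>: "continuous_on {0..1} \<delta>" "\<And>c. c \<in> A \<Longrightarrow> (snd c \<circ> \<delta>) C1_differentiable_on ({0..1} \<inter> \<delta> -` fst c - T)"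
    and eq: "\<gamma> 1 = \<delta> 0" and fin: "finite S" "finite T"
  shows "piecewise_C1_curve A (\<gamma> +++ \<delta>)"
proof -
  \<comment> \<open>The exceptional times of both curves in the parameter of the joined curve, and
    the junction, where the two velocities need not match.\<close>
  let ?U = "{1/2} \<union> (\<lambda>s. s / 2) ` S \<union> (\<lambda>s. (s + 1) / 2) ` T"
  have "continuous_on {0..1} (\<gamma> +++ \<delta>)"
    using \<gamma>(1) \<delta>(1) eq by (intro continuous_on_joinpaths) (auto simp: pathfinish_def pathstart_def)
  moreover have "finite ?U" using fin by simp
  moreover have "(snd c \<circ> (\<gamma> +++ \<delta>)) C1_differentiable_on ({0..1} \<inter> (\<gamma> +++ \<delta>) -` fst c - ?U)" (is "_ C1_differentiable_on ?X")
    if c: "c \<in> A" for c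
  proof (rule C1_differentiable_on_local)
    fix t assume t: "t \<in> ?X"
    show "\<exists>N h. open N \<and> t \<in> N \<and> h C1_differentiable_on (?X \<inter> N) \<and> (\<forall>s\<in>N. h s = (snd c \<circ> (\<gamma> +++ \<delta>)) s)"
    proof (cases "t < 1/2")
      case True
      have "(\<lambda>s. (snd c \<circ> \<gamma>) (2 * s + 0)) C1_differentiable_on (?X \<inter> {..<1/2})"
      proof (rule C1_differentiable_on_affine[OF \<gamma>(2)[OF c]])
        fix s assume s: "s \<in> ?X \<inter> {..<1/2}"
        have "2 * s \<notin> S"
        proof
          assume "2 * s \<in> S"
          then have "(2 * s) / 2 \<in> (\<lambda>s. s / 2) ` S" by (rule imageI)
          with s show False by simp
        qed
        with s show "2 * s + 0 \<in> {0..1} \<inter> \<gamma> -` fst c - S" by (auto simp: joinpaths_def)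
      qed
      moreover have "\<forall>s\<in>{..<1/2}. (\<lambda>s. (snd c \<circ> \<gamma>) (2 * s + 0)) s = (snd c \<circ> (\<gamma> +++ \<delta>)) s"
        by (simp add: joinpaths_def)
      moreover have "t \<in> {..<1/2}" using True by simp
      ultimately show ?thesis
        by (intro exI[of _ "{..<1/2}"] exI[of _ "\<lambda>s. (snd c \<circ> \<gamma>) (2 * s + 0)"] conjI open_lessThan)
    next
      case False
      have "(\<lambda>s. (snd c \<circ> \<delta>) (2 * s + (-1))) C1_differentiable_on (?X \<inter> {1/2<..})"
      proof (rule C1_differentiable_on_affine[OF \<delta>(2)[OF c]])
        fix s assume s: "s \<in> ?X \<inter> {1/2<..}"
        have "2 * s + (-1) \<notin> T"
        proof
          assume "2 * s + (-1) \<in> T"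
          then have "(2 * s + (-1) + 1) / 2 \<in> (\<lambda>s. (s + 1) / 2) ` T" by (rule imageI)
          with s show False by simp
        qed
        with s show "2 * s + (-1) \<in> {0..1} \<inter> \<delta> -` fst c - T" by (auto simp: joinpaths_def)
      qed
      moreover have "\<forall>s\<in>{1/2<..}. (\<lambda>s. (snd c \<circ> \<delta>) (2 * s + (-1))) s = (snd c \<circ> (\<gamma> +++ \<delta>)) s"
        by (simp add: joinpaths_def)
      moreover have "t \<in> {1/2<..}" using False t by auto
      ultimately show ?thesis
        by (intro exI[of _ "{1/2<..}"] exI[of _ "\<lambda>s. (snd c \<circ> \<delta>) (2 * s + (-1))"] conjI open_greaterThan)
    qed
  qed
  ultimately show ?thesis
    unfolding piecewise_C1_curve_def by (intro conjI exI[of _ ?U] ballI)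
qed

lemma curve_length_joinpaths:
  assumes M: "riemannian_manifold A g"
    and \<gamma>: "continuous_on {0..1} \<gamma>" "\<And>c. c \<in> A \<Longrightarrow> (snd c \<circ> \<gamma>) C1_differentiable_on ({0..1} \<inter> \<gamma> -` fst c - S)"
    and \<delta>: "continuous_on {0..1} \<delta>" "\<And>c. c \<in> A \<Longrightarrow> (snd c \<circ> \<delta>) C1_differentiable_on ({0..1} \<inter> \<delta> -` fst c - T)"
    and fin: "finite S" "finite T"
  shows "curve_length A g (\<gamma> +++ \<delta>) = curve_length A g \<gamma> + curve_length A g \<delta>"
proof -
  note A = manifold_atlas[OF M]
  let ?U = "{1/2} \<union> (\<lambda>s. s / 2) ` S \<union> (\<lambda>s. (s + 1) / 2) ` T"
  let ?h = "\<lambda>t. ennreal (indicator ({0<..<1} - S) t * speed A g \<gamma> t)"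
  let ?k = "\<lambda>t. ennreal (indicator ({0<..<1} - T) t * speed A g \<delta> t)"
  have h: "?h \<in> borel_measurable borel"
    by (rule measurable_speed[OF M fin(1) \<gamma>])
  have k: "?k \<in> borel_measurable borel"
    by (rule measurable_speed[OF M fin(2) \<delta>])
  \<comment> \<open>Each half is run at double speed. The indicators inside \<open>?h\<close> and
    \<open>?k\<close> switch the halves on and off, so one integrand on the whole line serves both,
    and an affine substitution absorbs the factor 2.\<close>
  have "curve_length A g (\<gamma> +++ \<delta>) = (\<integral>\<^sup>+t. 2 * ?h (0 + 2 * t) + 2 * ?k (-1 + 2 * t) \<partial>lborel)"
  proof (rule curve_length_eq)
    show "finite ?U" using fin by simp
    fix t assume t: "t \<in> {0<..<1} - ?U"
    show "ennreal (speed A g (\<gamma> +++ \<delta>) t) = 2 * ?h (0 + 2 * t) + 2 * ?k (-1 + 2 * t)"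
    proof (cases "t < 1/2")
      case True
      have "2 * t \<notin> S"
      proof
        assume "2 * t \<in> S"
        then have "(2 * t) / 2 \<in> (\<lambda>s. s / 2) ` S" by (rule imageI)
        with t show False by simp
      qed
      with t True have r: "2 * t + 0 \<in> {0..1} - S" "0 + 2 * t \<in> {0<..<1} - S" "-1 + 2 * t \<notin> {0<..<1} - T" by auto
      have "speed A g (\<gamma> +++ \<delta>) t = speed A g (\<lambda>s. \<gamma> (2 * s + 0)) t"
        by (rule speed_cong_open[of "{..<1/2}"]) (use True in \<open>auto simp: joinpaths_def\<close>)
      also have "\<dots> = 2 * speed A g \<gamma> (2 * t)"
        using speed_affine[OF A \<gamma>(2) r(1), of g] by simp
      finally show ?thesis
        using r(2,3) by (simp add: indicator_def ennreal_mult')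
    next
      case False
      then have t': "t > 1/2" using t by auto
      have "2 * t + (-1) \<notin> T"
      proof
        assume "2 * t + (-1) \<in> T"
        then have "(2 * t + (-1) + 1) / 2 \<in> (\<lambda>s. (s + 1) / 2) ` T" by (rule imageI)
        with t show False by simp
      qed
      with t t' have r: "2 * t + (-1) \<in> {0..1} - T" "-1 + 2 * t \<in> {0<..<1} - T" "0 + 2 * t \<notin> {0<..<1} - S" by auto
      have "speed A g (\<gamma> +++ \<delta>) t = speed A g (\<lambda>s. \<delta> (2 * s + (-1))) t"
        by (rule speed_cong_open[of "{1/2<..}"]) (use t' in \<open>auto simp: joinpaths_def\<close>)
      also have "\<dots> = 2 * speed A g \<delta> (2 * t + (-1))"
        using speed_affine[OF A \<delta>(2) r(1), of g] by simp
      finally show ?thesis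
        using r(2,3) by (simp add: indicator_def ennreal_mult')
    qed
  qed (auto simp: indicator_def)
  also have "\<dots> = 2 * (\<integral>\<^sup>+t. ?h (0 + 2 * t) \<partial>lborel) + 2 * (\<integral>\<^sup>+t. ?k (-1 + 2 * t) \<partial>lborel)"
  proof -
    have "(\<lambda>t. ?h (0 + 2 * t)) \<in> borel_measurable lborel" "(\<lambda>t. ?k (-1 + 2 * t)) \<in> borel_measurable lborel"
      by (rule measurable_compose[OF _ h], simp, rule measurable_compose[OF _ k], simp)
    then show ?thesis
      by (simp add: nn_integral_add nn_integral_cmult)
  qed
  also have "2 * (\<integral>\<^sup>+t. ?h (0 + 2 * t) \<partial>lborel) = (\<integral>\<^sup>+t. ?h t \<partial>lborel)"
    using nn_integral_real_affine[OF h, of 2 0] by simp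
  also have "2 * (\<integral>\<^sup>+t. ?k (-1 + 2 * t) \<partial>lborel) = (\<integral>\<^sup>+t. ?k t \<partial>lborel)"
    using nn_integral_real_affine[OF k, of 2 "-1"] by simp
  also have "(\<integral>\<^sup>+t. ?h t \<partial>lborel) = curve_length A g \<gamma>"
    by (rule curve_length_eq[symmetric, OF fin(1)]) (auto simp: indicator_def)
  also have "(\<integral>\<^sup>+t. ?k t \<partial>lborel) = curve_length A g \<delta>"
    by (rule curve_length_eq[symmetric, OF fin(2)]) (auto simp: indicator_def)
  finally show ?thesis .
qed

lemma geodesic_edist_triangle:
  assumes M: "riemannian_manifold A g"
  shows "geodesic_edist A g p r \<le> geodesic_edist A g p q + geodesic_edist A g q r"
proof (rule ennreal_le_epsilon)
  fix e :: real
  assume fin: "geodesic_edist A g p q + geodesic_edist A g q r < top" and e: "0 < e"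
  have "\<exists>\<gamma>. (piecewise_C1_curve A \<gamma> \<and> \<gamma> 0 = x \<and> \<gamma> 1 = y) \<and> curve_length A g \<gamma> < geodesic_edist A g x y + ennreal (e/2)"
    if "geodesic_edist A g x y < top" for x y
  proof -
    have "geodesic_edist A g x y < geodesic_edist A g x y + ennreal (e/2)"
      using that e by (cases "geodesic_edist A g x y") (auto simp: ennreal_less_iff simp flip: ennreal_plus)
    then show ?thesis
      unfolding geodesic_edist_def[of _ _ x y] INF_less_iff by auto
  qed
  note * = this
  obtain \<gamma> where \<gamma>: "piecewise_C1_curve A \<gamma>" "\<gamma> 0 = p" "\<gamma> 1 = q"
    "curve_length A g \<gamma> < geodesic_edist A g p q + ennreal (e/2)"
    using *[of p q] fin by (auto simp: less_top)
  obtain \<delta> where \<delta>: "piecewise_C1_curve A \<delta>" "\<delta> 0 = q" "\<delta> 1 = r"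
    "curve_length A g \<delta> < geodesic_edist A g q r + ennreal (e/2)"
    using *[of q r] fin by (auto simp: less_top)
  obtain S where S: "finite S" "continuous_on {0..1} \<gamma>"
    "\<And>c. c \<in> A \<Longrightarrow> (snd c \<circ> \<gamma>) C1_differentiable_on ({0..1} \<inter> \<gamma> -` fst c - S)"
    using \<gamma>(1) by (auto simp: piecewise_C1_curve_def)
  obtain T where T: "finite T" "continuous_on {0..1} \<delta>"
    "\<And>c. c \<in> A \<Longrightarrow> (snd c \<circ> \<delta>) C1_differentiable_on ({0..1} \<inter> \<delta> -` fst c - T)"
    using \<delta>(1) by (auto simp: piecewise_C1_curve_def)
  have "geodesic_edist A g p r \<le> curve_length A g (\<gamma> +++ \<delta>)"
    by (rule geodesic_edist_lower[OF piecewise_C1_joinpaths[OF S(2,3) T(2,3) _ S(1) T(1)]])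
      (simp_all add: \<gamma> \<delta> joinpaths_def)
  also have "\<dots> = curve_length A g \<gamma> + curve_length A g \<delta>"
    by (rule curve_length_joinpaths[OF M S(2,3) T(2,3) S(1) T(1)])
  also have "\<dots> \<le> (geodesic_edist A g p q + ennreal (e/2)) + (geodesic_edist A g q r + ennreal (e/2))"
    by (intro add_mono less_imp_le \<gamma>(4) \<delta>(4))
  also have "\<dots> = geodesic_edist A g p q + geodesic_edist A g q r + (ennreal (e/2) + ennreal (e/2))"
    by (simp add: add_ac)
  also have "ennreal (e/2) + ennreal (e/2) = ennreal e"
    using e by (simp flip: ennreal_plus)
  finally show "geodesic_edist A g p r \<le> geodesic_edist A g p q + geodesic_edist A g q r + ennreal e" .
qed

lemma geodesic_edist_refl:
  assumes "differentiable_structure A"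
  shows "geodesic_edist A g p p = 0"
proof -
  let ?\<gamma> = "\<lambda>_::real. p"
  have const: "snd c \<circ> ?\<gamma> = (\<lambda>_. snd c p)" for c :: "('a, 'b) chart" by auto
  have "piecewise_C1_curve A ?\<gamma>"
    unfolding piecewise_C1_curve_def const by (auto intro!: exI[of _ "{}"])
  from geodesic_edist_lower[OF this, of p p g]
  have "geodesic_edist A g p p \<le> curve_length A g ?\<gamma>" by simp
  also have "speed A g ?\<gamma> t = 0" for t
    unfolding speed_def const by simp
  then have "curve_length A g ?\<gamma> = 0"
    by (simp add: curve_length_def)
  finally show ?thesis by simp
qed

text \<open>Infinite distances are mapped to \<^term>\<open>0::real\<close> by \<^const>\<open>enn2real\<close>, which would put the
  point at the centre of the polar chart.\<close>

lemma geodesic_edist_finite: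
  assumes A: "differentiable_structure A" and c: "polar_chart A g p R \<psi> c"
  shows "geodesic_edist A g p q < top"
proof (rule ccontr)
  assume *: "\<not> ?thesis"
  then have "geodesic_edist A g p q = top"
    using top.not_eq_extremum by blast
  then have d: "geodesic_dist A g p q = 0"
    by (simp add: geodesic_dist_def geodesic_edist_def)
  have c': "c \<in> A" "0 < R" "fst c = {q. geodesic_dist A g p q < R}" "p \<in> fst c" "snd c p = 0"
    "\<forall>q\<in>fst c. geodesic_dist A g p q = norm (snd c q)"
    using c unfolding polar_chart_def by blast+
  have q: "q \<in> fst c" unfolding c'(3) using d c'(2) by simp
  then have "norm (snd c q) = 0" using c'(6) d by simp
  then have "snd c q = snd c p" by (simp add: c'(5))
  then have "q = p"
    by (rule inj_onD[OF chart_inj[OF atlas_chart[OF A c'(1)]] _ q c'(4)])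
  then show False using * geodesic_edist_refl[OF A, of g p] by simp
qed

lemma geodesic_dist_triangle:
  assumes M: "riemannian_manifold A g"
    and fin: "geodesic_edist A g p q < top" "geodesic_edist A g q r < top"
  shows "geodesic_dist A g p r \<le> geodesic_dist A g p q + geodesic_dist A g q r"
proof -
  have "enn2real (geodesic_edist A g p r) \<le> enn2real (geodesic_edist A g p q + geodesic_edist A g q r)"
    by (rule enn2real_mono[OF geodesic_edist_triangle[OF M]]) (use fin in simp)
  then show ?thesis
    using fin by (simp add: enn2real_plus geodesic_dist_def geodesic_edist_def)
qed

section \<open>Isometry invariance of minimizing geodesics, the cut locus and polar charts\<close>

lemma minimizing_geodesic_isometry:
  assumes "differentiable_structure A" "riemannian_isometry A g f"
  shows "minimizing_geodesic A g (f \<circ> \<gamma>) b \<longleftrightarrow> minimizing_geodesic A g \<gamma> b"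
  by (simp add: minimizing_geodesic_def geodesic_dist_isometry[OF assms])

text \<open>A longer minimizing extension of the image geodesic would be mapped by
  \<open>inv f\<close> to one of the original geodesic.\<close>

lemma cut_locus_isometry:
  assumes A: "differentiable_structure A" and f: "riemannian_isometry A g f" and q: "q \<in> cut_locus A g p"
  shows "f q \<in> cut_locus A g (f p)"
proof -
  have bij: "bij f" using f by (simp add: riemannian_isometry_def)
  note [simp] = inv_f_f[OF bij_is_inj[OF bij]] surj_f_inv_f[OF bij_is_surj[OF bij]]
  obtain \<gamma> b where \<gamma>: "0 < b" "\<gamma> 0 = p" "\<gamma> b = q" "minimizing_geodesic A g \<gamma> b"
    "\<not> (\<exists>\<gamma>' b'. b < b' \<and> (\<forall>t\<in>{0..b}. \<gamma>' t = \<gamma> t) \<and> minimizing_geodesic A g \<gamma>' b')"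
    using q unfolding cut_locus_def by auto
  have "\<not> (\<exists>\<gamma>' b'. b < b' \<and> (\<forall>t\<in>{0..b}. \<gamma>' t = (f \<circ> \<gamma>) t) \<and> minimizing_geodesic A g \<gamma>' b')"
  proof
    assume "\<exists>\<gamma>' b'. b < b' \<and> (\<forall>t\<in>{0..b}. \<gamma>' t = (f \<circ> \<gamma>) t) \<and> minimizing_geodesic A g \<gamma>' b'"
    then obtain \<gamma>' b' where \<gamma>': "b < b'" "\<forall>t\<in>{0..b}. \<gamma>' t = (f \<circ> \<gamma>) t" "minimizing_geodesic A g \<gamma>' b'"
      by blast
    have "f \<circ> (inv f \<circ> \<gamma>') = \<gamma>'" by (simp add: fun_eq_iff)
    then have "minimizing_geodesic A g (inv f \<circ> \<gamma>') b'"
      using \<gamma>'(3) minimizing_geodesic_isometry[OF A f, of "inv f \<circ> \<gamma>'" b'] by simp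
    moreover have "\<forall>t\<in>{0..b}. (inv f \<circ> \<gamma>') t = \<gamma> t" using \<gamma>'(2) by simp
    ultimately show False using \<gamma>(5) \<gamma>'(1) by blast
  qed
  moreover have "minimizing_geodesic A g (f \<circ> \<gamma>) b"
    using \<gamma>(4) by (simp only: minimizing_geodesic_isometry[OF A f])
  ultimately show ?thesis
    unfolding cut_locus_def using \<gamma>(1-3)
    by (intro CollectI exI[of _ "f \<circ> \<gamma>"] exI[of _ b] conjI) simp_all
qed

lemma polar_chart_pullback:
  assumes M: "riemannian_manifold A g" and f: "riemannian_isometry A g f" and c: "polar_chart A g (f p) R \<psi> c"
  shows "polar_chart A g p R \<psi> (pullback_chart f c)"
proof -
  note A = manifold_atlas[OF M]
  have f': "bij f" "Ck_map 3 A f" "Ck_map 3 A (inv f)"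
    using f by (auto simp: riemannian_isometry_def)
  have cA: "c \<in> A" and c': "0 < R" "C2_profile R \<psi>"
     "fst c = {q. geodesic_dist A g (f p) q < R}" "fst c \<inter> cut_locus A g (f p) = {}"
     "chart_image c = ball 0 R" "f p \<in> fst c" "snd c (f p) = 0"
     "\<forall>q\<in>fst c. geodesic_dist A g (f p) q = norm (snd c q)"
     "\<forall>z\<in>ball 0 R - {0}. \<forall>v. v \<bullet> (g c z *v v) =
        (frechet_derivative norm (at z) v)\<^sup>2 +
        (\<psi> (norm z))\<^sup>2 * (norm (frechet_derivative sgn (at z) v))\<^sup>2"
    using c unfolding polar_chart_def by blast+
  note im = pullback_chart_image[OF bij_is_surj[OF f'(1)], of c]
  have 1: "pullback_chart f c \<in> A"
    by (rule pullback_chart_in_atlas[OF A f' cA])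
  have 2: "fst (pullback_chart f c) = {q. geodesic_dist A g p q < R}"
    by (auto simp: c'(3) geodesic_dist_isometry[OF A f])
  have 3: "fst (pullback_chart f c) \<inter> cut_locus A g p = {}"
    using c'(4) cut_locus_isometry[OF A f] by auto
  have 4: "\<forall>q\<in>fst (pullback_chart f c). geodesic_dist A g p q = norm (snd (pullback_chart f c) q)"
    using c'(8) geodesic_dist_isometry[OF A f, of p] by auto
  have 5: "g (pullback_chart f c) z = g c z" if "z \<in> ball 0 R" for z
    by (rule pullback_chart_metric[OF A f cA]) (use that c'(5) in simp)
  have 6: "\<forall>z\<in>ball 0 R - {0}. \<forall>v. v \<bullet> (g (pullback_chart f c) z *v v) =
        (frechet_derivative norm (at z) v)\<^sup>2 +
        (\<psi> (norm z))\<^sup>2 * (norm (frechet_derivative sgn (at z) v))\<^sup>2"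
    using c'(9) 5 by simp
  have 7: "p \<in> fst (pullback_chart f c)" "snd (pullback_chart f c) p = 0"
    using c'(6,7) by auto
  show ?thesis
    unfolding polar_chart_def im
    by (intro conjI 1 c'(1) c'(2) 2 3 c'(5) 7 4 6)
qed

section \<open>The metric in polar charts\<close>

text \<open>Polarisation. It is needed because a polar chart prescribes the metric only as a
  quadratic form.\<close>

lemma quadratic_form_eqI:
  fixes M N :: "real^'n^'n"
  assumes sym: "transpose M = M" "transpose N = N" and eq: "\<And>v. v \<bullet> (M *v v) = v \<bullet> (N *v v)"
  shows "M = N"
proof -
  have form: "axis i 1 \<bullet> (L *v axis j 1) = L $ i $ j" for L :: "real^'n^'n" and i j
    by (simp add: inner_axis' matrix_vector_mult_basis column_def)
  have pol: "2 * L $ i $ j = (axis i 1 + axis j 1) \<bullet> (L *v (axis i 1 + axis j 1))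
      - axis i 1 \<bullet> (L *v axis i 1) - axis j 1 \<bullet> (L *v axis j 1)"
    if "transpose L = L" for L :: "real^'n^'n" and i j
  proof -
    have "L $ j $ i = L $ i $ j"
      using arg_cong[OF that, of "\<lambda>K. K $ i $ j"] by (simp add: transpose_def)
    then show ?thesis
      by (simp add: matrix_vector_right_distrib inner_add_left inner_add_right form)
  qed
  have "2 * M $ i $ j = 2 * N $ i $ j" for i j
    unfolding pol[OF sym(1)] pol[OF sym(2)] eq ..
  then show ?thesis by (simp add: vec_eq_iff)
qed

text \<open>All matrices on the segment from the identity to M are positive definite, hence have
  trivial kernel. The determinant starts at 1 and cannot reach 0 on the way.\<close>

lemma det_pos_definite:
  fixes M :: "real^'n^'n"
  assumes pos: "\<And>v. v \<noteq> 0 \<Longrightarrow> v \<bullet> (M *v v) > 0"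
  shows "det M > 0"
proof (rule ccontr)
  assume "\<not> ?thesis"
  define L where "L t = (1 - t) *\<^sub>R mat 1 + t *\<^sub>R M" for t :: real
  have "continuous_on {0..1} (\<lambda>t. det (L t))"
    unfolding L_def by (intro continuous_intros)
  moreover have "det (L 1) \<le> 0" "0 \<le> det (L 0)"
    using \<open>\<not> _\<close> by (simp_all add: L_def)
  ultimately obtain t where t: "0 \<le> t" "t \<le> 1" "det (L t) = 0"
    using IVT2'[of "\<lambda>t. det (L t)" 1 0 0] by auto
  then have "\<not> invertible (L t)" by (simp add: invertible_det_nz)
  then obtain v where v: "L t *v v = 0" "v \<noteq> 0"
    using matrix_left_invertible_ker[of "L t"] invertible_left_inverse[of "L t"] by blast
  have "L t *v v = (1 - t) *\<^sub>R v + t *\<^sub>R (M *v v)"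
    by (simp add: L_def matrix_vector_mult_add_rdistrib scaleR_matrix_vector_assoc[symmetric])
  then have "(1 - t) * (v \<bullet> v) + t * (v \<bullet> (M *v v)) = 0"
    using arg_cong[OF v(1), of "\<lambda>w. v \<bullet> w"] by (simp add: inner_add_right)
  moreover have "v \<bullet> v > 0" "v \<bullet> (M *v v) > 0" using pos v by auto
  ultimately show False
    using t by (metis add_nonneg_eq_0_iff diff_ge_0_iff_ge less_numeral_extra(3) mult_eq_0_iff mult_nonneg_nonneg less_imp_le diff_zero zero_neq_one right_minus_eq)
qed

lemma differentiable_sgn:
  fixes z :: "real^'n"
  assumes "z \<noteq> 0"
  shows "sgn differentiable (at z)"
proof -
  have "(\<lambda>x::real^'n. inverse (norm x) *\<^sub>R x) differentiable (at z)"
    using assms by (intro derivative_intros differentiable_norm_at) auto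
  then show ?thesis by (simp add: sgn_div_norm[abs_def])
qed

text \<open>\<open>sgn\<close> is constant along rays from the origin.\<close>

lemma frechet_derivative_sgn_radial:
  fixes z :: "real^'n"
  assumes "z \<noteq> 0"
  shows "frechet_derivative sgn (at z) z = 0"
proof -
  have "((\<lambda>s. z + s *\<^sub>R z) has_derivative (\<lambda>s. s *\<^sub>R z)) (at 0)"
    by (auto intro!: derivative_eq_intros)
  moreover have "(sgn has_derivative frechet_derivative sgn (at z)) (at (z + 0 *\<^sub>R z))"
    using iffD1[OF frechet_derivative_works differentiable_sgn[OF assms]] by simp
  ultimately have "(sgn \<circ> (\<lambda>s. z + s *\<^sub>R z) has_derivative frechet_derivative sgn (at z) \<circ> (\<lambda>s. s *\<^sub>R z)) (at 0)"
    by (rule diff_chain_at)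
  moreover have "(sgn \<circ> (\<lambda>s. z + s *\<^sub>R z) has_derivative (\<lambda>_. 0)) (at 0)"
  proof (rule has_derivative_transform_within_open)
    show "((\<lambda>_. sgn z) has_derivative (\<lambda>_. 0)) (at 0)" by simp
    show "open {-1<..<1::real}" "0 \<in> {-1<..<1::real}" by auto
    fix s :: real assume "s \<in> {-1<..<1}"
    then have "sgn ((1 + s) *\<^sub>R z) = sgn z" by (simp add: sgn_scaleR)
    then show "sgn z = (sgn \<circ> (\<lambda>s. z + s *\<^sub>R z)) s" by (simp add: scaleR_add_left)
  qed
  ultimately have "frechet_derivative sgn (at z) \<circ> (\<lambda>s. s *\<^sub>R z) = (\<lambda>_. 0)"
    by (rule has_derivative_unique)
  from fun_cong[OF this, of 1] show ?thesis by simp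
qed

lemma frechet_derivative_norm:
  fixes z :: "real^'n"
  assumes "z \<noteq> 0"
  shows "frechet_derivative norm (at z) v = v \<bullet> sgn z"
  using frechet_derivative_at[OF has_derivative_norm[OF assms]] by (metis inner_commute)

lemma frechet_derivative_sgn_minus:
  fixes z :: "real^'n"
  assumes "z \<noteq> 0"
  shows "frechet_derivative sgn (at (- z)) = frechet_derivative sgn (at z)"
proof -
  let ?D = "frechet_derivative sgn (at z)"
  have D: "(sgn has_derivative ?D) (at (- (- z)))"
    using iffD1[OF frechet_derivative_works differentiable_sgn[OF assms]] by simp
  have "(sgn \<circ> uminus has_derivative ?D \<circ> uminus) (at (- z))"
    by (rule diff_chain_at[where f = uminus, OF _ D]) (auto intro!: derivative_eq_intros)
  then have "((\<lambda>x. - (sgn \<circ> uminus) x) has_derivative (\<lambda>h. - (?D \<circ> uminus) h)) (at (- z))"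
    by (rule has_derivative_minus)
  moreover have "(\<lambda>x. - (sgn \<circ> uminus) x) = (sgn :: real^'n \<Rightarrow> _)"
    by (simp add: fun_eq_iff sgn_minus)
  moreover have "(\<lambda>h. - (?D \<circ> uminus) h) = ?D"
    using linear_neg[OF has_derivative_linear[OF D]] by (simp add: fun_eq_iff)
  ultimately have "(sgn has_derivative ?D) (at (- z))" by simp
  then show ?thesis using frechet_derivative_at by metis
qed

text \<open>For evenness: the derivative of the norm changes sign under z -> -z but enters squared,
  the derivative of \<open>sgn\<close> is unchanged because \<open>sgn\<close> is odd, and the
  profile sees only the norm.\<close>

lemma
  fixes c :: "('m::{t2_space, second_countable_topology}, 'n::finite) chart"
  assumes M: "riemannian_manifold A g" and c: "polar_chart A g p R \<psi> c"
  shows polar_metric_even: "z \<in> ball 0 R \<Longrightarrow> g c (- z) = g c z"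
    and polar_metric_0: "g c 0 = mat 1"
proof -
  have cA: "c \<in> A" and R: "0 < R" and im: "chart_image c = ball 0 R"
    and form: "\<And>z v. z \<in> ball 0 R - {0} \<Longrightarrow> v \<bullet> (g c z *v v) =
        (frechet_derivative norm (at z) v)\<^sup>2 +
        (\<psi> (norm z))\<^sup>2 * (norm (frechet_derivative sgn (at z) v))\<^sup>2"
    using c unfolding polar_chart_def by blast+
  have sym: "transpose (g c z) = g c z" if "z \<in> ball 0 R" for z
    by (rule metric_symmetric[OF M cA]) (use that im in simp)
  show "g c (- z) = g c z" if z: "z \<in> ball 0 R"
  proof (cases "z = 0")
    case False
    show ?thesis
    proof (rule quadratic_form_eqI)
      show "transpose (g c (- z)) = g c (- z)" "transpose (g c z) = g c z"
        using sym z by auto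
      show "v \<bullet> (g c (- z) *v v) = v \<bullet> (g c z *v v)" for v
        using form[of z v] form[of "- z" v] z False
        by (simp add: frechet_derivative_norm frechet_derivative_sgn_minus sgn_minus)
    qed
  qed simp
  show "g c 0 = mat 1"
  proof (rule quadratic_form_eqI)
    show "transpose (g c 0) = g c 0" using sym R by simp
    show "transpose (mat 1 :: real^'n^'n) = mat 1" by (rule transpose_mat)
    \<comment> \<open>The polar form says nothing at the centre itself. At points t v of the ray
      through v the angular term vanishes on v and the radial term is the squared norm of v;
      continuity of the metric carries this value to t = 0.\<close>
    show "v \<bullet> (g c 0 *v v) = v \<bullet> (mat 1 *v v)" for v
    proof (cases "v = 0")
      case False
      have "continuous_on (ball 0 R) (g c)"
        using Ck_on_continuous_on[OF metric_Ck_on[OF M cA]] im by simp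
      then have "continuous (at (0 *\<^sub>R v)) (g c)"
        using R by (simp add: continuous_on_eq_continuous_at)
      moreover have "continuous (at (0::real)) (\<lambda>t. t *\<^sub>R v)" by simp
      ultimately have "isCont (\<lambda>t. g c (t *\<^sub>R v)) (0::real)"
        by (rule isCont_o2[rotated])
      then have "isCont (\<lambda>t. v \<bullet> (g c (t *\<^sub>R v) *v v)) (0::real)"
        unfolding matrix_vector_mult_def inner_vec_def by (auto intro!: continuous_intros)
      then have "((\<lambda>t. v \<bullet> (g c (t *\<^sub>R v) *v v)) \<longlongrightarrow> v \<bullet> (g c 0 *v v)) (at_right 0)"
        by (simp add: isCont_def filterlim_at_split)
      moreover have "\<forall>\<^sub>F t in at_right 0. v \<bullet> (g c (t *\<^sub>R v) *v v) = v \<bullet> v"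
      proof -
        have "\<forall>\<^sub>F t in at_right (0::real). t < R / norm v"
          by (rule order_tendstoD[OF tendsto_ident_at]) (use R False in auto)
        moreover have "\<forall>\<^sub>F t in at_right (0::real). 0 < t" by (simp add: eventually_at_right_less)
        ultimately show ?thesis
        proof eventually_elim
          case (elim t)
          then have tv: "t *\<^sub>R v \<in> ball 0 R - {0}" "t *\<^sub>R v \<noteq> 0" using False by (auto simp: field_simps)
          have "frechet_derivative sgn (at (t *\<^sub>R v)) (t *\<^sub>R v) = 0"
            by (rule frechet_derivative_sgn_radial[OF tv(2)])
          moreover have "linear (frechet_derivative sgn (at (t *\<^sub>R v)))"
            using differentiable_sgn[OF tv(2)] frechet_derivative_works has_derivative_linear by blast
          ultimately have "frechet_derivative sgn (at (t *\<^sub>R v)) v = 0"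
            using elim by (simp add: linear_cmul)
          moreover have "frechet_derivative norm (at (t *\<^sub>R v)) v = norm v"
            using elim False by (simp only: frechet_derivative_norm[OF tv(2)])
              (simp add: sgn_scaleR sgn_div_norm dot_square_norm power2_eq_square field_simps)
          ultimately show ?case
            using form[OF tv(1), of v] by (simp add: power2_norm_eq_inner)
        qed
      qed
      then have "((\<lambda>t. v \<bullet> (g c (t *\<^sub>R v) *v v)) \<longlongrightarrow> v \<bullet> v) (at_right 0)"
        by (rule tendsto_eventually)
      ultimately have "v \<bullet> (g c 0 *v v) = v \<bullet> v"
        by (rule tendsto_unique[rotated]) simp
      then show ?thesis by simp
    qed simp
  qed
qed

section \<open>Integration in charts\<close>

text \<open>The volume measure is specified by the measures of Borel sets inside a chart; pushed
  forward to coordinates this becomes equality with a density. The indicator extends the density by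
  zero, as the matrix \<open>g c\<close> is arbitrary outside the chart image.\<close>

lemma chart_measure:
  fixes c :: "('m::{t2_space, second_countable_topology}, 'n::finite) chart"
  assumes M: "riemannian_manifold A g" and mu: "riemannian_measure A g \<mu>" and c: "c \<in> A"
  shows "distr (restrict_space \<mu> (fst c)) borel (snd c)
    = density lborel (\<lambda>z. ennreal (indicator (chart_image c) z * sqrt (det (g c z))))"
    and "snd c \<in> borel_measurable (restrict_space \<mu> (fst c))"
    and "(\<lambda>z. indicator (chart_image c) z * sqrt (det (g c z))) \<in> borel_measurable borel"
proof -
  note chart = atlas_chart[OF manifold_atlas[OF M] c]
  have sets: "sets \<mu> = sets borel"
    using mu by (simp add: riemannian_measure_def)
  then have U: "fst c \<in> sets \<mu>" using chart_open[OF chart] by simp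
  have "snd c \<in> borel_measurable (restrict_space borel (fst c))"
    by (rule borel_measurable_continuous_on_restrict[OF chart_continuous[OF chart]])
  moreover have "sets (restrict_space \<mu> (fst c)) = sets (restrict_space borel (fst c))"
    using sets by (rule sets_restrict_space_cong)
  ultimately show meas: "snd c \<in> borel_measurable (restrict_space \<mu> (fst c))"
    by (simp cong: measurable_cong_sets)
  have "continuous_on (chart_image c) (\<lambda>z. sqrt (det (g c z)))"
    by (intro continuous_intros Ck_on_continuous_on[OF metric_Ck_on[OF M c]])
  from borel_measurable_continuous_on_indicator[OF borel_open[OF chart_image_open[OF chart]] this]
  show w: "(\<lambda>z. indicator (chart_image c) z * sqrt (det (g c z))) \<in> borel_measurable borel" by simp
  show "distr (restrict_space \<mu> (fst c)) borel (snd c)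
    = density lborel (\<lambda>z. ennreal (indicator (chart_image c) z * sqrt (det (g c z))))"
  proof (rule measure_eqI)
    fix B assume "B \<in> sets (distr (restrict_space \<mu> (fst c)) borel (snd c))"
    then have B: "B \<in> sets borel" by simp
    have sp: "space (restrict_space \<mu> (fst c)) = fst c"
      using sets_eq_imp_space_eq[OF sets] by (simp add: space_restrict_space)
    have meas_B: "snd c -` B \<inter> fst c \<in> sets borel"
      using measurable_sets[OF meas B] U sets by (simp add: sp sets_restrict_space_iff)
    have "emeasure (distr (restrict_space \<mu> (fst c)) borel (snd c)) B = emeasure \<mu> (snd c -` B \<inter> fst c)"
      using B U by (simp add: emeasure_distr[OF meas] sp emeasure_restrict_space)
    also have "\<dots> = (\<integral>\<^sup>+x\<in>snd c ` (snd c -` B \<inter> fst c). ennreal (sqrt (det (g c x))) \<partial>lborel)"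
      using mu c meas_B unfolding riemannian_measure_def by blast
    also have "snd c ` (snd c -` B \<inter> fst c) = B \<inter> chart_image c" by auto
    also have "(\<integral>\<^sup>+x\<in>B \<inter> chart_image c. ennreal (sqrt (det (g c x))) \<partial>lborel)
      = (\<integral>\<^sup>+z. ennreal (indicator (chart_image c) z * sqrt (det (g c z))) * indicator B z \<partial>lborel)"
      by (intro nn_integral_cong) (simp add: indicator_def)
    also have "\<dots> = emeasure (density lborel (\<lambda>z. ennreal (indicator (chart_image c) z * sqrt (det (g c z))))) B"
      using B w by (simp add: emeasure_density)
    finally show "emeasure (distr (restrict_space \<mu> (fst c)) borel (snd c)) B = \<dots>" .
  qed simp
qed

text \<open>F has to match f inside the chart only, since the weight vanishes elsewhere; this leaves
  room for choosing a Borel extension of the coordinate expression.\<close>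

lemma
  fixes c :: "('m::{t2_space, second_countable_topology}, 'n::finite) chart" and f :: "'m \<Rightarrow> real"
  assumes M: "riemannian_manifold A g" and mu: "riemannian_measure A g \<mu>" and c: "c \<in> A"
    and f: "\<And>y. y \<notin> fst c \<Longrightarrow> f y = 0" and F: "F \<in> borel_measurable borel"
    and eq: "\<And>y. y \<in> fst c \<Longrightarrow> F (snd c y) = f y"
  shows integrable_chart: "integrable \<mu> f \<longleftrightarrow>
      integrable lborel (\<lambda>z. indicator (chart_image c) z * sqrt (det (g c z)) * F z)"
    and integral_chart: "integral\<^sup>L \<mu> f =
      integral\<^sup>L lborel (\<lambda>z. indicator (chart_image c) z * sqrt (det (g c z)) * F z)"
proof -
  note chart = atlas_chart[OF manifold_atlas[OF M] c]
  note cm = chart_measure[OF M mu c]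
  let ?w = "\<lambda>z. indicator (chart_image c) z * sqrt (det (g c z))"
  have sets: "sets \<mu> = sets borel"
    using mu by (simp add: riemannian_measure_def)
  then have U: "fst c \<inter> space \<mu> \<in> sets \<mu>"
    using chart_open[OF chart] sets_eq_imp_space_eq[OF sets] by simp
  have sp: "space (restrict_space \<mu> (fst c)) = fst c"
    using sets_eq_imp_space_eq[OF sets] by (simp add: space_restrict_space)
  have f': "indicator (fst c) x *\<^sub>R f x = f x" for x
    using f by (auto simp: indicator_def)
  have nonneg: "AE z in lborel. 0 \<le> ?w z"
  proof (rule AE_I2)
    fix z
    have "det (g c z) > 0" if "z \<in> chart_image c"
      by (rule det_pos_definite[OF metric_pos[OF M c that]])
    then show "0 \<le> ?w z" by (simp add: indicator_def less_imp_le)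
  qed
  have F': "F \<in> borel_measurable lborel" and w': "?w \<in> borel_measurable lborel"
    using F cm(3) by simp_all
  have "integrable \<mu> f \<longleftrightarrow> integrable (restrict_space \<mu> (fst c)) f"
    using integrable_restrict_space[OF U, of f] unfolding f' by simp
  also have "\<dots> \<longleftrightarrow> integrable (restrict_space \<mu> (fst c)) (\<lambda>x. F (snd c x))"
    by (rule Bochner_Integration.integrable_cong) (simp_all add: sp eq)
  also have "\<dots> \<longleftrightarrow> integrable (distr (restrict_space \<mu> (fst c)) borel (snd c)) F"
    by (rule integrable_distr_eq[OF cm(2) F, symmetric])
  also have "\<dots> \<longleftrightarrow> integrable lborel (\<lambda>z. ?w z *\<^sub>R F z)"
    unfolding cm(1) by (rule integrable_density[OF F' w' nonneg])
  finally show "integrable \<mu> f \<longleftrightarrow> integrable lborel (\<lambda>z. ?w z * F z)" by simp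
  have "integral\<^sup>L \<mu> f = integral\<^sup>L (restrict_space \<mu> (fst c)) f"
    using integral_restrict_space[OF U, of f] unfolding f' by simp
  also have "\<dots> = integral\<^sup>L (restrict_space \<mu> (fst c)) (\<lambda>x. F (snd c x))"
    by (rule Bochner_Integration.integral_cong) (simp_all add: sp eq)
  also have "\<dots> = integral\<^sup>L (distr (restrict_space \<mu> (fst c)) borel (snd c)) F"
    by (rule integral_distr[OF cm(2) F, symmetric])
  also have "\<dots> = integral\<^sup>L lborel (\<lambda>z. ?w z *\<^sub>R F z)"
    unfolding cm(1) by (rule integral_density[OF F' w' nonneg])
  finally show "integral\<^sup>L \<mu> f = integral\<^sup>L lborel (\<lambda>z. ?w z * F z)" by simp
qed

section \<open>Symmetries of Lebesgue measure\<close>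

text \<open>No measurability is assumed: scaling is invertible, so if f is not measurable neither is
  its rescaling, and both integrals are 0 by convention.\<close>

lemma integral_lborel_scaleR:
  fixes f :: "real^'n \<Rightarrow> real"
  assumes "a \<noteq> 0"
  shows "integral\<^sup>L lborel f = \<bar>a\<bar> ^ CARD('n) * integral\<^sup>L lborel (\<lambda>w. f (a *\<^sub>R w))"
proof -
  have eq: "lborel = density (distr lborel borel (\<lambda>w::real^'n. a *\<^sub>R w)) (\<lambda>_. \<bar>a\<bar> ^ CARD('n))"
    using lborel_affine[OF assms, of "0::real^'n"] by simp
  show ?thesis
  proof (cases "f \<in> borel_measurable borel")
    case True
    have "integral\<^sup>L lborel f = integral\<^sup>L (density (distr lborel borel (\<lambda>w::real^'n. a *\<^sub>R w)) (\<lambda>_. \<bar>a\<bar> ^ CARD('n))) f"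
      using eq by metis
    also have "\<dots> = integral\<^sup>L (distr lborel borel (\<lambda>w::real^'n. a *\<^sub>R w)) (\<lambda>z. \<bar>a\<bar> ^ CARD('n) *\<^sub>R f z)"
      by (rule integral_density) (use True in auto)
    also have "\<dots> = integral\<^sup>L lborel (\<lambda>w. \<bar>a\<bar> ^ CARD('n) *\<^sub>R f (a *\<^sub>R w))"
      by (rule integral_distr) (use True in auto)
    finally show ?thesis by simp
  next
    case False
    have "(\<lambda>w. f (a *\<^sub>R w)) \<notin> borel_measurable borel"
    proof
      assume "(\<lambda>w. f (a *\<^sub>R w)) \<in> borel_measurable borel"
      then have "(\<lambda>z. f (a *\<^sub>R (inverse a *\<^sub>R z))) \<in> borel_measurable borel"
        by (rule measurable_compose[rotated]) simp
      with False assms show False by simp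
    qed
    with False have "\<not> integrable lborel f" "\<not> integrable lborel (\<lambda>w. f (a *\<^sub>R w))" by auto
    then show ?thesis by (simp add: not_integrable_integral_eq)
  qed
qed

text \<open>The substitution w -> -w shows that the integral equals its own negative.\<close>

lemma integral_lborel_odd:
  fixes f :: "real^'n \<Rightarrow> real"
  assumes "\<And>w. f (- w) = - f w"
  shows "integral\<^sup>L lborel f = 0"
  using integral_lborel_scaleR[of "-1" f] assms by simp

lemma prod_Basis_cart:
  fixes x :: "real^'n"
  shows "(\<Prod>b\<in>Basis. x \<bullet> b) = (\<Prod>j\<in>UNIV. x $ j)"
proof -
  have "(Basis :: (real^'n) set) = range (\<lambda>j. axis j 1)"
    by (auto simp: Basis_vec_def)
  then have "(\<Prod>b\<in>Basis. x \<bullet> b) = (\<Prod>b\<in>range (\<lambda>j. axis j 1). x \<bullet> b)"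
    by (rule arg_cong)
  also have "\<dots> = (\<Prod>j\<in>UNIV. x \<bullet> axis j 1)"
    by (subst prod.reindex) (auto simp: inj_on_def axis_eq_axis)
  also have "\<dots> = (\<Prod>j\<in>UNIV. x $ j)"
    by (simp only: inner_axis inner_real_def mult_1_right)
  finally show ?thesis .
qed

text \<open>Reflections and exchanges of coordinates are the only rotational symmetries needed for
  second moments. The preimage of a box under such a map is again a box with the same side lengths
  in another order, and boxes determine Lebesgue measure.\<close>

lemma lborel_distr_signed_permutation:
  fixes \<sigma> :: "'n::finite \<Rightarrow> 'n" and s :: "'n \<Rightarrow> real"
  assumes \<sigma>: "bij \<sigma>" and s: "\<And>k. s k = 1 \<or> s k = -1"
  shows "distr lborel borel (\<lambda>w. \<chi> k. s k * w $ \<sigma> k) = (lborel :: (real^'n) measure)"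
proof (rule lborel_eqI[symmetric])
  let ?T = "\<lambda>w::real^'n. \<chi> k. s k * w $ \<sigma> k"
  have T: "?T \<in> borel_measurable borel"
    by (intro borel_measurable_continuous_onI continuous_intros)
  show "sets (distr lborel borel ?T) = sets borel" by simp
  fix l u :: "real^'n"
  assume le: "\<And>b. b \<in> Basis \<Longrightarrow> l \<bullet> b \<le> u \<bullet> b"
  then have lu: "l $ k \<le> u $ k" for k
    using le[of "axis k 1"] by (simp add: inner_axis axis_in_Basis_iff)
  let ?r = "inv \<sigma>"
  have [simp]: "\<sigma> (?r k) = k" "?r (\<sigma> k) = k" for k
    using \<sigma> by (simp_all add: bij_is_surj surj_f_inv_f bij_is_inj)
  \<comment> \<open>A negative sign reverses the interval of that coordinate, so the negated upper
    bound becomes the lower one.\<close>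
  define l' where "l' = (\<chi> j. if s (?r j) = 1 then l $ ?r j else - (u $ ?r j))"
  define u' where "u' = (\<chi> j. if s (?r j) = 1 then u $ ?r j else - (l $ ?r j))"
  have "?T -` box l u = box l' u'"
  proof (intro set_eqI)
    fix w
    have "w \<in> ?T -` box l u \<longleftrightarrow> (\<forall>k. l $ k < s k * w $ \<sigma> k \<and> s k * w $ \<sigma> k < u $ k)"
      by (simp add: mem_box_cart)
    also have "\<dots> \<longleftrightarrow> (\<forall>k. l' $ \<sigma> k < w $ \<sigma> k \<and> w $ \<sigma> k < u' $ \<sigma> k)"
    proof -
      have "(l $ k < s k * w $ \<sigma> k \<and> s k * w $ \<sigma> k < u $ k) \<longleftrightarrow> (l' $ \<sigma> k < w $ \<sigma> k \<and> w $ \<sigma> k < u' $ \<sigma> k)" for k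
        using s[of k] by (auto simp: l'_def u'_def)
      then show ?thesis by simp
    qed
    also have "\<dots> \<longleftrightarrow> (\<forall>j. l' $ j < w $ j \<and> w $ j < u' $ j)" (is "(\<forall>k. ?P (\<sigma> k)) \<longleftrightarrow> _")
    proof
      assume *: "\<forall>k. ?P (\<sigma> k)"
      show "\<forall>j. ?P j"
      proof
        fix j show "?P j" using spec[OF *, of "?r j"] by simp
      qed
    qed simp
    finally show "w \<in> ?T -` box l u \<longleftrightarrow> w \<in> box l' u'"
      by (simp add: mem_box_cart)
  qed
  then have "emeasure (distr lborel borel ?T) (box l u) = emeasure lborel (box l' u')"
    using T by (simp add: emeasure_distr)
  also have "\<dots> = ennreal (\<Prod>b\<in>Basis. (u' - l') \<bullet> b)"
  proof (rule emeasure_lborel_box)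
    have *: "l' $ j \<le> u' $ j" for j using lu by (simp add: l'_def u'_def)
    show "l' \<bullet> b \<le> u' \<bullet> b" if "b \<in> Basis" for b
      using that * by (auto simp: Basis_vec_def inner_axis)
  qed
  also have "(\<Prod>b\<in>Basis. (u' - l') \<bullet> b) = (\<Prod>j\<in>UNIV. u' $ j - l' $ j)"
    by (simp add: prod_Basis_cart)
  also have "\<dots> = (\<Prod>k\<in>UNIV. u' $ \<sigma> k - l' $ \<sigma> k)"
    by (rule prod.reindex_bij_betw[OF \<sigma>, symmetric])
  also have "\<dots> = (\<Prod>k\<in>UNIV. u $ k - l $ k)"
    by (rule prod.cong) (auto simp: l'_def u'_def)
  also have "\<dots> = (\<Prod>b\<in>Basis. (u - l) \<bullet> b)"
    by (simp add: prod_Basis_cart)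
  finally show "emeasure (distr lborel borel ?T) (box l u) = (\<Prod>b\<in>Basis. (u - l) \<bullet> b)" .
qed

lemma integral_lborel_signed_permutation:
  fixes \<sigma> :: "'n::finite \<Rightarrow> 'n" and s :: "'n \<Rightarrow> real" and f :: "real^'n \<Rightarrow> real"
  assumes "bij \<sigma>" "\<And>k. s k = 1 \<or> s k = -1" and f: "f \<in> borel_measurable borel"
  shows "integral\<^sup>L lborel (\<lambda>w. f (\<chi> k. s k * w $ \<sigma> k)) = integral\<^sup>L lborel f"
proof -
  have T: "(\<lambda>w::real^'n. \<chi> k. s k * w $ \<sigma> k) \<in> borel_measurable lborel"
    by (simp, intro borel_measurable_continuous_onI continuous_intros)
  show ?thesis
    using integral_distr[OF T f] lborel_distr_signed_permutation[OF assms(1,2)] by simp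
qed

text \<open>Reflecting coordinate i changes the sign of the integrand when i and j differ.
  Exchanging two coordinates shows that all diagonal moments agree, and they add up to the full
  second moment, so each is its N-th part.\<close>

lemma integral_radial_quadratic:
  fixes J :: "real \<Rightarrow> real"
  assumes J: "integrable lborel (\<lambda>w::real^'n. J (norm w) * (norm w)\<^sup>2)"
    and meas: "(\<lambda>w::real^'n. J (norm w)) \<in> borel_measurable borel"
  shows "integrable lborel (\<lambda>w::real^'n. J (norm w) * (w $ i * w $ j))"
    and "integral\<^sup>L lborel (\<lambda>w::real^'n. J (norm w) * (w $ i * w $ j))
      = (if i = j then integral\<^sup>L lborel (\<lambda>w::real^'n. J (norm w) * (norm w)\<^sup>2) / CARD('n) else 0)"
proof -
  let ?f = "\<lambda>i j (w::real^'n). J (norm w) * (w $ i * w $ j)"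
  have nth: "(\<lambda>w::real^'n. w $ i) \<in> borel_measurable borel" for i
    by (intro borel_measurable_continuous_onI continuous_intros)
  have f: "?f i j \<in> borel_measurable borel" for i j
    by (intro borel_measurable_times meas nth)
  have int: "integrable lborel (?f i j)" for i j
  proof (rule Bochner_Integration.integrable_bound[OF J])
    show "AE w in lborel. norm (?f i j w) \<le> norm (J (norm w) * (norm w)\<^sup>2)"
    proof (rule AE_I2)
      fix w :: "real^'n"
      have "\<bar>w $ i\<bar> * \<bar>w $ j\<bar> \<le> norm w * norm w"
        by (intro mult_mono component_le_norm_cart) auto
      then show "norm (?f i j w) \<le> norm (J (norm w) * (norm w)\<^sup>2)"
        by (simp add: abs_mult power2_eq_square mult_left_mono)
    qed
  qed (use f in simp)
  then show "integrable lborel (?f i j)" .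
  show "integral\<^sup>L lborel (?f i j)
      = (if i = j then integral\<^sup>L lborel (\<lambda>w::real^'n. J (norm w) * (norm w)\<^sup>2) / CARD('n) else 0)"
  proof (cases "i = j")
    case False
    define s where "s k = (if k = i then -1 else 1::real)" for k
    have nrm: "norm (\<chi> k. s k * w $ k) = norm w" for w :: "real^'n"
      unfolding norm_vec_def L2_set_def by (rule arg_cong[of _ _ sqrt], rule sum.cong) (auto simp: s_def)
    have "integral\<^sup>L lborel (?f i j) = integral\<^sup>L lborel (\<lambda>w. ?f i j (\<chi> k. s k * w $ id k))"
      by (rule integral_lborel_signed_permutation[OF bij_id _ f, symmetric]) (simp add: s_def)
    also have "\<dots> = integral\<^sup>L lborel (\<lambda>w. - ?f i j w)"
      using False nrm by (intro Bochner_Integration.integral_cong) (auto simp: s_def)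
    finally show ?thesis using False by simp
  next
    case True
    have swap: "integral\<^sup>L lborel (?f k k) = integral\<^sup>L lborel (?f i i)" for k
    proof -
      let ?\<sigma> = "Transposition.transpose i k"
      have nrm: "norm (\<chi> l. 1 * w $ ?\<sigma> l) = norm w" for w :: "real^'n"
      proof -
        have "(\<Sum>l\<in>UNIV. (w $ ?\<sigma> l)\<^sup>2) = (\<Sum>l\<in>UNIV. (w $ l)\<^sup>2)"
          by (rule sum.reindex_bij_betw[OF bij_transpose])
        then show ?thesis by (simp add: norm_vec_def L2_set_def)
      qed
      have "integral\<^sup>L lborel (?f i i) = integral\<^sup>L lborel (\<lambda>w. ?f i i (\<chi> l. 1 * w $ ?\<sigma> l))"
        by (rule integral_lborel_signed_permutation[OF bij_transpose _ f, symmetric]) simp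
      also have "\<dots> = integral\<^sup>L lborel (?f k k)"
        using nrm by (intro Bochner_Integration.integral_cong) auto
      finally show ?thesis by simp
    qed
    have "integral\<^sup>L lborel (\<lambda>w::real^'n. J (norm w) * (norm w)\<^sup>2) = integral\<^sup>L lborel (\<lambda>w. \<Sum>k\<in>UNIV. ?f k k w)"
      by (intro Bochner_Integration.integral_cong refl)
        (simp add: sum_distrib_left[symmetric] norm_vec_def L2_set_def power2_eq_square sum_nonneg)
    also have "\<dots> = (\<Sum>k\<in>UNIV. integral\<^sup>L lborel (?f k k))"
      by (rule Bochner_Integration.integral_sum) (rule int)
    also have "\<dots> = (\<Sum>k\<in>(UNIV::'n set). integral\<^sup>L lborel (?f i i))"
      by (rule sum.cong[OF refl swap])
    also have "\<dots> = CARD('n) * integral\<^sup>L lborel (?f i i)"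
      by simp
    finally show ?thesis using True by simp
  qed
qed

section \<open>The nonlocal operator in a polar chart\<close>

lemma taylor2:
  fixes v :: "real^'n \<Rightarrow> real"
  assumes v: "Ck_on 2 (ball 0 R) v" and z: "z \<in> ball 0 R"
  shows "\<exists>t. 0 < t \<and> t < 1 \<and> v z = v 0 + (\<Sum>i\<in>UNIV. partial i v 0 * z $ i)
    + 1/2 * (\<Sum>i\<in>UNIV. \<Sum>j\<in>UNIV. partial i (partial j v) (t *\<^sub>R z) * (z $ i * z $ j))"
proof -
  have d: "v differentiable (at y)" "partial j v differentiable (at y)" if "y \<in> ball 0 R" for y j
    using v that by (simp_all add: numeral_2_eq_2)
  have tz: "0 + t *\<^sub>R z \<in> ball 0 R" if "0 \<le> t" "t \<le> 1" for t
  proof -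
    have "t * norm z \<le> norm z" using that by (simp add: mult_left_le_one_le)
    with z that show ?thesis by simp
  qed
  define D1 where "D1 t = (\<Sum>j\<in>UNIV. z $ j * partial j v (0 + t *\<^sub>R z))" for t
  define D2 where "D2 t = (\<Sum>j\<in>UNIV. z $ j * (\<Sum>i\<in>UNIV. z $ i * partial i (partial j v) (0 + t *\<^sub>R z)))" for t
  define diff where "diff m = (if m = 0 then \<lambda>t. v (0 + t *\<^sub>R z) else if m = 1 then D1 else D2)" for m :: nat
  have "DERIV (diff m) t :> diff (Suc m) t" if "m < 2 \<and> 0 \<le> t \<and> t \<le> 1" for m t
  proof (cases "m = 0")
    case True
    then show ?thesis
      using has_real_derivative_line[OF d(1)[OF tz], of t] that by (simp add: diff_def D1_def)
  next
    case False
    then have "m = 1" using that by simp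
    moreover have "(D1 has_real_derivative D2 t) (at t)"
      unfolding D1_def[abs_def] D2_def
      by (intro DERIV_sum DERIV_cmult has_real_derivative_line d tz) (use that in auto)
    ultimately show ?thesis by (simp add: diff_def)
  qed
  then obtain t where t: "0 < t" "t < 1" "diff 0 1 = (\<Sum>m<2. diff m 0 / fact m * 1 ^ m) + diff 2 t / fact 2 * 1 ^ 2"
    using Maclaurin[of 1 2 diff "diff 0"] by auto
  have "D2 t = (\<Sum>i\<in>UNIV. \<Sum>j\<in>UNIV. partial i (partial j v) (t *\<^sub>R z) * (z $ i * z $ j))"
    unfolding D2_def sum_distrib_left by (subst sum.swap) (simp add: mult_ac)
  moreover have "D1 0 = (\<Sum>i\<in>UNIV. partial i v 0 * z $ i)"
    by (simp add: D1_def mult.commute)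
  ultimately show ?thesis
    using t by (intro exI[of _ t]) (simp add: diff_def numeral_2_eq_2)
qed

lemma taylor2_bound:
  fixes v :: "real^'n \<Rightarrow> real"
  assumes v: "Ck_on 2 (ball 0 R) v" and z: "z \<in> ball 0 R"
    and \<omega>: "\<And>i j y. norm y \<le> norm z \<Longrightarrow> \<bar>partial i (partial j v) y - partial i (partial j v) 0\<bar> \<le> \<omega>"
  shows "\<bar>v z - v 0 - (\<Sum>i\<in>UNIV. partial i v 0 * z $ i)
    - 1/2 * (\<Sum>i\<in>UNIV. \<Sum>j\<in>UNIV. partial i (partial j v) 0 * (z $ i * z $ j))\<bar>
    \<le> 1/2 * (real CARD('n))\<^sup>2 * \<omega> * (norm z)\<^sup>2"
proof -
  obtain t where t: "0 < t" "t < 1" and eq: "v z = v 0 + (\<Sum>i\<in>UNIV. partial i v 0 * z $ i)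
    + 1/2 * (\<Sum>i\<in>UNIV. \<Sum>j\<in>UNIV. partial i (partial j v) (t *\<^sub>R z) * (z $ i * z $ j))"
    using taylor2[OF v z] by blast
  let ?d = "\<lambda>i j. partial i (partial j v) (t *\<^sub>R z) - partial i (partial j v) 0"
  have "v z - v 0 - (\<Sum>i\<in>UNIV. partial i v 0 * z $ i)
    - 1/2 * (\<Sum>i\<in>UNIV. \<Sum>j\<in>UNIV. partial i (partial j v) 0 * (z $ i * z $ j))
    = 1/2 * (\<Sum>i\<in>UNIV. \<Sum>j\<in>UNIV. ?d i j * (z $ i * z $ j))"
    unfolding eq by (simp add: left_diff_distrib sum_subtractf)
  also have "\<bar>\<dots>\<bar> \<le> 1/2 * (\<Sum>i\<in>(UNIV::'n set). \<Sum>j\<in>(UNIV::'n set). \<omega> * (norm z)\<^sup>2)"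
  proof -
    have "\<bar>?d i j * (z $ i * z $ j)\<bar> \<le> \<omega> * (norm z)\<^sup>2" for i j
    proof -
      have "\<bar>?d i j\<bar> \<le> \<omega>"
        by (rule \<omega>) (use t in \<open>simp add: mult_left_le_one_le\<close>)
      moreover have "\<bar>z $ i\<bar> * \<bar>z $ j\<bar> \<le> norm z * norm z"
        by (intro mult_mono component_le_norm_cart) auto
      ultimately show ?thesis
        unfolding abs_mult power2_eq_square by (intro mult_mono component_le_norm_cart) auto
    qed
    then have "\<bar>\<Sum>i\<in>UNIV. \<Sum>j\<in>UNIV. ?d i j * (z $ i * z $ j)\<bar> \<le> (\<Sum>i\<in>(UNIV::'n set). \<Sum>j\<in>(UNIV::'n set). \<omega> * (norm z)\<^sup>2)"
      by (intro order_trans[OF sum_abs] sum_mono)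
    then show ?thesis by (simp add: abs_mult)
  qed
  also have "\<dots> = 1/2 * (real CARD('n))\<^sup>2 * \<omega> * (norm z)\<^sup>2"
    by (simp add: power2_eq_square)
  finally show ?thesis .
qed

text \<open>The first-order term of the Taylor expansion integrates to zero because the weight is even, and
  the second-order term is diagonalised by the symmetries of the kernel.\<close>

lemma nonlocal_average_estimate:
  fixes v W :: "real^'n \<Rightarrow> real" and J :: "real \<Rightarrow> real"
  assumes J0: "\<And>r. r \<ge> 0 \<Longrightarrow> J r \<ge> 0" and J1: "\<And>r. r > 1 \<Longrightarrow> J r = 0"
    and J2: "integrable lborel (\<lambda>w::real^'n. J (norm w) * (norm w)\<^sup>2)"
    and J: "integrable lborel (\<lambda>w::real^'n. J (norm w))"
    and v: "Ck_on 2 (ball 0 R) v" and W: "continuous_on (ball 0 R) W"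
    and Weven: "\<And>z. z \<in> ball 0 R \<Longrightarrow> W (- z) = W z"
    and W1: "\<And>z. norm z \<le> \<epsilon> \<Longrightarrow> \<bar>W z - 1\<bar> \<le> norm z" and \<epsilon>: "0 < \<epsilon>" "\<epsilon> \<le> 1" "\<epsilon> < R"
    and \<omega>: "\<And>i j y. norm y \<le> \<epsilon> \<Longrightarrow> \<bar>partial i (partial j v) y - partial i (partial j v) 0\<bar> \<le> \<omega>"
  shows "\<bar>1 / \<epsilon>\<^sup>2 * integral\<^sup>L lborel (\<lambda>w. J (norm w) * ((v (\<epsilon> *\<^sub>R w) - v 0) * W (\<epsilon> *\<^sub>R w)))
      - 1 / (2 * real CARD('n)) * integral\<^sup>L lborel (\<lambda>w::real^'n. J (norm w) * (norm w)\<^sup>2) * (\<Sum>i\<in>UNIV. partial i (partial i v) 0)\<bar>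
    \<le> integral\<^sup>L lborel (\<lambda>w::real^'n. J (norm w) * (norm w)\<^sup>2)
       * ((real CARD('n))\<^sup>2 * \<omega> + 1/2 * \<epsilon> * (\<Sum>i\<in>UNIV. \<Sum>j\<in>UNIV. \<bar>partial i (partial j v) 0\<bar>))"
proof -
  let ?D = "\<lambda>i j. partial i (partial j v) 0"
  let ?m = "integral\<^sup>L lborel (\<lambda>w::real^'n. J (norm w) * (norm w)\<^sup>2)"
  let ?C = "(real CARD('n))\<^sup>2 * \<omega> + 1/2 * \<epsilon> * (\<Sum>i\<in>UNIV. \<Sum>j\<in>UNIV. \<bar>?D i j\<bar>)"
  define K where "K = cball (0::real^'n) 1"
  have Jmeas: "(\<lambda>w::real^'n. J (norm w)) \<in> borel_measurable borel"
    using J by auto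
  have inR: "\<epsilon> *\<^sub>R w \<in> ball 0 R" if "w \<in> K" for w
  proof -
    have "\<epsilon> * norm w \<le> \<epsilon>" using that \<epsilon> by (simp add: K_def mult_left_le)
    then have "\<epsilon> * norm w < R" using \<epsilon> by linarith
    then show ?thesis using \<epsilon> by simp
  qed
  have le_\<epsilon>: "norm (\<epsilon> *\<^sub>R w) \<le> \<epsilon>" if "w \<in> K" for w
    using that \<epsilon> by (simp add: K_def mult_left_le)
  have Jout: "J (norm w) = 0" if "w \<notin> K" for w :: "real^'n"
    using that J1 by (simp add: K_def)
  have W2: "\<bar>W (\<epsilon> *\<^sub>R w)\<bar> \<le> 2" if "w \<in> K" for w
    using W1[OF le_\<epsilon>[OF that]] le_\<epsilon>[OF that] \<epsilon> by linarith
  \<comment> \<open>The integrand E is compared with a linear part F, odd since the weight W is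
    even, and a quadratic part Q in which W is replaced by 1.\<close>
  define E where "E w = J (norm w) * ((v (\<epsilon> *\<^sub>R w) - v 0) * W (\<epsilon> *\<^sub>R w))" for w
  define F where "F w = J (norm w) * (W (\<epsilon> *\<^sub>R w) * (\<Sum>i\<in>UNIV. partial i v 0 * (\<epsilon> * w $ i)))" for w
  define Q where "Q w = (\<Sum>i\<in>UNIV. \<Sum>j\<in>UNIV. 1/2 * \<epsilon>\<^sup>2 * ?D i j * (J (norm w) * (w $ i * w $ j)))" for w
  have scale: "continuous_on K (\<lambda>w. h (\<epsilon> *\<^sub>R w))" if "continuous_on (ball 0 R) h" for h :: "real^'n \<Rightarrow> real"
    by (rule continuous_on_compose2[OF that]) (use inR in \<open>auto intro!: continuous_intros\<close>)
  \<comment> \<open>The functions v and W are controlled only on a ball. As the kernel vanishes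
    outside the unit ball K, cutting h off there does not change the product.\<close>
  have meas: "(\<lambda>w. J (norm w) * h w) \<in> borel_measurable borel" if "continuous_on K h" for h :: "real^'n \<Rightarrow> real"
  proof -
    have "(\<lambda>w. indicator K w *\<^sub>R h w) \<in> borel_measurable borel"
      by (rule borel_measurable_continuous_on_indicator[OF _ that]) (simp add: K_def)
    then have "(\<lambda>w. J (norm w) * (indicator K w *\<^sub>R h w)) \<in> borel_measurable borel"
      by (intro borel_measurable_times Jmeas)
    moreover have "(\<lambda>w. J (norm w) * (indicator K w *\<^sub>R h w)) = (\<lambda>w. J (norm w) * h w)"
      using Jout by (auto simp: indicator_def fun_eq_iff)
    ultimately show ?thesis by (simp only:)
  qed
  have v': "continuous_on (ball 0 R) v" by (rule Ck_on_continuous_on[OF v])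
  have Emeas: "E \<in> borel_measurable lborel"
    unfolding E_def[abs_def] by (simp, intro meas continuous_intros scale v' W)
  have Fmeas: "F \<in> borel_measurable lborel"
    unfolding F_def[abs_def] by (simp, intro meas continuous_intros scale W)
  have Fint: "integrable lborel F"
  proof (rule Bochner_Integration.integrable_bound[OF integrable_mult_left[OF J, of "2 * (\<Sum>i\<in>UNIV. \<bar>partial i v 0\<bar>)"] Fmeas], rule AE_I2)
    fix w :: "real^'n"
    show "norm (F w) \<le> norm (J (norm w) * (2 * (\<Sum>i\<in>UNIV. \<bar>partial i v 0\<bar>)))"
    proof (cases "w \<in> K")
      case True
      have "\<bar>\<Sum>i\<in>UNIV. partial i v 0 * (\<epsilon> * w $ i)\<bar> \<le> (\<Sum>i\<in>UNIV. \<bar>partial i v 0\<bar>)"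
      proof (intro order_trans[OF sum_abs] sum_mono)
        fix i
        have "\<bar>w $ i\<bar> \<le> 1" using component_le_norm_cart[of w i] True by (simp add: K_def)
        then have "\<epsilon> * \<bar>w $ i\<bar> \<le> 1 * 1" using \<epsilon> by (intro mult_mono) auto
        then have "\<bar>partial i v 0\<bar> * (\<epsilon> * \<bar>w $ i\<bar>) \<le> \<bar>partial i v 0\<bar>"
          by (intro mult_left_le) auto
        then show "\<bar>partial i v 0 * (\<epsilon> * w $ i)\<bar> \<le> \<bar>partial i v 0\<bar>"
          using \<epsilon> by (simp add: abs_mult)
      qed
      with W2[OF True] have "\<bar>W (\<epsilon> *\<^sub>R w)\<bar> * \<bar>\<Sum>i\<in>UNIV. partial i v 0 * (\<epsilon> * w $ i)\<bar> \<le> 2 * (\<Sum>i\<in>UNIV. \<bar>partial i v 0\<bar>)"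
        by (intro mult_mono) auto
      then have "\<bar>J (norm w)\<bar> * (\<bar>W (\<epsilon> *\<^sub>R w)\<bar> * \<bar>\<Sum>i\<in>UNIV. partial i v 0 * (\<epsilon> * w $ i)\<bar>)
          \<le> \<bar>J (norm w)\<bar> * (2 * (\<Sum>i\<in>UNIV. \<bar>partial i v 0\<bar>))"
        by (rule mult_left_mono) simp
      moreover have "norm (F w) = \<bar>J (norm w)\<bar> * (\<bar>W (\<epsilon> *\<^sub>R w)\<bar> * \<bar>\<Sum>i\<in>UNIV. partial i v 0 * (\<epsilon> * w $ i)\<bar>)"
        by (simp only: F_def real_norm_def abs_mult)
      moreover have "norm (J (norm w) * (2 * (\<Sum>i\<in>UNIV. \<bar>partial i v 0\<bar>))) = \<bar>J (norm w)\<bar> * (2 * (\<Sum>i\<in>UNIV. \<bar>partial i v 0\<bar>))"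
        by (simp add: abs_mult sum_nonneg)
      ultimately show ?thesis by (simp only:)
    qed (simp add: F_def Jout)
  qed
  have Qint: "integrable lborel Q"
    unfolding Q_def[abs_def]
    by (intro Bochner_Integration.integrable_sum integrable_mult_right integral_radial_quadratic(1)[OF J2 Jmeas])
  have bound: "\<bar>E w - F w - Q w\<bar> \<le> \<epsilon>\<^sup>2 * ?C * (J (norm w) * (norm w)\<^sup>2)" for w
  proof (cases "w \<in> K")
    case True
    let ?z = "\<epsilon> *\<^sub>R w"
    let ?S = "1/2 * (\<Sum>i\<in>UNIV. \<Sum>j\<in>UNIV. ?D i j * (?z $ i * ?z $ j))"
    let ?r = "v ?z - v 0 - (\<Sum>i\<in>UNIV. partial i v 0 * ?z $ i) - ?S"
    have r: "\<bar>?r\<bar> \<le> 1/2 * (real CARD('n))\<^sup>2 * \<omega> * (norm ?z)\<^sup>2"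
      by (rule taylor2_bound[OF v inR[OF True]]) (use \<omega> le_\<epsilon>[OF True] in \<open>blast intro: order_trans\<close>)
    have Q: "Q w = J (norm w) * ?S"
      unfolding Q_def by (simp add: sum_distrib_left power2_eq_square mult_ac)
    \<comment> \<open>Here \<open>?r\<close> is the Taylor remainder and \<open>?S\<close> the
      quadratic term. In front of \<open>?r\<close> the bound W \<le> 2 is enough; in front of
      \<open>?S\<close> the weight error is at most \<epsilon>. These are the two summands of
      \<open>?C\<close>.\<close>
    have eq: "E w - F w - Q w = J (norm w) * (W ?z * ?r + (W ?z - 1) * ?S)"
    proof -
      have id: "a * ((b - d) * W') - a * (W' * L) - a * S = a * (W' * (b - d - L - S) + (W' - 1) * S)"
        for a b d L S W' :: real
        by (simp add: algebra_simps)
      show ?thesis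
        unfolding E_def F_def Q using id[of "J (norm w)" "v ?z" "v 0" "W ?z" _ ?S] by simp
    qed
    have S: "\<bar>?S\<bar> \<le> 1/2 * (\<Sum>i\<in>UNIV. \<Sum>j\<in>UNIV. \<bar>?D i j\<bar>) * (norm ?z)\<^sup>2"
    proof -
      have "\<bar>\<Sum>i\<in>UNIV. \<Sum>j\<in>UNIV. ?D i j * (?z $ i * ?z $ j)\<bar> \<le> (\<Sum>i\<in>UNIV. \<Sum>j\<in>UNIV. \<bar>?D i j\<bar> * (norm ?z)\<^sup>2)"
      proof (intro order_trans[OF sum_abs] sum_mono)
        fix i j
        have "\<bar>?z $ i\<bar> * \<bar>?z $ j\<bar> \<le> norm ?z * norm ?z"
          by (intro mult_mono component_le_norm_cart) auto
        then show "\<bar>?D i j * (?z $ i * ?z $ j)\<bar> \<le> \<bar>?D i j\<bar> * (norm ?z)\<^sup>2"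
          unfolding abs_mult power2_eq_square by (intro mult_left_mono) auto
      qed
      then show ?thesis by (simp add: abs_mult sum_distrib_right)
    qed
    have "\<bar>W ?z * ?r + (W ?z - 1) * ?S\<bar> \<le> 2 * (1/2 * (real CARD('n))\<^sup>2 * \<omega> * (norm ?z)\<^sup>2)
      + \<epsilon> * (1/2 * (\<Sum>i\<in>UNIV. \<Sum>j\<in>UNIV. \<bar>?D i j\<bar>) * (norm ?z)\<^sup>2)"
    proof (rule order_trans[OF abs_triangle_ineq], rule add_mono)
      show "\<bar>W ?z * ?r\<bar> \<le> 2 * (1/2 * (real CARD('n))\<^sup>2 * \<omega> * (norm ?z)\<^sup>2)"
        unfolding abs_mult by (rule mult_mono[OF W2[OF True] r]) auto
      have "\<bar>W ?z - 1\<bar> \<le> \<epsilon>" using W1[OF le_\<epsilon>[OF True]] le_\<epsilon>[OF True] by linarith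
      then show "\<bar>(W ?z - 1) * ?S\<bar> \<le> \<epsilon> * (1/2 * (\<Sum>i\<in>UNIV. \<Sum>j\<in>UNIV. \<bar>?D i j\<bar>) * (norm ?z)\<^sup>2)"
        unfolding abs_mult[of "W ?z - 1"] using S \<epsilon> by (intro mult_mono) auto
    qed
    also have "\<dots> = ?C * (norm ?z)\<^sup>2"
      by (simp add: algebra_simps)
    also have "(norm ?z)\<^sup>2 = \<epsilon>\<^sup>2 * (norm w)\<^sup>2"
      by (simp add: power_mult_distrib)
    finally have "\<bar>W ?z * ?r + (W ?z - 1) * ?S\<bar> \<le> ?C * (\<epsilon>\<^sup>2 * (norm w)\<^sup>2)" .
    then have "J (norm w) * \<bar>W ?z * ?r + (W ?z - 1) * ?S\<bar> \<le> J (norm w) * (?C * (\<epsilon>\<^sup>2 * (norm w)\<^sup>2))"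
      by (intro mult_left_mono J0) auto
    then show ?thesis
      unfolding eq abs_mult[of "J (norm w)"] using J0[of "norm w"] by (simp add: mult_ac)
  qed (simp add: E_def F_def Q_def Jout)
  have bint: "integrable lborel (\<lambda>w::real^'n. \<epsilon>\<^sup>2 * ?C * (J (norm w) * (norm w)\<^sup>2))"
    by (rule integrable_mult_right[OF J2])
  have Rint: "integrable lborel (\<lambda>w. E w - F w - Q w)"
  proof (rule Bochner_Integration.integrable_bound[OF bint])
    show "(\<lambda>w. E w - F w - Q w) \<in> borel_measurable lborel"
      using Emeas Fmeas Qint by auto
    show "AE w in lborel. norm (E w - F w - Q w) \<le> norm (\<epsilon>\<^sup>2 * ?C * (J (norm w) * (norm w)\<^sup>2))"
      unfolding real_norm_def by (rule AE_I2, rule order_trans[OF bound abs_ge_self])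
  qed
  \<comment> \<open>Integrability of E is not assumed but recovered from the dominated remainder and
    the two integrable model terms.\<close>
  have "E = (\<lambda>w. (E w - F w - Q w) + (F w + Q w))"
    by (rule ext) simp
  then have Eint: "integrable lborel E"
    using Bochner_Integration.integrable_add[OF Rint Bochner_Integration.integrable_add[OF Fint Qint]]
    by metis
  have F0: "integral\<^sup>L lborel F = 0"
  proof (rule integral_lborel_odd)
    show "F (- w) = - F w" for w
    proof (cases "w \<in> K")
      case True
      then show ?thesis
        using Weven[OF inR[OF True]] by (simp add: F_def sum_negf)
    next
      case False
      then have "- w \<notin> K" by (simp add: K_def)
      with False show ?thesis by (simp add: F_def Jout del: norm_minus_cancel)
    qed
  qed
  have "integral\<^sup>L lborel Q = (\<Sum>i\<in>UNIV. \<Sum>j\<in>UNIV. 1/2 * \<epsilon>\<^sup>2 * ?D i j * integral\<^sup>L lborel (\<lambda>w. J (norm w) * (w $ i * w $ j)))"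
    unfolding Q_def[abs_def]
    by (simp add: Bochner_Integration.integral_sum Bochner_Integration.integrable_sum integral_radial_quadratic(1)[OF J2 Jmeas])
  also have "\<dots> = (\<Sum>i\<in>UNIV. \<Sum>j\<in>UNIV. 1/2 * \<epsilon>\<^sup>2 * ?D i j * (if i = j then ?m / CARD('n) else 0))"
    unfolding integral_radial_quadratic(2)[OF J2 Jmeas] ..
  also have "\<dots> = (\<Sum>i\<in>UNIV. 1/2 * \<epsilon>\<^sup>2 * ?D i i * (?m / CARD('n)))"
    by (simp add: if_distrib[of "\<lambda>c. _ * c"] cong: if_cong)
  also have "\<dots> = \<epsilon>\<^sup>2 * (1 / (2 * real CARD('n)) * ?m * (\<Sum>i\<in>UNIV. ?D i i))"
    by (simp add: sum_distrib_left sum_distrib_right sum_divide_distrib mult_ac)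
  finally have Q0: "integral\<^sup>L lborel Q = \<epsilon>\<^sup>2 * (1 / (2 * real CARD('n)) * ?m * (\<Sum>i\<in>UNIV. ?D i i))" .
  have "\<bar>integral\<^sup>L lborel (\<lambda>w. E w - F w - Q w)\<bar> \<le> integral\<^sup>L lborel (\<lambda>w::real^'n. \<epsilon>\<^sup>2 * ?C * (J (norm w) * (norm w)\<^sup>2))"
    by (rule order_trans[OF integral_abs_bound Bochner_Integration.integral_mono[OF integrable_abs[OF Rint] bint bound]])
  then have "\<bar>integral\<^sup>L lborel E - \<epsilon>\<^sup>2 * (1 / (2 * real CARD('n)) * ?m * (\<Sum>i\<in>UNIV. ?D i i))\<bar> \<le> \<epsilon>\<^sup>2 * (?m * ?C)"
  proof -
    have "integral\<^sup>L lborel (\<lambda>w. E w - F w - Q w) = integral\<^sup>L lborel E - \<epsilon>\<^sup>2 * (1 / (2 * real CARD('n)) * ?m * (\<Sum>i\<in>UNIV. ?D i i))"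
      using Eint Fint Qint by (simp add: F0 Q0)
    moreover have "integral\<^sup>L lborel (\<lambda>w::real^'n. \<epsilon>\<^sup>2 * ?C * (J (norm w) * (norm w)\<^sup>2)) = \<epsilon>\<^sup>2 * (?m * ?C)"
      by (subst integral_mult_right_zero) (simp only: mult_ac)
    ultimately show ?thesis using \<open>\<bar>integral\<^sup>L lborel (\<lambda>w. E w - F w - Q w)\<bar> \<le> _\<close> by (simp only:)
  qed
  then have "\<epsilon>\<^sup>2 * \<bar>1 / \<epsilon>\<^sup>2 * integral\<^sup>L lborel E - 1 / (2 * real CARD('n)) * ?m * (\<Sum>i\<in>UNIV. ?D i i)\<bar> \<le> \<epsilon>\<^sup>2 * (?m * ?C)"
  proof -
    have "\<bar>integral\<^sup>L lborel E - \<epsilon>\<^sup>2 * (1 / (2 * real CARD('n)) * ?m * (\<Sum>i\<in>UNIV. ?D i i))\<bar>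
      = \<bar>\<epsilon>\<^sup>2 * (1 / \<epsilon>\<^sup>2 * integral\<^sup>L lborel E - 1 / (2 * real CARD('n)) * ?m * (\<Sum>i\<in>UNIV. ?D i i))\<bar>"
      using \<epsilon> by (simp add: right_diff_distrib)
    also have "\<dots> = \<epsilon>\<^sup>2 * \<bar>1 / \<epsilon>\<^sup>2 * integral\<^sup>L lborel E - 1 / (2 * real CARD('n)) * ?m * (\<Sum>i\<in>UNIV. ?D i i)\<bar>"
      by (simp add: abs_mult)
    finally show ?thesis using \<open>\<bar>integral\<^sup>L lborel E - _\<bar> \<le> _\<close> by simp
  qed
  then have "\<bar>1 / \<epsilon>\<^sup>2 * integral\<^sup>L lborel E - 1 / (2 * real CARD('n)) * ?m * (\<Sum>i\<in>UNIV. ?D i i)\<bar> \<le> ?m * ?C"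
    by (rule mult_left_le_imp_le) (use \<epsilon> in simp)
  then show ?thesis unfolding E_def[abs_def] .
qed

section \<open>The nonlocal operator and the Laplacian read in a polar chart\<close>

lemma
  assumes "polar_chart A g p R \<psi> c"
  shows polar_chart_in: "c \<in> A" and polar_radius_pos: "0 < R"
    and polar_domain: "fst c = {q. geodesic_dist A g p q < R}"
    and polar_image: "chart_image c = ball 0 R"
    and polar_centre_in: "p \<in> fst c" and polar_centre: "snd c p = 0"
    and polar_dist: "q \<in> fst c \<Longrightarrow> geodesic_dist A g p q = norm (snd c q)"
  using assms unfolding polar_chart_def by blast+

lemma polar_chart_inv_0:
  assumes A: "differentiable_structure A" and c: "polar_chart A g p R \<psi> c"
  shows "chart_inv c 0 = p"
  using chart_inv_f[OF atlas_chart[OF A polar_chart_in[OF c]] polar_centre_in[OF c]] polar_centre[OF c] by simp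

text \<open>Away from the origin the weight can be divided out, and the origin is a single
  point.\<close>

lemma borel_measurable_radial:
  fixes J :: "real \<Rightarrow> real"
  assumes "(\<lambda>w::real^'n. J (norm w) * (norm w)\<^sup>2) \<in> borel_measurable borel"
  shows "(\<lambda>w::real^'n. J (norm w)) \<in> borel_measurable borel"
proof -
  have "(\<lambda>w::real^'n. if w = 0 then J 0 else (J (norm w) * (norm w)\<^sup>2) / (norm w)\<^sup>2) \<in> borel_measurable borel"
    by (intro measurable_If borel_measurable_divide assms) auto
  moreover have "(\<lambda>w::real^'n. if w = 0 then J 0 else (J (norm w) * (norm w)\<^sup>2) / (norm w)\<^sup>2) = (\<lambda>w. J (norm w))"
    by (auto simp: fun_eq_iff)
  ultimately show ?thesis by (simp only:)
qed

text \<open>Since \<epsilon> < R and J vanishes beyond 1, the kernel only sees the chart. The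
  substitution z = \<epsilon> w produces the factor \<epsilon>^N that cancels the one in the
  definition of the operator.\<close>

lemma L_op_polar:
  fixes c :: "('m::{t2_space, second_countable_topology}, 'n::finite) chart"
  assumes M: "riemannian_manifold A g" and mu: "riemannian_measure A g \<mu>"
    and c: "polar_chart A g x R \<psi> c" and v: "continuous_on (ball 0 R) (u \<circ> chart_inv c)"
    and J1: "\<And>r. r > 1 \<Longrightarrow> J r = 0" and J: "(\<lambda>w::real^'n. J (norm w)) \<in> borel_measurable borel"
    and \<epsilon>: "0 < \<epsilon>" "\<epsilon> < R"
  shows "L_op A g \<mu> J \<epsilon> u x = 1 / \<epsilon>\<^sup>2 * integral\<^sup>L lborel (\<lambda>w. J (norm w) *
    (((u \<circ> chart_inv c) (\<epsilon> *\<^sub>R w) - (u \<circ> chart_inv c) 0) * sqrt (det (g c (\<epsilon> *\<^sub>R w)))))"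
proof -
  let ?v = "u \<circ> chart_inv c" and ?n = "CARD('n)" and ?I = "indicator (ball 0 R) :: real^'n \<Rightarrow> real"
  note cA = polar_chart_in[OF c]
  note chart = atlas_chart[OF manifold_atlas[OF M] cA]
  let ?f = "\<lambda>y. 1 / \<epsilon> ^ ?n * J (geodesic_dist A g x y / \<epsilon>) * (u y - u x)"
  \<comment> \<open>The indicator makes this coordinate expression Borel on the whole space,
    although \<open>?v\<close> is continuous only on the ball.\<close>
  let ?F = "\<lambda>z::real^'n. 1 / \<epsilon> ^ ?n * J (norm z / \<epsilon>) * (?I z * (?v z - ?v 0))"
  have v0: "?v 0 = u x"
    using polar_chart_inv_0[OF manifold_atlas[OF M] c] by simp
  have f0: "?f y = 0" if "y \<notin> fst c" for y
  proof -
    have "R \<le> geodesic_dist A g x y" using that by (simp add: polar_domain[OF c])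
    then have "geodesic_dist A g x y / \<epsilon> > 1" using \<epsilon> by simp
    then show ?thesis using J1 by simp
  qed
  have "(\<lambda>z::real^'n. J (norm ((1 / \<epsilon>) *\<^sub>R z))) \<in> borel_measurable borel"
    by (rule measurable_compose[OF _ J]) simp
  then have J\<epsilon>: "(\<lambda>z::real^'n. J (norm z / \<epsilon>)) \<in> borel_measurable borel"
    using \<epsilon> by simp
  have "(\<lambda>z. ?I z *\<^sub>R (?v z - ?v 0)) \<in> borel_measurable borel"
    by (intro borel_measurable_continuous_on_indicator continuous_on_diff v continuous_on_const) simp
  then have F: "?F \<in> borel_measurable borel"
    using J\<epsilon> by simp
  have eq: "?F (snd c y) = ?f y" if "y \<in> fst c" for y
  proof -
    have "snd c y \<in> ball 0 R" using polar_image[OF c] that by blast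
    then show ?thesis
      using polar_dist[OF c that] v0 chart that by simp
  qed
  have "integral\<^sup>L \<mu> ?f = integral\<^sup>L lborel (\<lambda>z. ?I z * sqrt (det (g c z)) * ?F z)"
    using integral_chart[where f = ?f and F = ?F, OF M mu cA f0 F eq] unfolding polar_image[OF c] .
  also have "\<dots> = \<bar>\<epsilon>\<bar> ^ ?n * integral\<^sup>L lborel (\<lambda>w. ?I (\<epsilon> *\<^sub>R w) * sqrt (det (g c (\<epsilon> *\<^sub>R w))) * ?F (\<epsilon> *\<^sub>R w))"
    by (rule integral_lborel_scaleR) (use \<epsilon> in simp)
  also have "\<dots> = integral\<^sup>L lborel (\<lambda>w. \<bar>\<epsilon>\<bar> ^ ?n * (?I (\<epsilon> *\<^sub>R w) * sqrt (det (g c (\<epsilon> *\<^sub>R w))) * ?F (\<epsilon> *\<^sub>R w)))"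
    by (rule integral_mult_right_zero[symmetric])
  also have "\<dots> = integral\<^sup>L lborel (\<lambda>w. J (norm w) * ((?v (\<epsilon> *\<^sub>R w) - ?v 0) * sqrt (det (g c (\<epsilon> *\<^sub>R w)))))"
  proof (rule Bochner_Integration.integral_cong[OF refl])
    fix w :: "real^'n"
    show "\<bar>\<epsilon>\<bar> ^ ?n * (?I (\<epsilon> *\<^sub>R w) * sqrt (det (g c (\<epsilon> *\<^sub>R w))) * ?F (\<epsilon> *\<^sub>R w))
      = J (norm w) * ((?v (\<epsilon> *\<^sub>R w) - ?v 0) * sqrt (det (g c (\<epsilon> *\<^sub>R w))))"
    proof (cases "\<epsilon> *\<^sub>R w \<in> ball 0 R")
      case True
      then show ?thesis using \<epsilon> by simp
    next
      case False
      have "norm w > 1"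
      proof (rule ccontr)
        assume "\<not> norm w > 1"
        then have "\<epsilon> * norm w \<le> \<epsilon>" using \<epsilon> by (simp add: mult_left_le)
        with False \<epsilon> show False by simp
      qed
      with False show ?thesis using J1 by simp
    qed
  qed
  finally show ?thesis by (simp add: L_op_def)
qed

lemma
  fixes c :: "('m::{t2_space, second_countable_topology}, 'n::finite) chart"
  assumes M: "riemannian_manifold A g" and c: "polar_chart A g x R \<psi> c"
  shows polar_metric_det: "z \<in> ball 0 R \<Longrightarrow> det (g c z) > 0"
    and polar_density_continuous: "continuous_on (ball 0 R) (\<lambda>z. sqrt (det (g c z)))"
    and polar_density_near_0: "\<exists>\<delta>>0. \<forall>z. norm z < \<delta> \<longrightarrow> \<bar>sqrt (det (g c z)) - 1\<bar> \<le> norm z"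
proof -
  note cA = polar_chart_in[OF c] and im = polar_image[OF c] and R = polar_radius_pos[OF c]
  have G: "Ck_on 2 (ball 0 R) (g c)" using metric_Ck_on[OF M cA] im by simp
  show det: "det (g c z) > 0" if "z \<in> ball 0 R" for z
    by (rule det_pos_definite[OF metric_pos[OF M cA]]) (use that im in auto)
  show "continuous_on (ball 0 R) (\<lambda>z. sqrt (det (g c z)))"
    by (intro continuous_intros Ck_on_continuous_on[OF G])
  have "g c differentiable (at 0)" using G R by (simp add: numeral_2_eq_2)
  from differentiable_det[OF matrix_entry_differentiable[OF this]]
  obtain D where "((\<lambda>z. det (g c z)) has_derivative D) (at 0)"
    using differentiable_def by blast
  then have "(\<lambda>z. sqrt (det (g c z))) differentiable (at 0)"
    using det[of 0] R by (intro differentiableI) (rule has_derivative_real_sqrt, auto)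
  then have "((\<lambda>z. sqrt (det (g c z))) has_derivative (\<lambda>_. 0)) (at 0)"
    by (rule has_derivative_even[where T = "ball 0 R"]) (use R polar_metric_even[OF M c] in auto)
  \<comment> \<open>The density is even, so its derivative at the centre is 0; the definition of the
    derivative is used with tolerance 1. A first-order bound is enough because this error will
    multiply a quadratic term.\<close>
  then obtain \<delta> where "\<delta> > 0" "\<forall>z. norm (z - 0) < \<delta> \<longrightarrow>
      norm (sqrt (det (g c z)) - sqrt (det (g c 0)) - 0) \<le> 1 * norm (z - 0)"
    unfolding has_derivative_at_alt by (meson zero_less_one)
  then show "\<exists>\<delta>>0. \<forall>z. norm z < \<delta> \<longrightarrow> \<bar>sqrt (det (g c z)) - 1\<bar> \<le> norm z"
    by (intro exI[of _ \<delta>]) (simp add: polar_metric_0[OF M c])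
qed

text \<open>Near the origin the volume density is bounded below, so integrability on the manifold
  passes to flat space; farther out the kernel is dominated by its second moment.\<close>

lemma integrable_radial_kernel:
  fixes c :: "('m::{t2_space, second_countable_topology}, 'n::finite) chart" and J :: "real \<Rightarrow> real"
  assumes M: "riemannian_manifold A g" and mu: "riemannian_measure A g \<mu>"
    and c: "polar_chart A g p R \<psi> c" and J0: "\<And>r. r \<ge> 0 \<Longrightarrow> J r \<ge> 0"
    and J2: "integrable lborel (\<lambda>w::real^'n. J (norm w) * (norm w)\<^sup>2)"
    and J\<mu>: "integrable \<mu> (\<lambda>x. J (geodesic_dist A g x p))"
  shows "integrable lborel (\<lambda>w::real^'n. J (norm w))"
proof -
  note cA = polar_chart_in[OF c]
  note chart = atlas_chart[OF manifold_atlas[OF M] cA]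
  have Jm: "(\<lambda>w::real^'n. J (norm w)) \<in> borel_measurable borel"
    by (rule borel_measurable_radial) (use J2 in auto)
  let ?f = "\<lambda>x. indicator (fst c) x *\<^sub>R J (geodesic_dist A g x p)"
  have "fst c \<in> sets \<mu>"
    using mu chart_open[OF chart] by (simp add: riemannian_measure_def)
  then have f: "integrable \<mu> ?f"
    by (rule integrable_mult_indicator[OF _ J\<mu>])
  have eq: "J (norm (snd c y)) = ?f y" if "y \<in> fst c" for y
    using polar_dist[OF c that] that geodesic_dist_commute[OF M, of y p] by simp
  let ?F = "\<lambda>z. indicator (ball 0 R) z * sqrt (det (g c z)) * J (norm z)"
  have f0: "?f y = 0" if "y \<notin> fst c" for y
    using that by simp
  have F: "integrable lborel ?F"
    using integrable_chart[where f = ?f and F = "\<lambda>z. J (norm z)", OF M mu cA f0 Jm eq] f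
    unfolding polar_image[OF c] by blast
  obtain \<delta>' where \<delta>': "\<delta>' > 0" "\<And>z. norm z < \<delta>' \<Longrightarrow> \<bar>sqrt (det (g c z)) - 1\<bar> \<le> norm z"
    using polar_density_near_0[OF M c] by blast
  \<comment> \<open>For |w| < 1/2 the density is at least 1/2, which is the source of the factor 2
    in the dominating function; the factor 1 / \<delta>^2 serves the region |w| \<ge>
    \<delta>.\<close>
  define \<delta> where "\<delta> = min \<delta>' (min R (1/2))"
  have \<delta>: "\<delta> > 0" "\<delta> \<le> \<delta>'" "\<delta> \<le> R" "\<delta> \<le> 1/2"
    using \<delta>'(1) polar_radius_pos[OF c] by (auto simp: \<delta>_def)
  show ?thesis
  proof (rule Bochner_Integration.integrable_bound)
    show "integrable lborel (\<lambda>w::real^'n. 2 * ?F w + 1 / \<delta>\<^sup>2 * (J (norm w) * (norm w)\<^sup>2))"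
      by (intro Bochner_Integration.integrable_add integrable_mult_right F J2)
    show "(\<lambda>w::real^'n. J (norm w)) \<in> borel_measurable lborel" using Jm by simp
    show "AE w in lborel. norm (J (norm w)) \<le> norm (2 * ?F w + 1 / \<delta>\<^sup>2 * (J (norm w) * (norm w)\<^sup>2))"
    proof (rule AE_I2)
      fix w :: "real^'n"
      have Jw: "J (norm w) \<ge> 0" using J0 by simp
      have F0: "?F w \<ge> 0"
        using Jw polar_metric_det[OF M c, of w] by (auto simp: indicator_def)
      have B0: "1 / \<delta>\<^sup>2 * (J (norm w) * (norm w)\<^sup>2) \<ge> 0" using Jw by simp
      have "J (norm w) \<le> 2 * ?F w + 1 / \<delta>\<^sup>2 * (J (norm w) * (norm w)\<^sup>2)"
      proof (cases "norm w < \<delta>")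
        case True
        then have "sqrt (det (g c w)) \<ge> 1/2" using \<delta>'(2)[of w] \<delta> by linarith
        then have "1/2 * J (norm w) \<le> sqrt (det (g c w)) * J (norm w)" by (rule mult_right_mono[OF _ Jw])
        moreover have "w \<in> ball 0 R" using True \<delta> by simp
        ultimately have "J (norm w) \<le> 2 * ?F w" by simp
        with B0 show ?thesis by linarith
      next
        case False
        then have "\<delta>\<^sup>2 \<le> (norm w)\<^sup>2" using \<delta> by (intro power_mono) auto
        then have "1 \<le> 1 / \<delta>\<^sup>2 * (norm w)\<^sup>2" using \<delta> by simp
        then have "J (norm w) * 1 \<le> J (norm w) * (1 / \<delta>\<^sup>2 * (norm w)\<^sup>2)" by (rule mult_left_mono[OF _ Jw])
        also have "\<dots> = 1 / \<delta>\<^sup>2 * (J (norm w) * (norm w)\<^sup>2)" by simp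
        finally show ?thesis using F0 by linarith
      qed
      then show "norm (J (norm w)) \<le> norm (2 * ?F w + 1 / \<delta>\<^sup>2 * (J (norm w) * (norm w)\<^sup>2))"
        using Jw by (simp only: real_norm_def)
    qed
  qed
qed

lemma local_rep_id_metric:
  fixes c c' :: "('m::{t2_space, second_countable_topology}, 'n::finite) chart"
  assumes M: "riemannian_manifold A g" and c: "c \<in> A" "c' \<in> A" and y: "y \<in> local_dom id c c'"
  shows "g c y = transpose (matrix (frechet_derivative (local_rep id c c') (at y)))
    ** g c' (local_rep id c c' y) ** matrix (frechet_derivative (local_rep id c c') (at y))"
  using metric_transform[OF M] c y by (auto simp: preserves_metric_def Let_def)

text \<open>The operator is defined through \<open>chart_at\<close>, an unknown chart. The
  transition map from it to the polar chart plays the role of F in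
  \<open>laplace_coord_centre\<close>.\<close>

lemma laplace_beltrami_polar:
  fixes c :: "('m::{t2_space, second_countable_topology}, 'n::finite) chart"
  assumes M: "riemannian_manifold A g" and c: "polar_chart A g x R \<psi> c"
    and v: "Ck_on 2 (ball 0 R) (u \<circ> chart_inv c)"
  shows "laplace_beltrami A g u x = (\<Sum>i\<in>UNIV. partial i (partial i (u \<circ> chart_inv c)) 0)"
proof -
  note A = manifold_atlas[OF M] and cA = polar_chart_in[OF c] and im = polar_image[OF c]
  let ?c' = "chart_at A x"
  note c' = chart_at[OF A, of x]
  note chart = atlas_chart[OF A cA] and chart' = atlas_chart[OF A c'(1)]
  let ?S = "local_dom id ?c' c" and ?F = "local_rep id ?c' c"
  have dom: "y \<in> ?S \<longleftrightarrow> y \<in> chart_image ?c' \<and> chart_inv ?c' y \<in> fst c" for y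
    by (simp add: local_dom_iff[OF chart'])
  have "laplace_coord (g ?c') (u \<circ> chart_inv ?c') (snd ?c' x) = (\<Sum>i\<in>UNIV. partial i (partial i (u \<circ> chart_inv c)) 0)"
  proof (rule laplace_coord_centre[where S = ?S and F = ?F and G = "g c" and T = "ball 0 R"])
    show "open ?S"
      by (rule open_local_dom[OF chart' chart_open[OF chart]]) simp
    show "snd ?c' x \<in> ?S"
      using c' chart' polar_centre_in[OF c] by (simp add: dom)
    have "Ck_on 3 ?S ?F"
      using atlas_compatible[OF A c'(1) cA] by (simp add: compatible_def)
    then have "Ck_on (Suc 2) ?S ?F" by (simp only: eval_nat_numeral)
    then show "Ck_on 2 ?S ?F" by (rule Ck_on_decr)
    show "?F y \<in> ball 0 R" if "y \<in> ?S" for y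
    proof -
      have "snd c (chart_inv ?c' y) \<in> chart_image c" using that unfolding dom by blast
      then show ?thesis by (simp only: im local_rep_def o_apply id_apply)
    qed
    show "?F (snd ?c' x) = 0"
      using c' chart' polar_centre[OF c] by (simp add: local_rep_def)
    show eq: "g ?c' y = transpose (matrix (frechet_derivative ?F (at y))) ** g c (?F y) ** matrix (frechet_derivative ?F (at y))"
      if "y \<in> ?S" for y
      by (rule local_rep_id_metric[OF M c'(1) cA that])
    \<comment> \<open>Invertibility of the Jacobian is read off the transformation law, whose left
      side has positive determinant; no inverse map is differentiated.\<close>
    show "det (matrix (frechet_derivative ?F (at y))) \<noteq> 0" if "y \<in> ?S" for y
    proof -
      have "det (g ?c' y) > 0"
        by (rule det_pos_definite[OF metric_pos[OF M c'(1)]]) (use that in \<open>auto simp: dom\<close>)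
      then show ?thesis
        unfolding eq[OF that] by (auto simp: det_mul)
    qed
    show "(u \<circ> chart_inv ?c') y = (u \<circ> chart_inv c) (?F y)" if "y \<in> ?S" for y
      using that chart by (simp add: dom local_rep_def)
    show "g c differentiable (at 0)"
      using metric_Ck_on[OF M cA] im polar_radius_pos[OF c] by (simp add: numeral_2_eq_2)
  qed (use polar_metric_det[OF M c] polar_metric_0[OF M c] polar_metric_even[OF M c] v in auto)
  then show ?thesis by (simp add: laplace_beltrami_def Let_def)
qed

lemma L_op_estimate_polar:
  fixes c :: "('m::{t2_space, second_countable_topology}, 'n::finite) chart" and J :: "real \<Rightarrow> real"
  assumes M: "riemannian_manifold A g" and mu: "riemannian_measure A g \<mu>"
    and c: "polar_chart A g x R \<psi> c" and v: "Ck_on 2 (ball 0 R) (u \<circ> chart_inv c)"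
    and J0: "\<And>r. r \<ge> 0 \<Longrightarrow> J r \<ge> 0" and J1: "\<And>r. r > 1 \<Longrightarrow> J r = 0"
    and J2: "integrable lborel (\<lambda>w::real^'n. J (norm w) * (norm w)\<^sup>2)"
    and J: "integrable lborel (\<lambda>w::real^'n. J (norm w))"
    and W: "\<And>z. norm z \<le> \<epsilon> \<Longrightarrow> \<bar>sqrt (det (g c z)) - 1\<bar> \<le> norm z" and \<epsilon>: "0 < \<epsilon>" "\<epsilon> \<le> 1" "\<epsilon> < R"
    and \<omega>: "\<And>i j y. norm y \<le> \<epsilon> \<Longrightarrow>
      \<bar>partial i (partial j (u \<circ> chart_inv c)) y - partial i (partial j (u \<circ> chart_inv c)) 0\<bar> \<le> \<omega>"
  shows "\<bar>L_op A g \<mu> J \<epsilon> u x - 1 / (2 * real CARD('n)) * integral\<^sup>L lborel (\<lambda>w::real^'n. J (norm w) * (norm w)\<^sup>2)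
        * laplace_beltrami A g u x\<bar>
    \<le> integral\<^sup>L lborel (\<lambda>w::real^'n. J (norm w) * (norm w)\<^sup>2) * ((real CARD('n))\<^sup>2 * \<omega>
      + 1/2 * \<epsilon> * (\<Sum>i\<in>UNIV. \<Sum>j\<in>UNIV. \<bar>partial i (partial j (u \<circ> chart_inv c)) 0\<bar>))"
proof -
  have Jm: "(\<lambda>w::real^'n. J (norm w)) \<in> borel_measurable borel" using J by auto
  have L: "L_op A g \<mu> J \<epsilon> u x = 1 / \<epsilon>\<^sup>2 * integral\<^sup>L lborel (\<lambda>w. J (norm w) *
    (((u \<circ> chart_inv c) (\<epsilon> *\<^sub>R w) - (u \<circ> chart_inv c) 0) * sqrt (det (g c (\<epsilon> *\<^sub>R w)))))"
    by (rule L_op_polar[OF M mu c Ck_on_continuous_on[OF v] J1 Jm \<epsilon>(1,3)])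
  show ?thesis
    unfolding laplace_beltrami_polar[OF M c v] L
  proof (rule nonlocal_average_estimate[where W = "\<lambda>z. sqrt (det (g c z))" and R = R])
    show "sqrt (det (g c (- z))) = sqrt (det (g c z))" if "z \<in> ball 0 R" for z
      by (simp only: polar_metric_even[OF M c that])
    show "Ck_on 2 (ball 0 R) (u \<circ> chart_inv c)" by (rule v)
  qed (fact J0 J1 J2 J polar_density_continuous[OF M c] W \<epsilon> \<omega>)+
qed

section \<open>Second derivatives of isometries\<close>

text \<open>With y = \<phi>(z) and D the Jacobian of \<phi> at z, this is what the k-th derivative
  of the isometry equation leaves, in entry (l, m), for the terms with second derivatives of
  \<phi>.\<close>

definition metric_defect ::
  "(real^'n \<Rightarrow> real^'n^'n) \<Rightarrow> real^'n \<Rightarrow> real^'n \<Rightarrow> real^'n^'n \<Rightarrow> 'n \<Rightarrow> 'n \<Rightarrow> 'n \<Rightarrow> real" where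
  "metric_defect G z y D k l m = partial k G z $ l $ m -
     (\<Sum>c\<in>UNIV. \<Sum>a\<in>UNIV. \<Sum>b\<in>UNIV. partial c G y $ a $ b * D $ c $ k * D $ a $ l * D $ b $ m)"

text \<open>The transformation law of Christoffel symbols, solved for the second derivatives of an
  isometry. The image point y and the Jacobian D are independent arguments so that the formula
  becomes one continuous function, common to all isometries. For an isometry, D G(z)^-1 inverts the
  transposed D times G(y).\<close>

definition isometry_hessian ::
  "(real^'n \<Rightarrow> real^'n^'n) \<Rightarrow> real^'n \<Rightarrow> real^'n \<Rightarrow> real^'n^'n \<Rightarrow> 'n \<Rightarrow> 'n \<Rightarrow> real^'n::finite" where
  "isometry_hessian G z y D k l = D *v (matrix_inv (G z) *v (\<chi> m.
     (metric_defect G z y D k l m + metric_defect G z y D l k m - metric_defect G z y D m k l) / 2))"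

text \<open>The second-order chain rule for v composed with an isometry, with its second derivatives
  replaced by the formula above.\<close>

definition pullback_hessian ::
  "(real^'n \<Rightarrow> real^'n^'n) \<Rightarrow> (real^'n \<Rightarrow> real) \<Rightarrow> real^'n \<Rightarrow> real^'n \<Rightarrow> real^'n^'n \<Rightarrow> 'n \<Rightarrow> 'n \<Rightarrow> real" where
  "pullback_hessian G v z y D i j =
     (\<Sum>a\<in>UNIV. \<Sum>b\<in>UNIV. partial b (partial a v) y * D $ b $ i * D $ a $ j) +
     (\<Sum>a\<in>UNIV. partial a v y * isometry_hessian G z y D i j $ a)"

text \<open>The Christoffel trick: permuting the indices in the derivative of the isometry equation
  expresses all second derivatives of an isometry through the metric and its first derivatives.\<close>

lemma partial_partial_isometry:
  fixes G :: "real^'n \<Rightarrow> real^'n^'n" and \<phi> :: "real^'n \<Rightarrow> real^'n"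
  assumes U: "open U" "z \<in> U" and \<phi>: "Ck_on 2 U \<phi>" "\<And>z. z \<in> U \<Longrightarrow> \<phi> z \<in> V"
    and G: "Ck_on 1 V G" "U \<subseteq> V" "\<And>y. y \<in> V \<Longrightarrow> transpose (G y) = G y" "det (G z) \<noteq> 0"
    and iso: "\<And>z. z \<in> U \<Longrightarrow> G z = transpose (matrix (frechet_derivative \<phi> (at z))) ** G (\<phi> z)
      ** matrix (frechet_derivative \<phi> (at z))"
  shows "partial k (partial l \<phi>) z = isometry_hessian G z (\<phi> z) (matrix (frechet_derivative \<phi> (at z))) k l"
proof -
  define M where "M y = matrix (frechet_derivative \<phi> (at y))" for y
  have d\<phi>: "\<phi> differentiable (at y)" "partial a \<phi> differentiable (at y)" if "y \<in> U" for y a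
    using \<phi>(1) that by (simp_all add: numeral_2_eq_2)
  have dG: "G differentiable (at y)" if "y \<in> V" for y
    using G(1) that by simp
  have M: "M y $ a $ l = partial l \<phi> y $ a" for y a l
    by (simp add: M_def matrix_frechet_derivative)
  define P where "P k l = partial k (partial l \<phi>) z" for k l
  have P_sym: "P k l = P l k" for k l
  proof -
    have P: "partial k (partial l (\<lambda>y. \<phi> y $ a)) z = P k l $ a" for k l a
    proof -
      have "partial k (partial l (\<lambda>y. \<phi> y $ a)) z = partial k (\<lambda>y. partial l \<phi> y $ a) z"
        by (rule partial_cong_open[OF U]) (simp add: partial_nth d\<phi>)
      then show ?thesis by (simp add: partial_nth d\<phi> U P_def)
    qed
    have "P k l $ a = P l k $ a" for a
      unfolding P[symmetric] by (rule partial_commute[OF Ck_on_nth[OF U(1) \<phi>(1)] U])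
    then show ?thesis by (simp add: vec_eq_iff)
  qed
  have G_sym: "G y $ a $ b = G y $ b $ a" if "y \<in> V" for y a b
    using arg_cong[OF G(3)[OF that], of "\<lambda>A. A $ b $ a"] by (simp add: transpose_def)
  have \<phi>z: "\<phi> z \<in> V" and z: "z \<in> V" using \<phi>(2) U G(2) by auto
  \<comment> \<open>The pairing, in the metric at the image point, of the second derivative
    \<open>P k l\<close> with the m-th column of the Jacobian. It is symmetric in its first two
    indices.\<close>
  define T where "T k l m = (\<Sum>a\<in>UNIV. \<Sum>b\<in>UNIV. G (\<phi> z) $ a $ b * P k l $ a * M z $ b $ m)" for k l m
  have T_sym: "T k l m = T l k m" for k l m
    by (simp add: T_def P_sym[of k l])
  have T': "(\<Sum>a\<in>UNIV. \<Sum>b\<in>UNIV. G (\<phi> z) $ a $ b * M z $ a $ l * P k m $ b) = T k m l" for k l m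
    unfolding T_def by (subst sum.swap) (simp add: G_sym[OF \<phi>z] mult_ac)
  have der_entry: "((\<lambda>y. A y $ a) has_derivative (\<lambda>h. (\<Sum>i\<in>UNIV. h $ i *\<^sub>R partial i A y) $ a)) (at y)"
    if "A differentiable (at y)" for A :: "real^'n \<Rightarrow> 'b::real_normed_vector^'m" and a and y
    by (rule bounded_linear.has_derivative[OF bounded_linear_vec_nth has_derivative_partial[OF that]])
  have defect: "metric_defect G z (\<phi> z) (M z) k l m = T k l m + T k m l" for k l m
  proof -
    have e1: "((\<lambda>y. G y $ a $ b) has_derivative (\<lambda>h. (\<Sum>c\<in>UNIV. h $ c *\<^sub>R partial c G y) $ a $ b)) (at y)"
      if "y \<in> V" for y a b
      by (rule bounded_linear.has_derivative[OF bounded_linear_vec_nth der_entry[OF dG[OF that]]])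
    have "(\<phi> has_derivative frechet_derivative \<phi> (at z)) (at z)"
      using iffD1[OF frechet_derivative_works d\<phi>(1)[OF U(2)]] .
    from diff_chain_at[OF this e1[OF \<phi>z]]
    have e2: "((\<lambda>y. G (\<phi> y) $ a $ b) has_derivative
      (\<lambda>h. (\<Sum>c\<in>UNIV. frechet_derivative \<phi> (at z) h $ c *\<^sub>R partial c G (\<phi> z)) $ a $ b)) (at z)" for a b
      by (simp add: o_def)
    have e3: "((\<lambda>y. M y $ a $ l) has_derivative (\<lambda>h. (\<Sum>i\<in>UNIV. h $ i *\<^sub>R partial i (partial l \<phi>) z) $ a)) (at z)" for a l
      unfolding M by (rule der_entry[OF d\<phi>(2)[OF U(2)]])
    have "((\<lambda>y. \<Sum>a\<in>UNIV. \<Sum>b\<in>UNIV. G (\<phi> y) $ a $ b * M y $ a $ l * M y $ b $ m) has_derivative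
      (\<lambda>h. \<Sum>a\<in>UNIV. \<Sum>b\<in>UNIV. G (\<phi> z) $ a $ b * M z $ a $ l * (\<Sum>i\<in>UNIV. h $ i *\<^sub>R partial i (partial m \<phi>) z) $ b
        + (G (\<phi> z) $ a $ b * (\<Sum>i\<in>UNIV. h $ i *\<^sub>R partial i (partial l \<phi>) z) $ a
          + (\<Sum>c\<in>UNIV. frechet_derivative \<phi> (at z) h $ c *\<^sub>R partial c G (\<phi> z)) $ a $ b * M z $ a $ l) * M z $ b $ m)) (at z)"
      by (intro has_derivative_sum has_derivative_mult e2 e3)
    moreover have "(\<Sum>a\<in>UNIV. \<Sum>b\<in>UNIV. G (\<phi> y) $ a $ b * M y $ a $ l * M y $ b $ m) = G y $ l $ m" if "y \<in> U" for y
    proof -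
      have "G y $ l $ m = (transpose (M y) ** G (\<phi> y) ** M y) $ l $ m"
        using arg_cong[OF iso[OF that], of "\<lambda>A. A $ l $ m"] by (simp only: M_def)
      also have "\<dots> = (\<Sum>b\<in>UNIV. \<Sum>a\<in>UNIV. G (\<phi> y) $ a $ b * M y $ a $ l * M y $ b $ m)"
        by (simp add: matrix_matrix_mult_def transpose_def sum_distrib_left sum_distrib_right mult_ac)
      also have "\<dots> = (\<Sum>a\<in>UNIV. \<Sum>b\<in>UNIV. G (\<phi> y) $ a $ b * M y $ a $ l * M y $ b $ m)"
        by (rule sum.swap)
      finally show ?thesis ..
    qed
    ultimately have "((\<lambda>y. G y $ l $ m) has_derivative
      (\<lambda>h. \<Sum>a\<in>UNIV. \<Sum>b\<in>UNIV. G (\<phi> z) $ a $ b * M z $ a $ l * (\<Sum>i\<in>UNIV. h $ i *\<^sub>R partial i (partial m \<phi>) z) $ b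
        + (G (\<phi> z) $ a $ b * (\<Sum>i\<in>UNIV. h $ i *\<^sub>R partial i (partial l \<phi>) z) $ a
          + (\<Sum>c\<in>UNIV. frechet_derivative \<phi> (at z) h $ c *\<^sub>R partial c G (\<phi> z)) $ a $ b * M z $ a $ l) * M z $ b $ m)) (at z)"
      by (rule has_derivative_transform_within_open[OF _ U])
    from partial_eqI[OF this, of k]
    have p: "partial k (\<lambda>y. G y $ l $ m) z =
      (\<Sum>a\<in>UNIV. \<Sum>b\<in>UNIV. G (\<phi> z) $ a $ b * M z $ a $ l * (\<Sum>i\<in>UNIV. axis k 1 $ i *\<^sub>R partial i (partial m \<phi>) z) $ b
        + (G (\<phi> z) $ a $ b * (\<Sum>i\<in>UNIV. axis k 1 $ i *\<^sub>R partial i (partial l \<phi>) z) $ a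
          + (\<Sum>c\<in>UNIV. frechet_derivative \<phi> (at z) (axis k 1) $ c *\<^sub>R partial c G (\<phi> z)) $ a $ b * M z $ a $ l) * M z $ b $ m)" .
    have ax: "(\<Sum>i\<in>UNIV. axis k (1::real) $ i *\<^sub>R f i) = f k" for f :: "'n \<Rightarrow> real^'n"
      by (simp add: axis_def if_distrib[of "\<lambda>c. c *\<^sub>R _"] cong: if_cong)
    have "partial k (\<lambda>y. G y $ l $ m) z = partial k G z $ l $ m"
      using partial_eqI[OF e1[OF z], of k l m] by (simp add: axis_def if_distrib[of "\<lambda>c. c * _"] cong: if_cong)
    moreover have "frechet_derivative \<phi> (at z) (axis k 1) $ c = M z $ c $ k" for c
      by (simp add: M partial_def)
    ultimately have "partial k G z $ l $ m = (\<Sum>a\<in>UNIV. \<Sum>b\<in>UNIV. G (\<phi> z) $ a $ b * M z $ a $ l * P k m $ b)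
        + T k l m + (\<Sum>a\<in>UNIV. \<Sum>b\<in>UNIV. \<Sum>c\<in>UNIV. partial c G (\<phi> z) $ a $ b * M z $ c $ k * M z $ a $ l * M z $ b $ m)"
      using p unfolding ax P_def[symmetric] T_def
      by (simp add: sum.distrib distrib_right distrib_left sum_distrib_right sum_distrib_left mult_ac)
    also have "(\<Sum>a\<in>UNIV. \<Sum>b\<in>UNIV. \<Sum>c\<in>UNIV. partial c G (\<phi> z) $ a $ b * M z $ c $ k * M z $ a $ l * M z $ b $ m)
      = (\<Sum>c\<in>UNIV. \<Sum>a\<in>UNIV. \<Sum>b\<in>UNIV. partial c G (\<phi> z) $ a $ b * M z $ c $ k * M z $ a $ l * M z $ b $ m)"
    proof -
      have "(\<Sum>a\<in>UNIV. \<Sum>b\<in>UNIV. \<Sum>c\<in>UNIV. partial c G (\<phi> z) $ a $ b * M z $ c $ k * M z $ a $ l * M z $ b $ m)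
        = (\<Sum>a\<in>UNIV. \<Sum>c\<in>UNIV. \<Sum>b\<in>UNIV. partial c G (\<phi> z) $ a $ b * M z $ c $ k * M z $ a $ l * M z $ b $ m)"
        by (rule sum.cong[OF refl], rule sum.swap)
      also have "\<dots> = (\<Sum>c\<in>UNIV. \<Sum>a\<in>UNIV. \<Sum>b\<in>UNIV. partial c G (\<phi> z) $ a $ b * M z $ c $ k * M z $ a $ l * M z $ b $ m)"
        by (rule sum.swap)
      finally show ?thesis .
    qed
    finally show ?thesis
      unfolding metric_defect_def T' by simp
  qed
  \<comment> \<open>Each defect is a sum of two values of T. By symmetry in the first two indices
    four of the six terms cancel, leaving \<open>T k l m\<close> twice.\<close>
  have "(metric_defect G z (\<phi> z) (M z) k l m + metric_defect G z (\<phi> z) (M z) l k m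
      - metric_defect G z (\<phi> z) (M z) m k l) / 2 = T k l m" for m
    unfolding defect using T_sym[of k l m] T_sym[of k m l] T_sym[of l m k] by simp
  moreover have "T k l m = (transpose (M z) *v (G (\<phi> z) *v P k l)) $ m" for m
  proof -
    have "(transpose (M z) *v (G (\<phi> z) *v P k l)) $ m = (\<Sum>b\<in>UNIV. \<Sum>a\<in>UNIV. M z $ b $ m * (G (\<phi> z) $ b $ a * P k l $ a))"
      by (simp add: matrix_vector_mult_def transpose_def sum_distrib_left del: transpose_matrix_vector)
    also have "\<dots> = T k l m"
      unfolding T_def by (subst sum.swap) (simp add: G_sym[OF \<phi>z] mult_ac)
    finally show ?thesis ..
  qed
  ultimately have "isometry_hessian G z (\<phi> z) (M z) k l
     = M z *v (matrix_inv (G z) *v (transpose (M z) *v (G (\<phi> z) *v P k l)))"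
    by (simp add: isometry_hessian_def del: transpose_matrix_vector)
  also have "\<dots> = ((M z ** matrix_inv (G z)) ** (transpose (M z) ** G (\<phi> z))) *v P k l"
    by (simp only: matrix_vector_mul_assoc matrix_mul_assoc)
  \<comment> \<open>The isometry equation gives the product in the opposite order; for square
    matrices a one-sided inverse is two-sided.\<close>
  also have "(M z ** matrix_inv (G z)) ** (transpose (M z) ** G (\<phi> z)) = mat 1"
  proof -
    have "(transpose (M z) ** G (\<phi> z)) ** (M z ** matrix_inv (G z))
      = (transpose (M z) ** G (\<phi> z) ** M z) ** matrix_inv (G z)"
      by (simp only: matrix_mul_assoc)
    also have "\<dots> = G z ** matrix_inv (G z)"
      using iso[OF U(2)] unfolding M_def by (rule arg_cong[of _ _ "\<lambda>A. A ** _", OF sym])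
    also have "\<dots> = mat 1" by (rule matrix_inv_right[OF G(4)])
    finally show ?thesis by (simp only: matrix_left_right_inverse)
  qed
  finally show ?thesis by (simp add: P_def M_def)
qed

lemma partial_partial_compose_isometry:
  fixes G :: "real^'n \<Rightarrow> real^'n^'n" and \<phi> :: "real^'n \<Rightarrow> real^'n" and v :: "real^'n \<Rightarrow> real"
  assumes U: "open U" "z \<in> U" and \<phi>: "Ck_on 2 U \<phi>" "\<And>z. z \<in> U \<Longrightarrow> \<phi> z \<in> V"
    and G: "Ck_on 1 V G" "U \<subseteq> V" "\<And>y. y \<in> V \<Longrightarrow> transpose (G y) = G y" "det (G z) \<noteq> 0"
    and iso: "\<And>z. z \<in> U \<Longrightarrow> G z = transpose (matrix (frechet_derivative \<phi> (at z))) ** G (\<phi> z)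
      ** matrix (frechet_derivative \<phi> (at z))"
    and v: "Ck_on 2 V v"
  shows "partial i (partial j (\<lambda>z. v (\<phi> z))) z
    = pullback_hessian G v z (\<phi> z) (matrix (frechet_derivative \<phi> (at z))) i j"
proof -
  have d\<phi>: "\<phi> differentiable (at y)" "partial a \<phi> differentiable (at y)" if "y \<in> U" for y a
    using \<phi>(1) that by (simp_all add: numeral_2_eq_2)
  have dv: "v differentiable (at y)" "partial a v differentiable (at y)" if "y \<in> V" for y a
    using v that by (simp_all add: numeral_2_eq_2)
  have "((\<lambda>y. \<Sum>a\<in>UNIV. partial j \<phi> y $ a * partial a v (\<phi> y)) has_derivative
    (\<lambda>h. \<Sum>a\<in>UNIV. partial j \<phi> z $ a * (\<Sum>i\<in>UNIV. h $ i *\<^sub>R partial i (\<lambda>y. partial a v (\<phi> y)) z)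
      + (\<Sum>i\<in>UNIV. h $ i *\<^sub>R partial i (partial j \<phi>) z) $ a * partial a v (\<phi> z))) (at z)"
  proof (intro has_derivative_sum has_derivative_mult)
    show "((\<lambda>y. partial j \<phi> y $ a) has_derivative (\<lambda>h. (\<Sum>i\<in>UNIV. h $ i *\<^sub>R partial i (partial j \<phi>) z) $ a)) (at z)" for a
      by (rule bounded_linear.has_derivative[OF bounded_linear_vec_nth has_derivative_partial[OF d\<phi>(2)[OF U(2)]]])
    show "((\<lambda>y. partial a v (\<phi> y)) has_derivative (\<lambda>h. \<Sum>i\<in>UNIV. h $ i *\<^sub>R partial i (\<lambda>y. partial a v (\<phi> y)) z)) (at z)" for a
      by (rule has_derivative_partial, rule differentiable_compose[of "partial a v" \<phi>])
        (use d\<phi>(1)[OF U(2)] dv(2)[OF \<phi>(2)[OF U(2)]] in auto)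
  qed
  from partial_eqI[OF this, of i]
  have "partial i (\<lambda>y. \<Sum>a\<in>UNIV. partial j \<phi> y $ a * partial a v (\<phi> y)) z
    = (\<Sum>a\<in>UNIV. partial j \<phi> z $ a * partial i (\<lambda>y. partial a v (\<phi> y)) z + partial i (partial j \<phi>) z $ a * partial a v (\<phi> z))"
    by (simp add: axis_def if_distrib[of "\<lambda>c. c * _"] if_distrib[of "\<lambda>c. c *\<^sub>R _"] cong: if_cong)
  also have "partial i (\<lambda>y. \<Sum>a\<in>UNIV. partial j \<phi> y $ a * partial a v (\<phi> y)) z = partial i (partial j (\<lambda>z. v (\<phi> z))) z"
    by (rule partial_cong_open[OF U]) (simp add: partial_compose d\<phi>(1) dv(1) \<phi>(2))
  also have "(\<Sum>a\<in>UNIV. partial j \<phi> z $ a * partial i (\<lambda>y. partial a v (\<phi> y)) z + partial i (partial j \<phi>) z $ a * partial a v (\<phi> z))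
    = (\<Sum>a\<in>UNIV. \<Sum>b\<in>UNIV. partial b (partial a v) (\<phi> z) * partial i \<phi> z $ b * partial j \<phi> z $ a)
      + (\<Sum>a\<in>UNIV. partial a v (\<phi> z) * partial i (partial j \<phi>) z $ a)"
    unfolding partial_compose[OF d\<phi>(1)[OF U(2)] dv(2)[OF \<phi>(2)[OF U(2)]]]
    by (simp add: sum.distrib sum_distrib_left mult_ac)
  moreover have "partial i (partial j \<phi>) z = isometry_hessian G z (\<phi> z) (matrix (frechet_derivative \<phi> (at z))) i j"
    by (rule partial_partial_isometry[OF U \<phi> G iso])
  ultimately show ?thesis
    by (simp only: pullback_hessian_def matrix_frechet_derivative)
qed

lemma
  fixes G :: "real^'n \<Rightarrow> real^'n^'n"
  assumes G: "Ck_on 1 V G" "\<And>y. y \<in> V \<Longrightarrow> det (G y) \<noteq> 0"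
  shows continuous_on_isometry_hessian:
      "continuous_on (V \<times> V \<times> UNIV) (\<lambda>p. isometry_hessian G (fst p) (fst (snd p)) (snd (snd p)) i j)"
    and continuous_on_pullback_hessian: "Ck_on 2 V v \<Longrightarrow>
      continuous_on (V \<times> V \<times> UNIV) (\<lambda>p. pullback_hessian G v (fst p) (fst (snd p)) (snd (snd p)) i j)"
proof -
  let ?Q = "V \<times> V \<times> (UNIV :: (real^'n^'n) set)"
  have fst: "continuous_on ?Q (\<lambda>p. f (fst p))" if "continuous_on V f" for f :: "real^'n \<Rightarrow> 'b::topological_space"
    by (rule continuous_on_compose2[OF that]) (auto intro!: continuous_intros)
  have snd: "continuous_on ?Q (\<lambda>p. f (fst (snd p)))" if "continuous_on V f" for f :: "real^'n \<Rightarrow> 'b::topological_space"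
    by (rule continuous_on_compose2[OF that]) (auto intro!: continuous_intros)
  have D: "continuous_on ?Q (\<lambda>p. snd (snd p) $ a $ b)" for a b
    by (intro continuous_intros)
  have dG: "continuous_on V (partial c G)" for c using G(1) by simp
  have S: "continuous_on ?Q (\<lambda>p. metric_defect G (fst p) (fst (snd p)) (snd (snd p)) k l m)" for k l m
    unfolding metric_defect_def by (intro continuous_intros D fst[OF dG] snd[OF dG])
  have inv: "continuous_on V (\<lambda>z. matrix_inv (G z))"
    by (rule continuous_on_matrix_inv[OF Ck_on_continuous_on[OF G(1)] G(2)])
  show H: "continuous_on ?Q (\<lambda>p. isometry_hessian G (fst p) (fst (snd p)) (snd (snd p)) i j)"
    unfolding isometry_hessian_def
    by (intro continuous_on_matrix_vector_mult continuous_on_vec_lambda continuous_intros S fst[OF inv]) auto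
  assume v: "Ck_on 2 V v"
  have dv: "continuous_on V (partial a v)" "continuous_on V (partial b (partial a v))" for a b
    using v by (auto simp: numeral_2_eq_2 intro!: continuous_at_imp_continuous_on differentiable_imp_continuous_within)
  show "continuous_on ?Q (\<lambda>p. pullback_hessian G v (fst p) (fst (snd p)) (snd (snd p)) i j)"
    unfolding pullback_hessian_def
    by (intro continuous_intros D snd[OF dv(1)] snd[OF dv(2)] H)
qed

section \<open>Compactness and equicontinuity of pulled back Hessians\<close>

lemma Lipschitz_from_partials:
  fixes f :: "real^'n \<Rightarrow> real"
  assumes f: "\<And>z. norm z < r \<Longrightarrow> f differentiable (at z)" "\<And>i z. norm z < r \<Longrightarrow> \<bar>partial i f z\<bar> \<le> B"
    and z: "norm z < r"
  shows "\<bar>f z - f 0\<bar> \<le> real CARD('n) * B * norm z"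
proof -
  have tz: "norm (0 + t *\<^sub>R z) < r" if "0 \<le> t" "t \<le> 1" for t
  proof -
    have "t * norm z \<le> norm z" using that by (simp add: mult_left_le_one_le)
    then have "t * norm z < r" using z by linarith
    with that show ?thesis by simp
  qed
  have "((\<lambda>t. f (0 + t *\<^sub>R z)) has_real_derivative (\<Sum>i\<in>UNIV. z $ i * partial i f (0 + t *\<^sub>R z))) (at t)"
    if "0 \<le> t" "t \<le> 1" for t
    by (rule has_real_derivative_line[OF f(1)[OF tz[OF that]]])
  from MVT2[OF zero_less_one this] obtain t where t: "0 < t" "t < 1"
    "f (0 + 1 *\<^sub>R z) - f (0 + 0 *\<^sub>R z) = (1 - 0) * (\<Sum>i\<in>UNIV. z $ i * partial i f (0 + t *\<^sub>R z))"
    by blast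
  have "\<bar>z $ i * partial i f (0 + t *\<^sub>R z)\<bar> \<le> norm z * B" for i
    unfolding abs_mult by (intro mult_mono component_le_norm_cart f(2) tz) (use t in auto)
  then have "\<bar>\<Sum>i\<in>UNIV. z $ i * partial i f (0 + t *\<^sub>R z)\<bar> \<le> (\<Sum>i\<in>(UNIV::'n set). norm z * B)"
    by (intro order_trans[OF sum_abs] sum_mono)
  then show ?thesis using t(3) by (simp add: mult_ac)
qed

lemma norm_le_sum_nth:
  fixes x :: "'a::real_normed_vector^'n"
  shows "norm x \<le> (\<Sum>i\<in>UNIV. norm (x $ i))"
  unfolding norm_vec_def by (rule L2_set_le_sum) simp

text \<open>Let m and N be the extreme values of the metric on unit vectors over K. Then m |D e|^2
  is at most the length squared of D e at y, which equals that of e at z and is at most N. So every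
  linear isometry between tangent spaces over K has entries bounded by sqrt(N/m).\<close>

lemma isometry_derivative_bound:
  fixes G :: "real^'n \<Rightarrow> real^'n^'n"
  assumes K: "compact K" "K \<noteq> {}" and G: "continuous_on K G"
    and pos: "\<And>y v. y \<in> K \<Longrightarrow> v \<noteq> 0 \<Longrightarrow> v \<bullet> (G y *v v) > 0"
  shows "\<exists>L>0. \<forall>z\<in>K. \<forall>y\<in>K. \<forall>D. G z = transpose D ** G y ** D \<longrightarrow> (\<forall>a i. \<bar>D $ a $ i\<bar> \<le> L)"
proof -
  let ?Q = "K \<times> sphere (0::real^'n) 1" and ?q = "\<lambda>p. snd p \<bullet> (G (fst p) *v snd p)"
  have Q: "compact ?Q" by (intro compact_Times K compact_sphere)
  have cont: "continuous_on ?Q ?q"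
    by (intro continuous_intros continuous_on_matrix_vector_mult continuous_on_compose2[OF G]) auto
  have "axis undefined 1 \<in> sphere (0::real^'n) 1" by simp
  then have ne: "?Q \<noteq> {}" using K(2) by blast
  obtain p where p: "p \<in> ?Q" "\<And>q. q \<in> ?Q \<Longrightarrow> ?q p \<le> ?q q"
    using continuous_attains_inf[OF Q ne cont] by blast
  obtain p' where p': "p' \<in> ?Q" "\<And>q. q \<in> ?Q \<Longrightarrow> ?q q \<le> ?q p'"
    using continuous_attains_sup[OF Q ne cont] by blast
  define m where "m = ?q p"
  define N where "N = ?q p'"
  have m: "m > 0" unfolding m_def using p(1) by (intro pos) auto
  have N: "N > 0" using p'(2)[OF p(1)] m by (simp add: N_def m_def)
  have lower: "m * (norm w)\<^sup>2 \<le> w \<bullet> (G y *v w)" if "y \<in> K" for y w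
  proof (cases "w = 0")
    case False
    have "m \<le> sgn w \<bullet> (G y *v sgn w)"
      using p(2)[of "(y, sgn w)"] that False by (simp add: m_def norm_sgn)
    also have "\<dots> = (w \<bullet> (G y *v w)) / (norm w)\<^sup>2"
      by (simp add: sgn_div_norm matrix_vector_mult_scaleR power2_eq_square field_simps)
    finally show ?thesis using False by (simp add: field_simps)
  qed simp
  have upper: "w \<bullet> (G y *v w) \<le> N" if "y \<in> K" "norm w = 1" for y w
    using p'(2)[of "(y, w)"] that by (simp add: N_def)
  have "\<bar>D $ a $ i\<bar> \<le> sqrt (N / m)" if "z \<in> K" "y \<in> K" "G z = transpose D ** G y ** D" for z y D a i
  proof -
    have "m * (norm (D *v axis i 1))\<^sup>2 \<le> (D *v axis i 1) \<bullet> (G y *v (D *v axis i 1))"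
      by (rule lower[OF that(2)])
    also have "\<dots> = axis i 1 \<bullet> (G z *v axis i 1)"
      unfolding that(3) by (rule quadratic_form_transform[symmetric])
    also have "\<dots> \<le> N" by (rule upper[OF that(1)]) simp
    finally have "(norm (D *v axis i 1))\<^sup>2 \<le> N / m" using m by (simp add: field_simps)
    then have "norm (D *v axis i 1) \<le> sqrt (N / m)" by (rule real_le_rsqrt)
    moreover have "D $ a $ i = (D *v axis i 1) $ a"
      by (simp add: matrix_vector_mult_basis column_def)
    ultimately show ?thesis using component_le_norm_cart[of "D *v axis i 1" a] by simp
  qed
  then show ?thesis using m N by (intro exI[of _ "sqrt (N / m)"]) auto
qed

lemma compact_family_bounded:
  fixes f :: "'i::finite \<Rightarrow> 'a::metric_space \<Rightarrow> real"
  assumes "compact Q" "\<And>i. continuous_on Q (f i)"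
  shows "\<exists>B. \<forall>i. \<forall>p\<in>Q. \<bar>f i p\<bar> \<le> B"
proof -
  have "\<exists>B. \<forall>p\<in>Q. \<bar>f i p\<bar> \<le> B" for i
    using compact_imp_bounded[OF compact_continuous_image[OF assms(2,1)]] by (auto simp: bounded_iff)
  then obtain B where B: "\<And>i p. p \<in> Q \<Longrightarrow> \<bar>f i p\<bar> \<le> B i" by metis
  have "\<bar>f i p\<bar> \<le> (\<Sum>i\<in>UNIV. \<bar>B i\<bar>)" if "p \<in> Q" for i p
    using B[OF that, of i] member_le_sum[of i UNIV "\<lambda>i. \<bar>B i\<bar>"] by fastforce
  then show ?thesis by blast
qed

lemma compact_family_uniformly_continuous:
  fixes f :: "'i::finite \<Rightarrow> 'a::metric_space \<Rightarrow> real"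
  assumes "compact Q" "\<And>i. continuous_on Q (f i)" "\<eta> > 0"
  shows "\<exists>d>0. \<forall>i. \<forall>p\<in>Q. \<forall>q\<in>Q. dist p q < d \<longrightarrow> \<bar>f i p - f i q\<bar> < \<eta>"
proof -
  have "\<exists>d>0. \<forall>p\<in>Q. \<forall>q\<in>Q. dist p q < d \<longrightarrow> \<bar>f i p - f i q\<bar> < \<eta>" for i
    using compact_uniformly_continuous[OF assms(2,1), of i] assms(3)
    unfolding uniformly_continuous_on_def dist_real_def by (metis dist_commute abs_minus_commute)
  then obtain d where d: "\<And>i. d i > 0" "\<And>i p q. p \<in> Q \<Longrightarrow> q \<in> Q \<Longrightarrow> dist p q < d i \<Longrightarrow> \<bar>f i p - f i q\<bar> < \<eta>"
    by metis
  show ?thesis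
  proof (intro exI[of _ "Min (range d)"] conjI allI ballI impI)
    show "Min (range d) > 0" using d(1) by simp
    fix i p q assume "p \<in> Q" "q \<in> Q" and *: "dist p q < Min (range d)"
    moreover have "Min (range d) \<le> d i" by simp
    ultimately show "\<bar>f i p - f i q\<bar> < \<eta>" by (intro d(2)) auto
  qed
qed

definition local_isometry ::
  "(real^'n \<Rightarrow> real^'n^'n) \<Rightarrow> (real^'n) set \<Rightarrow> (real^'n) set \<Rightarrow> (real^'n \<Rightarrow> real^'n::finite) \<Rightarrow> bool" where
  "local_isometry G U V \<phi> \<longleftrightarrow> Ck_on 2 U \<phi> \<and> (\<forall>z\<in>U. \<phi> z \<in> V \<and>
     G z = transpose (matrix (frechet_derivative \<phi> (at z))) ** G (\<phi> z) ** matrix (frechet_derivative \<phi> (at z)))"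

text \<open>What matters is the order of quantifiers: B and \<delta> do not depend on \<phi>. The
  Hessian is one fixed function, uniformly continuous on a compact set, evaluated at (z, \<phi>(z),
  D\<phi>(z)). This triple is Lipschitz in z with a constant common to all \<phi>: first derivatives
  are bounded by the isometry equation, second derivatives by the compact range of
  \<open>isometry_hessian\<close>.\<close>

lemma pullback_hessian_equicontinuous:
  fixes G :: "real^'n \<Rightarrow> real^'n^'n" and v :: "real^'n \<Rightarrow> real"
  assumes r: "0 < r" "2 * r \<le> R" and G: "Ck_on 1 (ball 0 R) G" "\<And>y. y \<in> ball 0 R \<Longrightarrow> transpose (G y) = G y"
      "\<And>y v. y \<in> ball 0 R \<Longrightarrow> v \<noteq> 0 \<Longrightarrow> v \<bullet> (G y *v v) > 0"
    and v: "Ck_on 2 (ball 0 R) v"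
  shows "\<exists>B. \<forall>\<eta>>0. \<exists>\<delta>>0. \<forall>\<phi>. local_isometry G (ball 0 r) (cball 0 (R/2)) \<phi> \<longrightarrow>
    (\<forall>i j. \<bar>partial i (partial j (\<lambda>z. v (\<phi> z))) 0\<bar> \<le> B \<and>
      (\<forall>z. norm z < \<delta> \<longrightarrow> \<bar>partial i (partial j (\<lambda>z. v (\<phi> z))) z - partial i (partial j (\<lambda>z. v (\<phi> z))) 0\<bar> < \<eta>))"
proof -
  let ?n = "real CARD('n)" and ?V = "ball (0::real^'n) R"
  define K where "K = cball (0::real^'n) (R/2)"
  have R: "0 < R" using r by simp
  have K: "compact K" "K \<noteq> {}" "K \<subseteq> ?V" using R by (auto simp: K_def)
  have det: "det (G y) \<noteq> 0" if "y \<in> ?V" for y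
    using det_pos_definite[of "G y", OF G(3)[OF that]] by simp
  have contG: "continuous_on K G"
    by (rule continuous_on_subset[OF Ck_on_continuous_on[OF G(1)] K(3)])
  obtain L where L: "L > 0" "\<And>z y D a i. z \<in> K \<Longrightarrow> y \<in> K \<Longrightarrow> G z = transpose D ** G y ** D \<Longrightarrow> \<bar>D $ a $ i\<bar> \<le> L"
    using isometry_derivative_bound[OF K(1,2) contG G(3)] K(3) by blast
  \<comment> \<open>The norm of a matrix is at most the sum of its N^2 entries, each bounded by L;
    hence the radius.\<close>
  define Q where "Q = K \<times> K \<times> cball (0::real^'n^'n) (?n * (?n * L))"
  have Q: "compact Q" "Q \<subseteq> ?V \<times> ?V \<times> UNIV"
    using K by (auto simp: Q_def intro!: compact_Times)
  let ?\<Theta> = "\<lambda>(i, j) p. pullback_hessian G v (fst p) (fst (snd p)) (snd (snd p)) i j"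
  let ?H = "\<lambda>(i, j, a) p. isometry_hessian G (fst p) (fst (snd p)) (snd (snd p)) i j $ a"
  have cont\<Theta>: "continuous_on Q (?\<Theta> ij)" for ij
    by (cases ij) (auto intro: continuous_on_subset[OF continuous_on_pullback_hessian[OF G(1) det v] Q(2)])
  have contH: "continuous_on Q (?H ij)" for ij
    by (cases ij) (auto intro!: continuous_intros intro: continuous_on_subset[OF continuous_on_isometry_hessian[OF G(1) det] Q(2)])
  obtain B where B: "\<And>ij p. p \<in> Q \<Longrightarrow> \<bar>?\<Theta> ij p\<bar> \<le> B"
    using compact_family_bounded[where f = ?\<Theta>, OF Q(1) cont\<Theta>] by blast
  obtain B2 where B2: "\<And>ij p. p \<in> Q \<Longrightarrow> \<bar>?H ij p\<bar> \<le> B2"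
    using compact_family_bounded[where f = ?H, OF Q(1) contH] by blast
  \<comment> \<open>A common Lipschitz constant: 1 for z, the second summand for \<phi> and the
    third for its Jacobian. One factor N comes from the number of partial derivatives, the others
    from summing over components and over rows.\<close>
  define C where "C = 1 + ?n * (?n * L) + ?n * (?n * (?n * \<bar>B2\<bar>))"
  have C: "C > 0" using L(1) by (simp add: C_def add_pos_nonneg)
  show ?thesis
  proof (rule exI[of _ B], intro allI impI)
    fix \<eta> :: real assume "\<eta> > 0"
    from compact_family_uniformly_continuous[where f = ?\<Theta>, OF Q(1) cont\<Theta> this]
    obtain d where "d > 0 \<and> (\<forall>ij. \<forall>p\<in>Q. \<forall>q\<in>Q. dist p q < d \<longrightarrow> \<bar>?\<Theta> ij p - ?\<Theta> ij q\<bar> < \<eta>)"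
      by (rule exE)
    then have d: "d > 0" and d\<Theta>: "\<forall>ij. \<forall>p\<in>Q. \<forall>q\<in>Q. dist p q < d \<longrightarrow> \<bar>?\<Theta> ij p - ?\<Theta> ij q\<bar> < \<eta>"
      by (rule conjunct1, rule conjunct2)
    define \<delta> where "\<delta> = min r (d / C)"
    have \<delta>: "\<delta> > 0" "\<delta> \<le> r" "\<delta> \<le> d / C" using r d C by (auto simp: \<delta>_def)
    have "\<bar>partial i (partial j (\<lambda>z. v (\<phi> z))) 0\<bar> \<le> B \<and>
      (\<forall>z. norm z < \<delta> \<longrightarrow> \<bar>partial i (partial j (\<lambda>z. v (\<phi> z))) z - partial i (partial j (\<lambda>z. v (\<phi> z))) 0\<bar> < \<eta>)"
      if \<phi>: "Ck_on 2 (ball 0 r) \<phi>" and \<phi>K: "\<And>z. z \<in> ball 0 r \<Longrightarrow> \<phi> z \<in> K"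
        and iso: "\<And>z. z \<in> ball 0 r \<Longrightarrow> G z = transpose (matrix (frechet_derivative \<phi> (at z))) ** G (\<phi> z) ** matrix (frechet_derivative \<phi> (at z))"
      for \<phi> i j
    proof -
      define M where "M z = matrix (frechet_derivative \<phi> (at z))" for z
      have M: "M z $ a $ l = partial l \<phi> z $ a" for z a l
        by (simp add: M_def matrix_frechet_derivative)
      have d\<phi>: "\<phi> differentiable (at z)" "partial l \<phi> differentiable (at z)" if "norm z < r" for z l
        using \<phi> that by (simp_all add: numeral_2_eq_2)
      have zK: "z \<in> K" if "norm z < r" for z
        using that r by (simp add: K_def)
      have M_le: "\<bar>M z $ a $ l\<bar> \<le> L" if "norm z < r" for z a l
        unfolding M_def by (rule L(2)[OF zK[OF that] \<phi>K iso]) (use that in auto)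
      have inQ: "(z, \<phi> z, M z) \<in> Q" if "norm z < r" for z
      proof -
        have "norm (M z) \<le> (\<Sum>a\<in>UNIV. norm (M z $ a))" by (rule norm_le_sum_nth)
        also have "\<dots> \<le> (\<Sum>a\<in>(UNIV::'n set). ?n * L)"
        proof (rule sum_mono)
          fix a
          have "norm (M z $ a) \<le> (\<Sum>l\<in>UNIV. norm (M z $ a $ l))" by (rule norm_le_sum_nth)
          also have "\<dots> \<le> (\<Sum>l\<in>(UNIV::'n set). L)" by (rule sum_mono) (use M_le[OF that] in simp)
          finally show "norm (M z $ a) \<le> ?n * L" by simp
        qed
        finally show ?thesis using zK[OF that] \<phi>K[of z] that by (simp add: Q_def)
      qed
      have sub: "ball 0 r \<subseteq> ?V" using r by auto
      have \<phi>V: "\<And>z. z \<in> ball 0 r \<Longrightarrow> \<phi> z \<in> ?V" using \<phi>K K(3) by blast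
      have hess: "partial k (partial l \<phi>) z = isometry_hessian G z (\<phi> z) (M z) k l" if "norm z < r" for k l z
        unfolding M_def
        by (rule partial_partial_isometry[OF open_ball _ \<phi> \<phi>V G(1) sub G(2) _ iso]) (use that sub det in auto)
      have \<Theta>: "partial i (partial j (\<lambda>z. v (\<phi> z))) z = ?\<Theta> (i, j) (z, \<phi> z, M z)" if "norm z < r" for z i j
        unfolding M_def fst_conv snd_conv case_prod_conv
        by (rule partial_partial_compose_isometry[OF open_ball _ \<phi> \<phi>V G(1) sub G(2) _ iso v]) (use that sub det in auto)
      have lip\<phi>: "norm (\<phi> z - \<phi> 0) \<le> ?n * (?n * L) * norm z" if z: "norm z < r" for z
      proof -
        have "\<bar>\<phi> z $ a - \<phi> 0 $ a\<bar> \<le> ?n * L * norm z" for a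
        proof (rule Lipschitz_from_partials[where f = "\<lambda>z. \<phi> z $ a", OF _ _ z])
          fix y :: "real^'n" and l assume y: "norm y < r"
          show "(\<lambda>z. \<phi> z $ a) differentiable (at y)"
            using bounded_linear.has_derivative[OF bounded_linear_vec_nth has_derivative_partial[OF d\<phi>(1)[OF y]]]
            by (rule differentiableI)
          show "\<bar>partial l (\<lambda>z. \<phi> z $ a) y\<bar> \<le> L"
            using M_le[OF y, of a l] by (simp add: partial_nth d\<phi>(1)[OF y] M)
        qed
        then have "(\<Sum>a\<in>UNIV. norm ((\<phi> z - \<phi> 0) $ a)) \<le> (\<Sum>a\<in>(UNIV::'n set). ?n * L * norm z)"
          by (intro sum_mono) simp
        then show ?thesis
          using norm_le_sum_nth[of "\<phi> z - \<phi> 0"] by simp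
      qed
      have lipM: "norm (M z - M 0) \<le> ?n * (?n * (?n * \<bar>B2\<bar>)) * norm z" if z: "norm z < r" for z
      proof -
        have "\<bar>M z $ a $ l - M 0 $ a $ l\<bar> \<le> ?n * \<bar>B2\<bar> * norm z" for a l
          unfolding M
        proof (rule Lipschitz_from_partials[where f = "\<lambda>z. partial l \<phi> z $ a", OF _ _ z])
          fix y :: "real^'n" and k assume y: "norm y < r"
          show "(\<lambda>z. partial l \<phi> z $ a) differentiable (at y)"
            using bounded_linear.has_derivative[OF bounded_linear_vec_nth has_derivative_partial[OF d\<phi>(2)[OF y]]]
            by (rule differentiableI)
          show "\<bar>partial k (\<lambda>z. partial l \<phi> z $ a) y\<bar> \<le> \<bar>B2\<bar>"
            using B2[OF inQ[OF y], of "(k, l, a)"] by (simp add: partial_nth d\<phi>(2)[OF y] hess[OF y])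
        qed
        then have *: "(\<Sum>l\<in>UNIV. norm ((M z - M 0) $ a $ l)) \<le> (\<Sum>l\<in>(UNIV::'n set). ?n * \<bar>B2\<bar> * norm z)" for a
          by (intro sum_mono) simp
        have "norm ((M z - M 0) $ a) \<le> ?n * (?n * \<bar>B2\<bar>) * norm z" for a
          using order_trans[OF norm_le_sum_nth *, of a] by simp
        then have "(\<Sum>a\<in>UNIV. norm ((M z - M 0) $ a)) \<le> (\<Sum>a\<in>(UNIV::'n set). ?n * (?n * \<bar>B2\<bar>) * norm z)"
          by (intro sum_mono)
        then show ?thesis
          using norm_le_sum_nth[of "M z - M 0"] by simp
      qed
      have "\<bar>partial i (partial j (\<lambda>z. v (\<phi> z))) z - partial i (partial j (\<lambda>z. v (\<phi> z))) 0\<bar> < \<eta>"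
        if z: "norm z < \<delta>" for z
      proof -
        have zr: "norm z < r" and 0: "norm (0::real^'n) < r" using z \<delta> r by auto
        have "dist (z, \<phi> z, M z) (0, \<phi> 0, M 0) = norm (z, \<phi> z - \<phi> 0, M z - M 0)"
          by (simp add: dist_norm)
        also have "\<dots> \<le> norm z + (norm (\<phi> z - \<phi> 0) + norm (M z - M 0))"
          by (rule order_trans[OF norm_Pair_le add_left_mono[OF norm_Pair_le]])
        also have "\<dots> \<le> C * norm z"
          using lip\<phi>[OF zr] lipM[OF zr] by (simp add: C_def algebra_simps)
        also have "\<dots> < C * (d / C)"
          by (rule mult_strict_left_mono[OF _ C]) (use z \<delta> in linarith)
        also have "\<dots> = d" using C by simp
        finally show ?thesis
          unfolding \<Theta>[OF zr] \<Theta>[OF 0] by (rule d\<Theta>[rule_format, OF inQ[OF zr] inQ[OF 0]])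
      qed
      moreover have "\<bar>partial i (partial j (\<lambda>z. v (\<phi> z))) 0\<bar> \<le> B"
        unfolding \<Theta>[of 0, simplified norm_zero, OF r(1)] using B[OF inQ, of 0 "(i, j)"] r(1) by simp
      ultimately show ?thesis by blast
    qed
    then show "\<exists>\<delta>>0. \<forall>\<phi>. local_isometry G (ball 0 r) (cball 0 (R/2)) \<phi> \<longrightarrow>
    (\<forall>i j. \<bar>partial i (partial j (\<lambda>z. v (\<phi> z))) 0\<bar> \<le> B \<and>
      (\<forall>z. norm z < \<delta> \<longrightarrow> \<bar>partial i (partial j (\<lambda>z. v (\<phi> z))) z - partial i (partial j (\<lambda>z. v (\<phi> z))) 0\<bar> < \<eta>))"
      using \<delta>(1) unfolding K_def local_isometry_def by (intro exI[of _ \<delta>]) simp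
  qed
qed

section \<open>Convergence\<close>

lemma
  fixes v :: "real^'n \<Rightarrow> real"
  assumes le: "C2_holder_norm_on \<alpha> S v \<le> ennreal N" and N: "0 \<le> N" and x: "x \<in> S"
  shows C2_holder_norm_on_second: "\<bar>partial i (partial j v) x\<bar> \<le> N"
    and C2_holder_norm_on_seminorm: "y \<in> S \<Longrightarrow> \<bar>partial i (partial j v) x - partial i (partial j v) y\<bar> \<le> N * dist x y powr \<alpha>"
proof -
  let ?f = "partial i (partial j v)"
  let ?t = "\<lambda>i j. sup_norm S (partial i (partial j v)) + holder_seminorm \<alpha> S (partial i (partial j v))"
  have "?t i j \<le> (\<Sum>j\<in>UNIV. ?t i j)" by (rule member_le_sum) auto
  also have "\<dots> \<le> (\<Sum>i\<in>UNIV. \<Sum>j\<in>UNIV. ?t i j)"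
    by (rule member_le_sum[of i UNIV "\<lambda>i. \<Sum>j\<in>UNIV. ?t i j"]) auto
  also have "\<dots> \<le> C2_holder_norm_on \<alpha> S v"
    unfolding C2_holder_norm_on_def by (simp add: add_increasing)
  finally have t: "?t i j \<le> ennreal N" using le by (rule order_trans)
  have "ennreal \<bar>?f x\<bar> \<le> sup_norm S ?f"
    unfolding sup_norm_def by (rule SUP_upper[OF x])
  also have "\<dots> \<le> ennreal N"
    by (rule order_trans[OF _ t]) simp
  finally show "\<bar>?f x\<bar> \<le> N" using N by simp
  assume y: "y \<in> S"
  show "\<bar>?f x - ?f y\<bar> \<le> N * dist x y powr \<alpha>"
  proof (cases "x = y")
    case False
    have "ennreal (\<bar>?f x - ?f y\<bar> / dist x y powr \<alpha>) \<le> (SUP y\<in>S - {x}. ennreal (\<bar>?f x - ?f y\<bar> / dist x y powr \<alpha>))"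
      by (rule SUP_upper) (use y False in auto)
    also have "\<dots> \<le> holder_seminorm \<alpha> S ?f"
      unfolding holder_seminorm_def by (rule SUP_upper[OF x])
    also have "\<dots> \<le> ennreal N"
      by (rule order_trans[OF _ t]) simp
    finally have "\<bar>?f x - ?f y\<bar> / dist x y powr \<alpha> \<le> N" using N by simp
    then show ?thesis using False by (simp add: divide_le_eq)
  qed simp
qed

text \<open>The setting after one polar chart at the base point has been chosen, with the
  normalisation of J already converted into integrability of the kernel on flat space.\<close>

locale symmetric_nonlocal =
  fixes A :: "('m::{t2_space, second_countable_topology}, 'n::finite) chart set"
    and g :: "('m, 'n) metric" and \<mu> :: "'m measure" and p\<^sub>0 :: 'm and \<tau> :: "'m \<Rightarrow> 'm \<Rightarrow> 'm"
    and J :: "real \<Rightarrow> real" and \<rho> :: real and \<psi> :: "real \<Rightarrow> real" and c\<^sub>0 :: "('m, 'n) chart"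
  assumes M: "riemannian_manifold A g"
    and mu: "riemannian_measure A g \<mu>"
    and isometries: "\<And>x. riemannian_isometry A g (\<tau> x) \<and> \<tau> x x = p\<^sub>0"
    and J_nonneg: "\<And>r. r \<ge> 0 \<Longrightarrow> J r \<ge> 0"
    and J_zero: "\<And>r. r > 1 \<Longrightarrow> J r = 0"
    and J_moment: "integrable lborel (\<lambda>z::real^'n. J (norm z) * (norm z)\<^sup>2)"
    and J_integrable: "integrable lborel (\<lambda>z::real^'n. J (norm z))"
    and polar: "polar_chart A g p\<^sub>0 \<rho> \<psi> c\<^sub>0"
begin

definition moment :: real where
  "moment = integral\<^sup>L lborel (\<lambda>z::real^'n. J (norm z) * (norm z)\<^sup>2)"

definition diffusivity :: real where
  "diffusivity = 1 / (2 * real CARD('n)) * moment"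

definition chart_of :: "'m \<Rightarrow> ('m, 'n) chart" where
  "chart_of x = pullback_chart (\<tau> x) c\<^sub>0"

abbreviation local_fun :: "('m \<Rightarrow> real) \<Rightarrow> 'm \<Rightarrow> real^'n \<Rightarrow> real" where
  "local_fun u x \<equiv> u \<circ> chart_inv (chart_of x)"

abbreviation local_hess :: "('m \<Rightarrow> real) \<Rightarrow> 'm \<Rightarrow> 'n \<Rightarrow> 'n \<Rightarrow> real^'n \<Rightarrow> real" where
  "local_hess u x i j z \<equiv> partial i (partial j (local_fun u x)) z"

lemma polar_chart_of: "polar_chart A g x \<rho> \<psi> (chart_of x)"
  unfolding chart_of_def
  by (rule polar_chart_pullback[OF M conjunct1[OF isometries]]) (simp only: conjunct2[OF isometries] polar)

lemma metric_chart_of: "z \<in> ball 0 \<rho> \<Longrightarrow> g (chart_of x) z = g c\<^sub>0 z"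
  unfolding chart_of_def
  by (rule pullback_chart_metric[OF manifold_atlas[OF M] conjunct1[OF isometries] polar_chart_in[OF polar]])
    (simp only: polar_image[OF polar])

lemma rho_pos: "0 < \<rho>"
  by (rule polar_radius_pos[OF polar])

lemma moment_nonneg: "0 \<le> moment"
  unfolding moment_def using J_nonneg by (intro integral_nonneg_AE AE_I2) simp

lemma local_fun_C2:
  assumes "C2_holder_loc A \<alpha> u"
  shows "Ck_on 2 (ball 0 \<rho>) (local_fun u x)"
  using assms polar_chart_in[OF polar_chart_of[of x]] polar_image[OF polar_chart_of[of x]]
  unfolding C2_holder_loc_def Let_def by metis

text \<open>The interface between the analytic estimate and its two uses: the global bound supplies
  B and \<omega> from the Hoelder norm, the local one from equicontinuity.\<close>

definition hessian_bounds :: "('m \<Rightarrow> real) \<Rightarrow> 'm \<Rightarrow> real \<Rightarrow> real \<Rightarrow> real \<Rightarrow> bool" where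
  "hessian_bounds u x \<epsilon> \<omega> B \<longleftrightarrow> (\<forall>i j. \<bar>local_hess u x i j 0\<bar> \<le> B \<and>
    (\<forall>y. norm y \<le> \<epsilon> \<longrightarrow> \<bar>local_hess u x i j y - local_hess u x i j 0\<bar> \<le> \<omega>))"

text \<open>The threshold is independent of u and x because all charts \<open>chart_of x\<close>
  carry the same matrix and hence the same volume density.\<close>

lemma L_op_estimate:
  "\<exists>\<epsilon>\<^sub>0. 0 < \<epsilon>\<^sub>0 \<and> \<epsilon>\<^sub>0 \<le> 1 \<and> \<epsilon>\<^sub>0 \<le> \<rho> \<and>
    (\<forall>u \<alpha> \<epsilon> x \<omega> B. C2_holder_loc A \<alpha> u \<and> 0 < \<epsilon> \<and> \<epsilon> < \<epsilon>\<^sub>0 \<and> hessian_bounds u x \<epsilon> \<omega> B \<longrightarrow>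
      \<bar>L_op A g \<mu> J \<epsilon> u x - diffusivity * laplace_beltrami A g u x\<bar>
        \<le> moment * (real CARD('n))\<^sup>2 * (\<omega> + \<epsilon> * B))"
proof -
  obtain \<delta> where \<delta>: "\<delta> > 0" "\<And>z. norm z < \<delta> \<Longrightarrow> \<bar>sqrt (det (g c\<^sub>0 z)) - 1\<bar> \<le> norm z"
    using polar_density_near_0[OF M polar] by blast
  show ?thesis
  proof (intro exI[of _ "min \<delta> (min 1 \<rho>)"] conjI allI impI)
    fix u \<alpha> \<epsilon> x \<omega> B
    assume "C2_holder_loc A \<alpha> u \<and> 0 < \<epsilon> \<and> \<epsilon> < min \<delta> (min 1 \<rho>) \<and> hessian_bounds u x \<epsilon> \<omega> B"
    then have u: "C2_holder_loc A \<alpha> u" and \<epsilon>: "0 < \<epsilon>" "\<epsilon> < min \<delta> (min 1 \<rho>)"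
      and \<omega>: "\<And>i j y. norm y \<le> \<epsilon> \<Longrightarrow> \<bar>local_hess u x i j y - local_hess u x i j 0\<bar> \<le> \<omega>"
      and B: "\<And>i j. \<bar>local_hess u x i j 0\<bar> \<le> B"
      unfolding hessian_bounds_def by blast+
    have W: "\<bar>sqrt (det (g (chart_of x) z)) - 1\<bar> \<le> norm z" if "norm z \<le> \<epsilon>" for z
      using \<delta>(2)[of z] metric_chart_of[of z x] that \<epsilon> by simp
    have "\<bar>L_op A g \<mu> J \<epsilon> u x - diffusivity * laplace_beltrami A g u x\<bar>
      \<le> moment * ((real CARD('n))\<^sup>2 * \<omega> + 1/2 * \<epsilon> * (\<Sum>i\<in>UNIV. \<Sum>j\<in>UNIV. \<bar>local_hess u x i j 0\<bar>))"
      unfolding diffusivity_def moment_def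
      by (rule L_op_estimate_polar[OF M mu polar_chart_of local_fun_C2[OF u] J_nonneg J_zero J_moment J_integrable W _ _ _ \<omega>])
        (use \<epsilon> in auto)
    also have "\<dots> \<le> moment * ((real CARD('n))\<^sup>2 * \<omega> + (real CARD('n))\<^sup>2 * (\<epsilon> * B))"
    proof (intro mult_left_mono add_left_mono moment_nonneg)
      have "(\<Sum>i\<in>UNIV. \<Sum>j\<in>UNIV. \<bar>local_hess u x i j 0\<bar>) \<le> (\<Sum>i\<in>(UNIV::'n set). \<Sum>j\<in>(UNIV::'n set). B)"
        by (intro sum_mono B)
      also have "\<dots> = (real CARD('n))\<^sup>2 * B" by (simp add: power2_eq_square)
      finally have "1/2 * \<epsilon> * (\<Sum>i\<in>UNIV. \<Sum>j\<in>UNIV. \<bar>local_hess u x i j 0\<bar>) \<le> 1/2 * \<epsilon> * ((real CARD('n))\<^sup>2 * B)"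
        using \<epsilon> by (intro mult_left_mono) auto
      also have "\<dots> \<le> (real CARD('n))\<^sup>2 * (\<epsilon> * B)"
      proof -
        have "0 \<le> B" using B[of undefined undefined] by linarith
        then have "0 \<le> (real CARD('n))\<^sup>2 * (\<epsilon> * B)" using \<epsilon> by simp
        then show ?thesis by (simp add: mult_ac)
      qed
      finally show "1/2 * \<epsilon> * (\<Sum>i\<in>UNIV. \<Sum>j\<in>UNIV. \<bar>local_hess u x i j 0\<bar>) \<le> (real CARD('n))\<^sup>2 * (\<epsilon> * B)" .
    qed
    also have "\<dots> = moment * (real CARD('n))\<^sup>2 * (\<omega> + \<epsilon> * B)"
      by (simp only: distrib_left mult.assoc)
    finally show "\<bar>L_op A g \<mu> J \<epsilon> u x - diffusivity * laplace_beltrami A g u x\<bar>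
        \<le> moment * (real CARD('n))\<^sup>2 * (\<omega> + \<epsilon> * B)" .
  qed (use \<delta>(1) rho_pos in auto)
qed

text \<open>The global norm is a supremum over all polar charts of radius \<rho>, among them every
  \<open>chart_of x\<close>, so its value bounds the Hessians at all points at once.\<close>

lemma global_estimate:
  assumes \<alpha>: "0 < \<alpha>" "\<alpha> \<le> 1"
  shows "\<exists>C \<epsilon>\<^sub>0. 0 < \<epsilon>\<^sub>0 \<and> (\<forall>u \<epsilon> x. C2_holder A g \<rho> \<alpha> u \<and> 0 < \<epsilon> \<and> \<epsilon> < \<epsilon>\<^sub>0 \<longrightarrow>
      \<bar>L_op A g \<mu> J \<epsilon> u x - diffusivity * laplace_beltrami A g u x\<bar>
        \<le> C * enn2real (C2_holder_norm A g \<rho> \<alpha> u) * \<epsilon> powr \<alpha>)"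
proof -
  obtain \<epsilon>\<^sub>0 where \<epsilon>\<^sub>0: "0 < \<epsilon>\<^sub>0" "\<epsilon>\<^sub>0 \<le> 1" "\<epsilon>\<^sub>0 \<le> \<rho>"
    and est: "\<forall>u \<alpha> \<epsilon> x \<omega> B. C2_holder_loc A \<alpha> u \<and> 0 < \<epsilon> \<and> \<epsilon> < \<epsilon>\<^sub>0 \<and> hessian_bounds u x \<epsilon> \<omega> B \<longrightarrow>
      \<bar>L_op A g \<mu> J \<epsilon> u x - diffusivity * laplace_beltrami A g u x\<bar>
        \<le> moment * (real CARD('n))\<^sup>2 * (\<omega> + \<epsilon> * B)"
    using L_op_estimate by (elim exE conjE) (rule that)
  show ?thesis
  \<comment> \<open>The 2 counts the modulus N \<epsilon>^\<alpha> of the Hessian and the density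
    error \<epsilon> N, which is at most N \<epsilon>^\<alpha> because \<epsilon> < 1 and \<alpha>
    \<le> 1.\<close>
  proof (rule exI[of _ "moment * (real CARD('n))\<^sup>2 * 2"], rule exI[of _ \<epsilon>\<^sub>0], intro conjI allI impI)
    show "0 < \<epsilon>\<^sub>0" by (rule \<epsilon>\<^sub>0(1))
    fix u \<epsilon> x
    assume "C2_holder A g \<rho> \<alpha> u \<and> 0 < \<epsilon> \<and> \<epsilon> < \<epsilon>\<^sub>0"
    then have u: "C2_holder A g \<rho> \<alpha> u" and \<epsilon>: "0 < \<epsilon>" "\<epsilon> < \<epsilon>\<^sub>0" by auto
    define N where "N = enn2real (C2_holder_norm A g \<rho> \<alpha> u)"
    have N: "0 \<le> N" by (simp add: N_def)
    have loc: "C2_holder_loc A \<alpha> u" and fin: "C2_holder_norm A g \<rho> \<alpha> u < \<infinity>"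
      using u by (auto simp: C2_holder_def)
    have "C2_holder_norm_on \<alpha> (ball 0 \<rho>) (local_fun u x) \<le> C2_holder_norm A g \<rho> \<alpha> u"
      unfolding C2_holder_norm_def by (rule SUP_upper) (use polar_chart_of in blast)
    also have "\<dots> = ennreal N" using fin by (simp add: N_def)
    finally have on: "C2_holder_norm_on \<alpha> (ball 0 \<rho>) (local_fun u x) \<le> ennreal N" .
    have 0: "0 \<in> ball (0::real^'n) \<rho>" using rho_pos by simp
    have "hessian_bounds u x \<epsilon> (N * \<epsilon> powr \<alpha>) N"
      unfolding hessian_bounds_def
    proof (intro allI conjI impI)
      show "\<bar>local_hess u x i j 0\<bar> \<le> N" for i j
        by (rule C2_holder_norm_on_second[OF on N 0])
      fix i j and y :: "real^'n" assume y: "norm y \<le> \<epsilon>"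
      then have "y \<in> ball 0 \<rho>" using \<epsilon> \<epsilon>\<^sub>0 by simp
      from C2_holder_norm_on_seminorm[OF on N this 0]
      have "\<bar>local_hess u x i j y - local_hess u x i j 0\<bar> \<le> N * norm y powr \<alpha>"
        by simp
      also have "\<dots> \<le> N * \<epsilon> powr \<alpha>"
        using y \<alpha> by (intro mult_left_mono powr_mono2 N) auto
      finally show "\<bar>local_hess u x i j y - local_hess u x i j 0\<bar> \<le> N * \<epsilon> powr \<alpha>" .
    qed
    then have "\<bar>L_op A g \<mu> J \<epsilon> u x - diffusivity * laplace_beltrami A g u x\<bar>
        \<le> moment * (real CARD('n))\<^sup>2 * (N * \<epsilon> powr \<alpha> + \<epsilon> * N)"
      by (intro est[rule_format, of \<alpha>] conjI loc \<epsilon>)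
    also have "\<dots> \<le> moment * (real CARD('n))\<^sup>2 * (N * \<epsilon> powr \<alpha> + N * \<epsilon> powr \<alpha>)"
    proof (intro mult_left_mono add_left_mono mult_nonneg_nonneg moment_nonneg)
      have "\<epsilon> powr 1 \<le> \<epsilon> powr \<alpha>"
        using \<alpha> \<epsilon> \<epsilon>\<^sub>0 by (intro powr_mono') auto
      then show "\<epsilon> * N \<le> N * \<epsilon> powr \<alpha>"
        using \<epsilon> mult_left_mono[OF _ N, of \<epsilon> "\<epsilon> powr \<alpha>"] by (simp add: mult.commute)
    qed simp
    also have "\<dots> = moment * (real CARD('n))\<^sup>2 * 2 * N * \<epsilon> powr \<alpha>" by simp
    finally show "\<bar>L_op A g \<mu> J \<epsilon> u x - diffusivity * laplace_beltrami A g u x\<bar>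
        \<le> moment * (real CARD('n))\<^sup>2 * 2 * enn2real (C2_holder_norm A g \<rho> \<alpha> u) * \<epsilon> powr \<alpha>"
      by (simp only: N_def)
  qed
qed

lemma global_convergence:
  assumes \<alpha>: "0 < \<alpha>" "\<alpha> \<le> 1" and u: "C2_holder A g \<rho> \<alpha> u"
  shows "uniform_limit UNIV (\<lambda>\<epsilon>. L_op A g \<mu> J \<epsilon> u)
    (\<lambda>x. diffusivity * laplace_beltrami A g u x) (at_right 0)"
proof -
  obtain C \<epsilon>\<^sub>0 where \<epsilon>\<^sub>0: "0 < \<epsilon>\<^sub>0" and est: "\<forall>u \<epsilon> x. C2_holder A g \<rho> \<alpha> u \<and> 0 < \<epsilon> \<and> \<epsilon> < \<epsilon>\<^sub>0 \<longrightarrow>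
      \<bar>L_op A g \<mu> J \<epsilon> u x - diffusivity * laplace_beltrami A g u x\<bar>
        \<le> C * enn2real (C2_holder_norm A g \<rho> \<alpha> u) * \<epsilon> powr \<alpha>"
    using global_estimate[OF \<alpha>] by (elim exE conjE) (rule that)
  show ?thesis
    unfolding uniform_limit_iff
  proof (intro allI impI)
    fix e :: real assume e: "0 < e"
    have "((\<lambda>\<epsilon>::real. \<epsilon> powr \<alpha>) \<longlongrightarrow> 0) (at_right 0)"
      by (rule tendsto_zero_powrI[OF _ tendsto_const]) (use \<alpha> in \<open>auto intro: tendsto_ident_at simp: eventually_at_filter\<close>)
    then have "((\<lambda>\<epsilon>. C * enn2real (C2_holder_norm A g \<rho> \<alpha> u) * \<epsilon> powr \<alpha>) \<longlongrightarrow> 0) (at_right 0)"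
      by (rule tendsto_mult_right_zero)
    then have "\<forall>\<^sub>F \<epsilon> in at_right 0. C * enn2real (C2_holder_norm A g \<rho> \<alpha> u) * \<epsilon> powr \<alpha> < e"
      by (rule order_tendstoD(2)) (rule e)
    moreover have "\<forall>\<^sub>F \<epsilon> in at_right 0. 0 < \<epsilon> \<and> \<epsilon> < \<epsilon>\<^sub>0"
      using \<epsilon>\<^sub>0 by (auto simp: eventually_at_right_field)
    ultimately show "\<forall>\<^sub>F \<epsilon> in at_right 0. \<forall>x\<in>UNIV. dist (L_op A g \<mu> J \<epsilon> u x)
        (diffusivity * laplace_beltrami A g u x) < e"
    proof eventually_elim
      case (elim \<epsilon>)
      show ?case
        unfolding dist_real_def using est[rule_format, of u \<epsilon>] u elim by (auto intro: le_less_trans)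
    qed
  qed
qed

text \<open>By the triangle inequality the ball of radius \<rho>/4 around x lies within distance
  \<rho>/2 of p. The transition map is thus defined on the whole small ball and takes values in a
  compact part of the large one. It preserves \<open>g c\<^sub>0\<close> because both charts see
  this same matrix.\<close>

lemma transition_isometry:
  assumes x: "geodesic_dist A g p x < \<rho> / 4"
  defines "\<phi> \<equiv> local_rep id (chart_of x) (chart_of p)"
  shows "local_isometry (g c\<^sub>0) (ball 0 (\<rho> / 4)) (cball 0 (\<rho> / 2)) \<phi>"
    and "z \<in> ball 0 (\<rho> / 4) \<Longrightarrow> local_fun u p (\<phi> z) = local_fun u x z"
proof -
  note A = manifold_atlas[OF M]
  let ?c = "chart_of x" and ?c' = "chart_of p"
  note c = polar_chart_in[OF polar_chart_of[of x]] and c' = polar_chart_in[OF polar_chart_of[of p]]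
  note chart = atlas_chart[OF A c] and chart' = atlas_chart[OF A c']
  have dist_le: "geodesic_dist A g p (chart_inv ?c z) < \<rho> / 2" if z: "z \<in> ball 0 (\<rho> / 4)" for z
  proof -
    have im: "z \<in> chart_image ?c"
      using z rho_pos by (simp add: polar_image[OF polar_chart_of])
    have "geodesic_dist A g x (chart_inv ?c z) = norm z"
      using polar_dist[OF polar_chart_of chart_inv_in[OF im]] f_chart_inv[OF im] by simp
    then show ?thesis
      using geodesic_dist_triangle[where p = p and q = x and r = "chart_inv ?c z", OF M
          geodesic_edist_finite[OF A polar_chart_of] geodesic_edist_finite[OF A polar_chart_of]] x z by simp
  qed
  have in_c': "chart_inv ?c z \<in> fst ?c'" if "z \<in> ball 0 (\<rho> / 4)" for z
    using dist_le[OF that] rho_pos by (simp add: polar_domain[OF polar_chart_of])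
  have dom: "z \<in> local_dom id ?c ?c'" if "z \<in> ball 0 (\<rho> / 4)" for z
    using in_c'[OF that] that rho_pos by (simp add: local_dom_iff[OF chart] polar_image[OF polar_chart_of])
  have \<phi>_in: "\<phi> z \<in> cball 0 (\<rho> / 2)" if z: "z \<in> ball 0 (\<rho> / 4)" for z
    using polar_dist[OF polar_chart_of in_c'[OF z]] dist_le[OF z] by (simp add: \<phi>_def local_rep_def)
  have "Ck_on 3 (local_dom id ?c ?c') \<phi>"
    using atlas_compatible[OF A c c'] by (simp add: compatible_def \<phi>_def)
  then have "Ck_on (Suc 2) (local_dom id ?c ?c') \<phi>" by (simp only: eval_nat_numeral)
  then have "Ck_on 2 (ball 0 (\<rho> / 4)) \<phi>"
    by (rule Ck_on_subset[OF Ck_on_decr]) (use dom in blast)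
  moreover have "g c\<^sub>0 z = transpose (matrix (frechet_derivative \<phi> (at z))) ** g c\<^sub>0 (\<phi> z)
      ** matrix (frechet_derivative \<phi> (at z))" if z: "z \<in> ball 0 (\<rho> / 4)" for z
  proof -
    have "z \<in> ball 0 \<rho>" "\<phi> z \<in> ball 0 \<rho>" using z \<phi>_in[OF z] rho_pos by auto
    then show ?thesis
      using local_rep_id_metric[OF M c c' dom[OF z]] by (simp only: metric_chart_of \<phi>_def)
  qed
  ultimately show "local_isometry (g c\<^sub>0) (ball 0 (\<rho> / 4)) (cball 0 (\<rho> / 2)) \<phi>"
    using \<phi>_in by (simp only: local_isometry_def) blast
  show "local_fun u p (\<phi> z) = local_fun u x z" if z: "z \<in> ball 0 (\<rho> / 4)"
    using chart_inv_f[OF chart' in_c'[OF z]] by (simp add: \<phi>_def local_rep_def)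
qed

text \<open>For x near p the coordinate expression of u at x is the single function
  \<open>local_fun u p\<close> composed with a local isometry, so equicontinuity over all such
  isometries gives bounds uniform in x.\<close>

lemma local_convergence:
  assumes u: "C2_holder_loc A \<alpha> u"
  shows "\<exists>U. open U \<and> p \<in> U \<and> uniform_limit U (\<lambda>\<epsilon>. L_op A g \<mu> J \<epsilon> u)
    (\<lambda>x. diffusivity * laplace_beltrami A g u x) (at_right 0)"
proof -
  let ?r = "\<rho> / 4" and ?c = "chart_of p" and ?k = "moment * (real CARD('n))\<^sup>2"
  let ?U = "fst ?c \<inter> snd ?c -` ball 0 ?r"
  note A = manifold_atlas[OF M]
  note c = polar_chart_of[of p]
  note chart = atlas_chart[OF A polar_chart_in[OF c]]
  have "open ?U"
    by (rule continuous_open_preimage[OF chart_continuous[OF chart] chart_open[OF chart] open_ball])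
  moreover have "p \<in> ?U"
    using polar_centre_in[OF c] polar_centre[OF c] rho_pos by simp
  moreover have "uniform_limit ?U (\<lambda>\<epsilon>. L_op A g \<mu> J \<epsilon> u)
    (\<lambda>x. diffusivity * laplace_beltrami A g u x) (at_right 0)"
    unfolding uniform_limit_iff
  proof (intro allI impI)
    fix e :: real assume e: "0 < e"
    have im: "chart_image c\<^sub>0 = ball 0 \<rho>" and c\<^sub>0: "c\<^sub>0 \<in> A"
      by (rule polar_image[OF polar], rule polar_chart_in[OF polar])
    have G: "Ck_on 1 (ball 0 \<rho>) (g c\<^sub>0)"
    proof -
      have "Ck_on (Suc 1) (ball 0 \<rho>) (g c\<^sub>0)"
        using metric_Ck_on[OF M c\<^sub>0] unfolding im numeral_2_eq_2 One_nat_def .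
      then show ?thesis by (rule Ck_on_decr)
    qed
    have sym: "transpose (g c\<^sub>0 y) = g c\<^sub>0 y" if "y \<in> ball 0 \<rho>" for y
      by (rule metric_symmetric[OF M c\<^sub>0]) (use that im in simp)
    have pos: "v \<bullet> (g c\<^sub>0 y *v v) > 0" if "y \<in> ball 0 \<rho>" "v \<noteq> 0" for y v
      by (rule metric_pos[OF M c\<^sub>0]) (use that im in simp_all)
    have r: "0 < ?r" "2 * ?r \<le> \<rho>" using rho_pos by simp_all
    have "\<exists>B. \<forall>\<eta>>0. \<exists>\<delta>>0. \<forall>\<phi>. local_isometry (g c\<^sub>0) (ball 0 ?r) (cball 0 (\<rho>/2)) \<phi> \<longrightarrow>
      (\<forall>i j. \<bar>partial i (partial j (\<lambda>z. local_fun u p (\<phi> z))) 0\<bar> \<le> B \<and>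
        (\<forall>z. norm z < \<delta> \<longrightarrow> \<bar>partial i (partial j (\<lambda>z. local_fun u p (\<phi> z))) z
          - partial i (partial j (\<lambda>z. local_fun u p (\<phi> z))) 0\<bar> < \<eta>))"
      by (rule pullback_hessian_equicontinuous[OF r G sym pos local_fun_C2[OF u, of p]])
    then obtain B where B: "\<forall>\<eta>>0. \<exists>\<delta>>0. \<forall>\<phi>. local_isometry (g c\<^sub>0) (ball 0 ?r) (cball 0 (\<rho>/2)) \<phi> \<longrightarrow>
      (\<forall>i j. \<bar>partial i (partial j (\<lambda>z. local_fun u p (\<phi> z))) 0\<bar> \<le> B \<and>
        (\<forall>z. norm z < \<delta> \<longrightarrow> \<bar>partial i (partial j (\<lambda>z. local_fun u p (\<phi> z))) z
          - partial i (partial j (\<lambda>z. local_fun u p (\<phi> z))) 0\<bar> < \<eta>))"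
      by (rule exE)
    obtain \<epsilon>\<^sub>0 where \<epsilon>\<^sub>0: "0 < \<epsilon>\<^sub>0"
      and est: "\<forall>u \<alpha> \<epsilon> x \<omega> B. C2_holder_loc A \<alpha> u \<and> 0 < \<epsilon> \<and> \<epsilon> < \<epsilon>\<^sub>0 \<and> hessian_bounds u x \<epsilon> \<omega> B \<longrightarrow>
        \<bar>L_op A g \<mu> J \<epsilon> u x - diffusivity * laplace_beltrami A g u x\<bar>
          \<le> ?k * (\<omega> + \<epsilon> * B)"
      using L_op_estimate by (elim exE conjE) (rule that)
    \<comment> \<open>Chosen so that \<open>?k * (\<eta> + \<eta>)\<close> is at most e/2; adding 1
      covers a vanishing moment.\<close>
    define \<eta> where "\<eta> = e / (4 * (?k + 1))"
    have k: "0 \<le> ?k" using moment_nonneg by simp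
    have \<eta>: "\<eta> > 0" using e k by (simp add: \<eta>_def)
    obtain \<delta> where \<delta>: "\<delta> > 0" and \<delta>\<phi>: "\<forall>\<phi>. local_isometry (g c\<^sub>0) (ball 0 ?r) (cball 0 (\<rho>/2)) \<phi> \<longrightarrow>
      (\<forall>i j. \<bar>partial i (partial j (\<lambda>z. local_fun u p (\<phi> z))) 0\<bar> \<le> B \<and>
        (\<forall>z. norm z < \<delta> \<longrightarrow> \<bar>partial i (partial j (\<lambda>z. local_fun u p (\<phi> z))) z
          - partial i (partial j (\<lambda>z. local_fun u p (\<phi> z))) 0\<bar> < \<eta>))"
      using B[rule_format, OF \<eta>] by (elim exE conjE) (rule that)
    have hess: "\<bar>local_hess u x i j 0\<bar> \<le> B \<and>
        (\<forall>z. norm z < \<delta> \<and> norm z < ?r \<longrightarrow> \<bar>local_hess u x i j z - local_hess u x i j 0\<bar> < \<eta>)"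
      if x: "x \<in> ?U" for x i j
    proof -
      let ?\<phi> = "local_rep id (chart_of x) (chart_of p)"
      have d: "geodesic_dist A g p x < \<rho> / 4"
        using x polar_dist[OF c] by simp
      note t = transition_isometry[OF d]
      have "partial j (\<lambda>z. local_fun u p (?\<phi> z)) z = partial j (local_fun u x) z" if "z \<in> ball 0 ?r" for z
        by (rule partial_cong_open[OF open_ball that t(2)])
      then have eq: "partial i (partial j (\<lambda>z. local_fun u p (?\<phi> z))) z = local_hess u x i j z"
        if "z \<in> ball 0 ?r" for z
        by (rule partial_cong_open[OF open_ball that])
      have H: "\<bar>partial i (partial j (\<lambda>z. local_fun u p (?\<phi> z))) 0\<bar> \<le> B \<and>
        (\<forall>z. norm z < \<delta> \<longrightarrow> \<bar>partial i (partial j (\<lambda>z. local_fun u p (?\<phi> z))) z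
          - partial i (partial j (\<lambda>z. local_fun u p (?\<phi> z))) 0\<bar> < \<eta>)"
        using \<delta>\<phi>[rule_format, OF t(1)] by (intro conjI allI) blast+
      have eq0: "partial i (partial j (\<lambda>z. local_fun u p (?\<phi> z))) 0 = local_hess u x i j 0"
        by (rule eq) (use r(1) in simp)
      show ?thesis
      proof (intro conjI allI impI)
        show "\<bar>local_hess u x i j 0\<bar> \<le> B"
          using conjunct1[OF H] by (simp only: eq0)
        fix z :: "real^'n" assume z: "norm z < \<delta> \<and> norm z < ?r"
        then have "z \<in> ball 0 ?r" by simp
        from H[THEN conjunct2, rule_format, OF conjunct1[OF z]]
        show "\<bar>local_hess u x i j z - local_hess u x i j 0\<bar> < \<eta>"
          by (simp only: eq0 eq[OF \<open>z \<in> ball 0 ?r\<close>])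
      qed
    qed
    \<comment> \<open>The bound \<open>?r\<close> keeps the points inside the domain of the
      transition map, and the last bound makes the density error \<epsilon> B at most
      \<eta>.\<close>
    have "\<forall>\<^sub>F \<epsilon> in at_right (0::real). 0 < \<epsilon> \<and> \<epsilon> < min (min \<epsilon>\<^sub>0 \<delta>) (min ?r (\<eta> / (\<bar>B\<bar> + 1)))"
      using \<epsilon>\<^sub>0 \<delta> r(1) \<eta> by (auto simp: eventually_at_right_field intro!: exI[of _ "min (min \<epsilon>\<^sub>0 \<delta>) (min ?r (\<eta> / (\<bar>B\<bar> + 1)))"])
    then show "\<forall>\<^sub>F \<epsilon> in at_right 0. \<forall>x\<in>?U. dist (L_op A g \<mu> J \<epsilon> u x)
        (diffusivity * laplace_beltrami A g u x) < e"
    proof eventually_elim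
      case (elim \<epsilon>)
      show ?case
      proof
        fix x assume x: "x \<in> ?U"
        have "hessian_bounds u x \<epsilon> \<eta> B"
          unfolding hessian_bounds_def
        proof (intro allI conjI impI)
          show "\<bar>local_hess u x i j 0\<bar> \<le> B" for i j
            using hess[OF x] by blast
          show "\<bar>local_hess u x i j y - local_hess u x i j 0\<bar> \<le> \<eta>"
            if "norm y \<le> \<epsilon>" for i j y
            using hess[OF x, of i j] elim that by (intro less_imp_le) auto
        qed
        then have "\<bar>L_op A g \<mu> J \<epsilon> u x - diffusivity * laplace_beltrami A g u x\<bar>
          \<le> ?k * (\<eta> + \<epsilon> * B)"
          using elim u by (intro est[rule_format, of \<alpha>] conjI) auto
        also have "\<dots> \<le> ?k * (\<eta> + \<eta>)"
        proof (rule mult_left_mono[OF _ k], rule add_left_mono)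
          have "\<epsilon> * B \<le> \<epsilon> * (\<bar>B\<bar> + 1)" using elim by (intro mult_left_mono) auto
          also have "\<dots> \<le> \<eta>" using elim by (simp add: less_imp_le pos_less_divide_eq)
          finally show "\<epsilon> * B \<le> \<eta>" .
        qed
        also have "\<dots> < e"
        proof -
          have "b * (e / (4 * b) + e / (4 * b)) = e / 2" if "b > 0" for b
            using that by (simp add: field_simps)
          then have "(?k + 1) * (\<eta> + \<eta>) = e / 2" using k by (simp only: \<eta>_def)
          moreover have "?k * (\<eta> + \<eta>) \<le> (?k + 1) * (\<eta> + \<eta>)" using \<eta> by (intro mult_right_mono) auto
          ultimately show ?thesis using e by linarith
        qed
        finally show "dist (L_op A g \<mu> J \<epsilon> u x)
          (diffusivity * laplace_beltrami A g u x) < e"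
          by (simp add: dist_real_def)
      qed
    qed
  qed
  ultimately show ?thesis by blast
qed

end

theorem theorem3p1:
  fixes A :: "('m::{t2_space, second_countable_topology}, 'n::finite) chart set"
    and g :: "('m, 'n) metric"
    and \<mu> :: "'m measure"
    and p\<^sub>0 :: 'm
    and \<tau> :: "'m \<Rightarrow> 'm \<Rightarrow> 'm"
    and J :: "real \<Rightarrow> real"
    and \<alpha> \<rho> \<q> :: real
  assumes M: "riemannian_manifold A g"
    and mu: "riemannian_measure A g \<mu>"
    and isometries: "\<And>x. riemannian_isometry A g (\<tau> x) \<and> \<tau> x x = p\<^sub>0"
    and symmetric: "spherically_symmetric A g"
    and J_nonneg: "\<And>r. r \<ge> 0 \<Longrightarrow> J r \<ge> 0"
    and J_support: "closure {r. r \<ge> 0 \<and> J r \<noteq> 0} \<subseteq> {0..1}"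
    and J_normalized: "has_bochner_integral \<mu> (\<lambda>x. J (geodesic_dist A g x p\<^sub>0)) 1"
    and q_finite: "integrable lborel (\<lambda>z::real^'n. J (norm z) * (norm z)\<^sup>2)"
    and q_def: "\<q> = 1 / (2 * real CARD('n)) * integral\<^sup>L lborel (\<lambda>z::real^'n. J (norm z) * (norm z)\<^sup>2)"
    and alpha: "0 < \<alpha>" "\<alpha> \<le> 1"
    and rho: "\<exists>\<psi> c. polar_chart A g p\<^sub>0 \<rho> \<psi> c"
  shows
    "(\<forall>u. C2_holder_loc A \<alpha> u \<longrightarrow>
        (\<forall>p. \<exists>U. open U \<and> p \<in> U \<and>
           uniform_limit U (\<lambda>\<epsilon>. L_op A g \<mu> J \<epsilon> u) (\<lambda>x. \<q> * laplace_beltrami A g u x) (at_right 0))) \<and>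
     (\<forall>u. C2_holder A g \<rho> \<alpha> u \<longrightarrow>
        uniform_limit UNIV (\<lambda>\<epsilon>. L_op A g \<mu> J \<epsilon> u) (\<lambda>x. \<q> * laplace_beltrami A g u x) (at_right 0)) \<and>
     (\<exists>C \<epsilon>\<^sub>0. \<epsilon>\<^sub>0 > 0 \<and>
        (\<forall>u \<epsilon> x. C2_holder A g \<rho> \<alpha> u \<and> 0 < \<epsilon> \<and> \<epsilon> < \<epsilon>\<^sub>0 \<longrightarrow>
           \<bar>L_op A g \<mu> J \<epsilon> u x - \<q> * laplace_beltrami A g u x\<bar>
             \<le> C * enn2real (C2_holder_norm A g \<rho> \<alpha> u) * \<epsilon> powr \<alpha>))"
proof -
  obtain \<psi> c\<^sub>0 where c\<^sub>0: "polar_chart A g p\<^sub>0 \<rho> \<psi> c\<^sub>0" using rho by blast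
  \<comment> \<open>Strictly beyond 1 only: J may be nonzero at 1 itself, and accordingly the
    estimates work on the closed unit ball.\<close>
  have J_zero: "J r = 0" if "r > 1" for r
  proof (rule ccontr)
    assume "J r \<noteq> 0"
    then have "r \<in> closure {r. r \<ge> 0 \<and> J r \<noteq> 0}"
      using that by (intro closure_subset[THEN subsetD]) simp
    with J_support that show False by auto
  qed
  \<comment> \<open>The normalisation yields integrability near the centre and the moment condition
    the rest, which completes the assumptions of the locale.\<close>
  have "integrable \<mu> (\<lambda>x. J (geodesic_dist A g x p\<^sub>0))"
    using J_normalized by (rule integrable.intros)
  from integrable_radial_kernel[OF M mu c\<^sub>0 J_nonneg q_finite this]
  interpret symmetric_nonlocal A g \<mu> p\<^sub>0 \<tau> J \<rho> \<psi> c\<^sub>0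
    by (intro symmetric_nonlocal.intro M mu isometries J_nonneg J_zero q_finite c\<^sub>0)
  have q: "\<q> = diffusivity"
    by (simp only: q_def diffusivity_def moment_def)
  show ?thesis
  proof (intro conjI allI impI)
    show "\<exists>U. open U \<and> p \<in> U \<and>
        uniform_limit U (\<lambda>\<epsilon>. L_op A g \<mu> J \<epsilon> u) (\<lambda>x. \<q> * laplace_beltrami A g u x) (at_right 0)"
      if "C2_holder_loc A \<alpha> u" for u p
      by (rule local_convergence[OF that, folded q])
    show "uniform_limit UNIV (\<lambda>\<epsilon>. L_op A g \<mu> J \<epsilon> u) (\<lambda>x. \<q> * laplace_beltrami A g u x) (at_right 0)"
      if "C2_holder A g \<rho> \<alpha> u" for u
      by (rule global_convergence[OF alpha that, folded q])
  qed (rule global_estimate[OF alpha, folded q])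
qed

end
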